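(* Let $k$ be a positive integer. Then $\overline{b}(n)$ is almost always divisible by $2^k$, namely, $$\lim_{X\to\infty}\frac{\#\left\{n\le X:\ \overline{b}(n)\equiv 0\pmod{2^k}\right\}}{X}=1,$$ where $\overline{b}(n)$ denotes the number of overcubic partition pairs of $n$, i.e. the coefficients defined by $\sum_{n=0}^{\infty}\overline{b}(n)q^n=\dfrac{(-q;q)_\infty^2\,(-q^2;q^2)_\infty^2}{(q;q)_\infty^2\,(q^2;q^2)_\infty^2}$.
   Context: For $|q|<1$, $(a;q)_\infty:=\prod_{n\ge 0}(1-aq^n)$; thus, for a positive integer $j$, $(q^j;q^j)_\infty=\prod_{n\ge 1}(1-q^{jn})$ and $(-q^j;q^j)_\infty=\prod_{n\ge 1}(1+q^{jn})$. The integers $\overline{b}(n)$, $n\ge 0$, are the coefficients of the power series $\sum_{n=0}^{\infty}\overline{b}(n)q^n=\frac{(-q;q)_\infty^2(-q^2;q^2)_\infty^2}{(q;q)_\infty^2(q^2;q^2)_\infty^2}$. In the counting set, $n$ ranges over non-negative integers. *)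

theory Defs
  imports "HOL-Complex_Analysis.Complex_Analysis" "HOL-Number_Theory.Cong"
begin

definition qpochhammer_inf :: "complex \<Rightarrow> complex \<Rightarrow> complex" where
  "qpochhammer_inf a q = (\<Prod>n. 1 - a * q ^ n)"

definition overcubic_pair_gf :: "complex \<Rightarrow> complex" where
  "overcubic_pair_gf q =
     (qpochhammer_inf (- q) q)\<^sup>2 * (qpochhammer_inf (- (q ^ 2)) (q ^ 2))\<^sup>2 /
     ((qpochhammer_inf q q)\<^sup>2 * (qpochhammer_inf (q ^ 2) (q ^ 2))\<^sup>2)"

text \<open>
  The number of overcubic partition pairs of \<open>n\<close>.  The description determines exactly one integer
  sequence: see \<open>ex1_overcubic_pair_coeffs\<close> and \<open>overcubic_pair_sums\<close> below.
\<close>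
definition overcubic_pair :: "nat \<Rightarrow> int" where
  "overcubic_pair = (THE b. \<forall>q::complex. norm q < 1 \<longrightarrow>
     (\<lambda>n. of_int (b n) * q ^ n) sums overcubic_pair_gf q)"

definition int_series :: "(complex \<Rightarrow> complex) \<Rightarrow> bool" where
  "int_series f \<longleftrightarrow> f holomorphic_on ball 0 1 \<and>
     (\<exists>F. f has_fps_expansion F \<and> (\<forall>n. fps_nth F n \<in> \<int>))"

lemma int_series_mult:
  assumes "int_series f" "int_series g"
  shows "int_series (\<lambda>q. f q * g q)"
proof -
  obtain F G where "f has_fps_expansion F" "g has_fps_expansion G"
      "\<And>n. fps_nth F n \<in> \<int>" "\<And>n. fps_nth G n \<in> \<int>"
    using assms unfolding int_series_def by blast
  then have "(\<lambda>q. f q * g q) has_fps_expansion F * G" "\<And>n. fps_nth (F * G) n \<in> \<int>"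
    by (auto simp: fps_mult_nth intro!: has_fps_expansion_mult Ints_sum)
  then show ?thesis
    using assms unfolding int_series_def by (auto intro!: holomorphic_intros)
qed

lemma int_series_inverse:
  assumes "int_series f" "f 0 = 1" "\<And>q. norm q < 1 \<Longrightarrow> f q \<noteq> 0"
  shows "int_series (\<lambda>q. inverse (f q))"
proof -
  obtain F where F: "f has_fps_expansion F" "\<And>n. fps_nth F n \<in> \<int>"
    using assms unfolding int_series_def by blast
  have F0: "fps_nth F 0 = 1"
    using has_fps_expansion_imp_0_eq_fps_nth_0[OF F(1)] assms(2) by simp
  have "fps_nth (inverse F) n \<in> \<int>" for n
  proof (induction n rule: less_induct)
    case (less n)
    show ?case
    proof (cases "n = 0")
      case True
      then show ?thesis by (simp add: F0)
    next
      case False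
      have "inverse F * F = 1"
        by (rule inverse_mult_eq_1) (simp add: F0)
      then have "(\<Sum>i=0..n. fps_nth (inverse F) i * fps_nth F (n - i)) = 0"
        using False by (metis fps_mult_nth fps_one_nth)
      moreover have "{0..n} = insert n {0..<n}" by auto
      ultimately have "fps_nth (inverse F) n =
          - (\<Sum>i=0..<n. fps_nth (inverse F) i * fps_nth F (n - i))"
        by (simp add: F0 eq_neg_iff_add_eq_0)
      also have "\<dots> \<in> \<int>"
        using less F(2) by (intro Ints_minus Ints_sum Ints_mult) auto
      finally show ?thesis .
    qed
  qed
  moreover have "(\<lambda>q. inverse (f q)) has_fps_expansion inverse F"
    by (rule has_fps_expansion_inverse) (use F F0 in auto)
  ultimately show ?thesis
    using assms unfolding int_series_def by (auto intro!: holomorphic_intros)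
qed

lemma int_series_factor:
  assumes "c \<in> \<int>"
  shows "int_series (\<lambda>q. 1 - c * q ^ m)"
proof -
  have "(\<lambda>q. 1 - c * q ^ m) has_fps_expansion 1 - fps_const c * fps_X ^ m"
    by (intro fps_expansion_intros)
  moreover have "fps_nth (1 - fps_const c * fps_X ^ m) n \<in> \<int>" for n
    using assms by (auto simp: fps_X_power_nth)
  ultimately show ?thesis
    unfolding int_series_def by (auto intro!: holomorphic_intros)
qed

lemma int_series_prod:
  fixes N :: nat
  assumes "\<And>n. int_series (f n)"
  shows "int_series (\<lambda>q. \<Prod>n<N. f n q)"
proof (induction N)
  case 0
  then show ?case
    using int_series_factor[of 0 0] by simp
next
  case (Suc N)
  then show ?case
    using int_series_mult[OF Suc assms[of N]] by simp
qed

lemma int_series_limit: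
  assumes f: "\<And>N. int_series (f N)"
    and lim: "\<And>r. 0 < r \<Longrightarrow> r < 1 \<Longrightarrow> uniform_limit (cball 0 r) f g sequentially"
  shows "int_series g"
proof -
  have hol: "g holomorphic_on ball 0 1"
  proof (rule holomorphic_uniform_sequence[where f = f])
    fix x :: complex assume x: "x \<in> ball 0 1"
    define d where "d = (1 - norm x) / 2"
    have "d > 0" "norm x + d < 1"
      using x by (auto simp: d_def field_simps)
    moreover have "cball x d \<subseteq> cball 0 (norm x + d)"
      by (rule cball_subset_cball_iff[THEN iffD2]) simp
    moreover have "cball x d \<subseteq> ball 0 1"
      using calculation by (force simp: subset_iff)
    ultimately show "\<exists>d>0. cball x d \<subseteq> ball 0 1 \<and> uniform_limit (cball x d) f g sequentially"
      using lim[of "norm x + d"] by (meson uniform_limit_on_subset add_nonneg_pos norm_ge_zero)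
  qed (use f in \<open>auto simp: int_series_def\<close>)
  have exp_g: "g has_fps_expansion fps_expansion g 0"
    by (rule has_fps_expansion_fps_expansion[of "ball 0 1"]) (use hol in auto)
  have "(\<lambda>N. (deriv ^^ n) (f N) 0 / fact n) \<longlonglongrightarrow> (deriv ^^ n) g 0 / fact n" for n
  proof (intro tendsto_intros higher_deriv_complex_uniform_limit[where A = "ball 0 (1/2)"])
    show "uniform_limit (ball 0 (1/2)) f g sequentially"
      by (rule uniform_limit_on_subset[OF lim[of "1/2"]]) auto
    show "\<forall>\<^sub>F n in sequentially. f n holomorphic_on ball 0 (1/2)"
    proof (intro always_eventually allI)
      fix n
      have "f n holomorphic_on ball 0 1"
        using f[of n] by (simp add: int_series_def)
      then show "f n holomorphic_on ball 0 (1/2)"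
        by (rule holomorphic_on_subset) auto
    qed
  qed auto
  moreover have "(deriv ^^ n) (f N) 0 / fact n \<in> \<int>" for n N
  proof -
    obtain F where "f N has_fps_expansion F" "fps_nth F n \<in> \<int>"
      using f[of N] unfolding int_series_def by blast
    then show ?thesis
      using fps_nth_fps_expansion[of "f N" F n] by simp
  qed
  ultimately have "(deriv ^^ n) g 0 / fact n \<in> \<int>" for n
    by (metis (no_types, lifting) closed_sequentially[OF closed_Ints])
  then have "fps_nth (fps_expansion g 0) n \<in> \<int>" for n
    by (simp add: fps_expansion_def)
  then show ?thesis
    using hol exp_g unfolding int_series_def by blast
qed

lemma
  fixes c :: complex and j :: nat
  assumes c: "c \<in> \<int>" "norm c = 1" and j: "j > 0"
  shows int_series_qpochhammer: "int_series (\<lambda>q. qpochhammer_inf (c * q ^ j) (q ^ j))"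
    and qpochhammer_nonzero: "\<And>q. norm q < 1 \<Longrightarrow> qpochhammer_inf (c * q ^ j) (q ^ j) \<noteq> 0"
    and qpochhammer_at_0: "qpochhammer_inf (c * 0 ^ j) (0 ^ j) = 1"
proof -
  have eq: "c * q ^ j * (q ^ j) ^ n = c * q ^ (j * Suc n)" for q n
    by (simp flip: power_mult power_add)
  have bound: "norm (c * q ^ (j * Suc n)) \<le> r ^ n" if "norm q \<le> r" "r < 1" for q n and r :: real
  proof -
    have r: "r \<ge> 0" using that norm_ge_zero order_trans by blast
    have "norm (c * q ^ (j * Suc n)) = norm q ^ (j * Suc n)"
      using c by (simp add: norm_mult norm_power)
    also have "\<dots> \<le> r ^ (j * Suc n)"
      using that by (intro power_mono) auto
    also have "\<dots> \<le> r ^ n"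
    proof (rule power_decreasing)
      have "1 * n \<le> j * Suc n" using j by (intro mult_le_mono) auto
      then show "n \<le> j * Suc n" by simp
    qed (use r that in auto)
    finally show ?thesis .
  qed
  have conv: "convergent_prod (\<lambda>n. 1 - c * q ^ (j * Suc n))" if "norm q < 1" for q
  proof (intro abs_convergent_prod_imp_convergent_prod summable_imp_abs_convergent_prod)
    show "summable (\<lambda>n. norm (1 - c * q ^ (j * Suc n) - 1))"
      by (rule summable_comparison_test[OF _ summable_geometric[of "norm q"]])
         (use bound[of q "norm q"] that in auto)
  qed
  show "qpochhammer_inf (c * q ^ j) (q ^ j) \<noteq> 0" if q: "norm q < 1" for q
    unfolding qpochhammer_inf_def eq
  proof (rule prodinf_nonzero[OF conv[OF q]])
    fix n
    have "norm (c * q ^ (j * Suc n)) = norm q ^ (j * Suc n)"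
      using c by (simp add: norm_mult norm_power)
    also have "\<dots> < 1"
      using q j by (simp add: power_less_one_iff)
    finally show "1 - c * q ^ (j * Suc n) \<noteq> 0"
      by force
  qed
  show "qpochhammer_inf (c * 0 ^ j) (0 ^ j) = 1"
    using j by (simp add: qpochhammer_inf_def zero_power)
  show "int_series (\<lambda>q. qpochhammer_inf (c * q ^ j) (q ^ j))"
    unfolding qpochhammer_inf_def eq
  proof (rule int_series_limit)
    show "int_series (\<lambda>q. \<Prod>n<N. 1 - c * q ^ (j * Suc n))" for N
      by (intro int_series_prod int_series_factor c)
    fix r :: real assume r: "0 < r" "r < 1"
    have "uniformly_convergent_on (cball 0 r) (\<lambda>N q. \<Prod>n<N. 1 - c * q ^ (j * Suc n))"
    proof (rule uniformly_convergent_on_prod')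
      show "uniformly_convergent_on (cball 0 r)
              (\<lambda>N q. \<Sum>n<N. norm (1 - c * q ^ (j * Suc n) - 1))"
        by (rule Weierstrass_m_test'[where M = "\<lambda>n. r ^ n"])
           (use bound[of _ r] r in \<open>auto intro: summable_geometric\<close>)
    qed (auto intro!: continuous_intros)
    then obtain l where l: "uniform_limit (cball 0 r) (\<lambda>N q. \<Prod>n<N. 1 - c * q ^ (j * Suc n)) l sequentially"
      unfolding uniformly_convergent_on_def by blast
    have "l q = (\<Prod>n. 1 - c * q ^ (j * Suc n))" if "q \<in> cball 0 r" for q
    proof (rule LIMSEQ_unique)
      show "(\<lambda>N. \<Prod>n<N. 1 - c * q ^ (j * Suc n)) \<longlonglongrightarrow> l q"
        by (rule tendsto_uniform_limitI[OF l that])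
      have "(\<lambda>N. \<Prod>n\<le>N. 1 - c * q ^ (j * Suc n)) \<longlonglongrightarrow> (\<Prod>n. 1 - c * q ^ (j * Suc n))"
        using that r by (intro convergent_prod_LIMSEQ conv) auto
      then show "(\<lambda>N. \<Prod>n<N. 1 - c * q ^ (j * Suc n)) \<longlonglongrightarrow> (\<Prod>n. 1 - c * q ^ (j * Suc n))"
        by (subst filterlim_sequentially_Suc[symmetric]) (simp only: lessThan_Suc_atMost)
    qed
    then show "uniform_limit (cball 0 r) (\<lambda>N q. \<Prod>n<N. 1 - c * q ^ (j * Suc n))
                 (\<lambda>q. \<Prod>n. 1 - c * q ^ (j * Suc n)) sequentially"
      using l by (subst uniform_limit_cong'[where i = l]) auto
  qed
qed

lemma ex1_overcubic_pair_coeffs: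
  "\<exists>!b::nat \<Rightarrow> int. \<forall>q::complex. norm q < 1 \<longrightarrow>
     (\<lambda>n. of_int (b n) * q ^ n) sums overcubic_pair_gf q"
proof (rule ex_ex1I)
  define A where "A c j q = qpochhammer_inf (c * q ^ j) (q ^ j)" for c q :: complex and j :: nat
  have A: "int_series (A c j)" "A c j 0 = 1" "\<And>q. norm q < 1 \<Longrightarrow> A c j q \<noteq> 0"
    if "c \<in> {1, -1}" "j > 0" for c j
    using that int_series_qpochhammer[of c j] qpochhammer_at_0[of c j] qpochhammer_nonzero[of c j]
    by (auto simp: A_def[abs_def])
  define B where "B j q = A (-1) j q * inverse (A 1 j q)" for j q
  have B: "int_series (B j)" if "j > 0" for j
    unfolding B_def[abs_def] using that by (intro int_series_mult int_series_inverse A) auto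
  have gf: "overcubic_pair_gf = (\<lambda>q. (B 1 q * B 1 q) * (B 2 q * B 2 q))"
    by (auto simp: overcubic_pair_gf_def B_def A_def power2_eq_square field_simps)
  have "int_series overcubic_pair_gf"
    unfolding gf by (intro int_series_mult B) auto
  then obtain F where F: "overcubic_pair_gf holomorphic_on ball 0 1"
      "overcubic_pair_gf has_fps_expansion F" "\<And>n. fps_nth F n \<in> \<int>"
    unfolding int_series_def by blast
  obtain b where b: "\<And>n. fps_nth F n = of_int (b n)"
    using F(3) unfolding Ints_def image_iff by metis
  have "(\<lambda>n. of_int (b n) * q ^ n) sums overcubic_pair_gf q" if "norm q < 1" for q
    using has_fps_expansion_imp_sums_complex[OF F(2), of 1 q] F(1) that
    by (simp add: b one_ereal_def)
  then show "\<exists>b::nat \<Rightarrow> int. \<forall>q::complex. norm q < 1 \<longrightarrow>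
     (\<lambda>n. of_int (b n) * q ^ n) sums overcubic_pair_gf q" by blast
next
  have expand: "overcubic_pair_gf has_fps_expansion Abs_fps (\<lambda>n. of_int (b n))"
    if "\<forall>q::complex. norm q < 1 \<longrightarrow> (\<lambda>n. of_int (b n) * q ^ n) sums overcubic_pair_gf q"
    for b :: "nat \<Rightarrow> int"
  proof (rule has_fps_expansionI)
    have "eventually (\<lambda>q. q \<in> ball (0::complex) 1) (nhds 0)"
      by (intro eventually_nhds_in_open) auto
    then show "\<forall>\<^sub>F q in nhds 0.
        (\<lambda>n. fps_nth (Abs_fps (\<lambda>n. of_int (b n))) n * q ^ n) sums overcubic_pair_gf q"
      by eventually_elim (use that in auto)
  qed
  fix b b' :: "nat \<Rightarrow> int"
  assume b: "\<forall>q::complex. norm q < 1 \<longrightarrow> (\<lambda>n. of_int (b n) * q ^ n) sums overcubic_pair_gf q"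
    and b': "\<forall>q::complex. norm q < 1 \<longrightarrow> (\<lambda>n. of_int (b' n) * q ^ n) sums overcubic_pair_gf q"
  have "Abs_fps (\<lambda>n. of_int (b n) :: complex) = Abs_fps (\<lambda>n. of_int (b' n))"
    by (rule fps_expansion_unique_complex[OF expand[OF b] expand[OF b']])
  then show "b = b'"
    by (auto simp: fps_eq_iff)
qed

lemma overcubic_pair_sums:
  "norm q < 1 \<Longrightarrow> (\<lambda>n. of_int (overcubic_pair n) * q ^ n) sums overcubic_pair_gf q"
  using theI'[OF ex1_overcubic_pair_coeffs] unfolding overcubic_pair_def by blast

end

theory Submission
  imports Defs "HOL-Probability.Distributions" "HOL-Computational_Algebra.Squarefree"
    "HOL-Computational_Algebra.Nth_Powers" "HOL-Real_Asymp.Real_Asymp"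
begin

text \<open>
  Write \<open>\<phi>(q)\<close> for the theta series \<open>1 + 2 q + 2 q^4 + 2 q^9 + \<dots>\<close>.  Gauss' product formula and
  \<open>\<phi>(q) \<phi>(-q) = \<phi>(-q^2)^2\<close> turn the generating function into \<open>1 / (\<phi>(-q)^3 \<phi>(q))\<close>.  Let
  \<open>A = \<phi>^4\<close> and \<open>16 F = \<phi>(q)^4 - \<phi>(-q)^4\<close>, two modular forms of weight 2.  Since \<open>\<phi>\<close> is congruent
  to 1 modulo 2, high powers \<open>A^(2^m)\<close> are congruent to 1 modulo \<open>2^k\<close>, and the generating function is
  congruent modulo \<open>2^k\<close> to an integral combination of the forms \<open>A^(j-l) F^l\<close>, \<open>l \<le> j\<close>, of weight \<open>2 j\<close>.
  The Hecke operators \<open>T_p\<close> with \<open>p\<close> odd preserve the lattice of these combinations and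
  strictly lower the degree in \<open>F\<close> modulo 2, so any \<open>k (j + 1)\<close> of them map it into its multiples by
  \<open>2^k\<close>.  If \<open>k (j + 1)\<close> odd primes divide \<open>n\<close> exactly once, the \<open>n\<close>-th coefficient is a coefficient of
  the image under the corresponding Hecke operators, hence divisible by \<open>2^k\<close>; almost
  every \<open>n\<close> has that many such primes.
\<close>

section \<open>Integers with many exact prime divisors\<close>

text \<open>With \<open>u = F / A\<close> the generating function is
  \<open>A^(-1) (1 - 16 u)^(-1) (1 - 16 u)^(1/4)\<close>. The fourth root is the quotient of
  \<open>\<phi>(-q)\<close> by \<open>\<phi>(q)\<close> and is reached only as a 2-adic limit of
  integral polynomials in \<open>u\<close>, while the 16 makes the geometric series finite modulo
  \<open>2^k\<close>. The remaining \<open>A^(-1)\<close> is absorbed by \<open>A^(2^m)\<close>, so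
  that \<open>j = 2^m - 1\<close>. Integrality survives the complex analysis because
  \<open>A^(j-l) F^l\<close> starts with \<open>q^l\<close>: the coefficients of an integral series
  up to \<open>q^j\<close> are those of an integral combination, and a vanishing theorem for weight
  \<open>2 j\<close> turns this agreement into equality for a Hecke image. The degree drops because
  the top coefficient of \<open>T_p F^i\<close> is \<open>1 + p^(2 i - 1)\<close>, an even number.
  After \<open>j + 1\<close> operators no degree is left modulo 2, a factor 2 splits off, and the
  argument starts again on the quotient; this is the origin of the count
  \<open>k (j + 1)\<close>.\<close>

lemma nat_eq_prod_primes_mult_square:
  fixes n :: nat
  assumes "n > 0"
  obtains T k where "T \<subseteq> {p. prime p \<and> p dvd n}" "k \<in> {1..n}" "n = \<Prod>T * k\<^sup>2"
proof
  let ?m = "squarefree_part n" and ?k = "square_part n"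
  have n: "n = ?m * ?k\<^sup>2" by (rule squarefree_decompose)
  have "?m = (\<Prod>p\<in>prime_factors ?m. p ^ multiplicity p ?m)"
    by (rule prime_factorization_nat) (metis neq0_conv squarefree_part_nonzero)
  also have "\<dots> = \<Prod>(prime_factors ?m)"
  proof (rule prod.cong[OF refl])
    fix p assume "p \<in> prime_factors ?m"
    then have "prime p" "multiplicity p ?m > 0"
      by (auto simp: prime_factors_multiplicity)
    then have "multiplicity p ?m = 1"
      using prime_multiplicity_squarefree_part_le_Suc_0[of p n] by linarith
    then show "p ^ multiplicity p ?m = p" by simp
  qed
  finally show "n = \<Prod>(prime_factors ?m) * ?k\<^sup>2" using n by simp
  have "?m dvd n" by (subst n) simp
  then show "prime_factors ?m \<subseteq> {p. prime p \<and> p dvd n}"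
    using dvd_trans[OF _ \<open>?m dvd n\<close>] by (auto simp: in_prime_factors_iff)
  have "?k dvd n" using dvd_trans[OF _ square_part_square_dvd[of n], of ?k] by (simp add: power2_eq_square)
  then have "?k \<le> n" "?k > 0" using assms by (auto intro: dvd_imp_le dvd_pos_nat)
  then show "?k \<in> {1..n}" by simp
qed

lemma sum_inverse_squares_le:
  "(\<Sum>k=1..n. 1 / real k ^ 2) \<le> 2"
proof -
  \<comment> \<open>Strengthened for the induction: \<open>1 / (n + 1)^2\<close> is at most
    \<open>1 / n - 1 / (n + 1)\<close>, which telescopes.\<close>
  have "(\<Sum>k=1..n. 1 / real k ^ 2) \<le> 2 - 1 / real (max n 1)"
  proof (induction n)
    case (Suc n)
    show ?case
    proof (cases "n = 0")
      case False
      then have "1 / real (Suc n) ^ 2 \<le> 1 / real n - 1 / real (Suc n)"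
        by (simp add: divide_simps) (simp add: algebra_simps power2_eq_square)
      then show ?thesis using Suc False by (cases "n = 1") (simp_all add: max_def)
    qed auto
  qed auto
  also have "\<dots> \<le> 2" by simp
  finally show ?thesis .
qed

text \<open>Every \<open>m\<close> up to \<open>n\<close> is a squarefree number times a square.
  Expanding the product gives the reciprocals of all squarefree numbers built from these primes, and
  the squares contribute at most 2.\<close>

lemma harm_le_prod_primes:
  "harm n \<le> 2 * (\<Prod>p | prime p \<and> p \<le> n. 1 + 1 / real p)"
proof -
  let ?P = "{p. prime p \<and> p \<le> n}"
  have fin: "finite ?P" by (rule finite_subset[of _ "{..n}"]) auto
  let ?f = "\<lambda>(T,k). \<Prod>T * k\<^sup>2" and ?g = "\<lambda>m. 1 / real m"
  have "harm n = sum ?g {1..n}" by (simp add: harm_def divide_inverse)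
  also have "\<dots> \<le> sum ?g (?f ` (Pow ?P \<times> {1..n}))"
  proof (rule sum_mono2)
    show "{1..n} \<subseteq> ?f ` (Pow ?P \<times> {1..n})"
    proof
      fix m assume m: "m \<in> {1..n}"
      then obtain T k where "T \<subseteq> {p. prime p \<and> p dvd m}" "k \<in> {1..m}" "m = \<Prod>T * k\<^sup>2"
        using nat_eq_prod_primes_mult_square[of m] by auto
      moreover have "p \<le> n" if "p dvd m" for p using dvd_imp_le[OF that] m by auto
      ultimately show "m \<in> ?f ` (Pow ?P \<times> {1..n})" using m
        by (intro image_eqI[of _ _ "(T,k)"]) auto
    qed
  qed (use fin in auto)
  also have "\<dots> \<le> sum (?g \<circ> ?f) (Pow ?P \<times> {1..n})"
    by (rule sum_image_le) (use fin in auto)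
  also have "\<dots> = (\<Sum>T\<in>Pow ?P. \<Sum>k=1..n. (\<Prod>p\<in>T. 1 / real p) * (1 / real k ^ 2))"
    by (subst sum.cartesian_product) (auto intro!: sum.cong simp: prod_dividef)
  also have "\<dots> = (\<Sum>T\<in>Pow ?P. \<Prod>p\<in>T. 1 / real p) * (\<Sum>k=1..n. 1 / real k ^ 2)"
    by (simp add: sum_product)
  also have "(\<Sum>T\<in>Pow ?P. \<Prod>p\<in>T. 1 / real p) = (\<Prod>p\<in>?P. 1 / real p + 1)"
    by (subst prod_add[OF fin]) simp
  also have "(\<Prod>p\<in>?P. 1 / real p + 1) * (\<Sum>k=1..n. 1 / real k ^ 2) \<le> (\<Prod>p\<in>?P. 1 / real p + 1) * 2"
    by (intro mult_left_mono sum_inverse_squares_le prod_nonneg) auto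
  finally show ?thesis by (simp add: add.commute mult.commute)
qed

text \<open>Euler's argument: harmonic sums are unbounded, and \<open>1 + x \<le> exp x\<close>
  moves the product bound into an exponent. Leaving out the primes in \<open>E\<close> costs at most
  \<open>card E\<close>, which \<open>D\<close> adds beforehand.\<close>

lemma sum_inverse_primes_unbounded:
  fixes C :: real and E :: "nat set"
  assumes "finite E"
  obtains S where "finite S" "S \<inter> E = {}" "\<And>p. p \<in> S \<Longrightarrow> prime p" "(\<Sum>p\<in>S. 1 / real p) \<ge> C"
proof -
  define D where "D = C + real (card E)"
  have "eventually (\<lambda>n. harm n \<ge> 2 * exp D) sequentially"
    using harm_at_top[unfolded filterlim_at_top] by blast
  then obtain n where n: "harm n \<ge> 2 * exp D" by (auto dest: eventually_happens)
  let ?P = "{p. prime p \<and> p \<le> n}"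
  have fin: "finite ?P" by (rule finite_subset[of _ "{..n}"]) auto
  have "exp D \<le> (\<Prod>p\<in>?P. 1 + 1 / real p)" using n harm_le_prod_primes[of n] by simp
  also have "\<dots> \<le> (\<Prod>p\<in>?P. exp (1 / real p))" by (intro prod_mono) auto
  also have "\<dots> = exp (\<Sum>p\<in>?P. 1 / real p)" using fin by (simp add: exp_sum)
  finally have D: "D \<le> (\<Sum>p\<in>?P. 1 / real p)" by simp
  have "(\<Sum>p\<in>?P. 1 / real p) = (\<Sum>p\<in>?P - E. 1 / real p) + (\<Sum>p\<in>?P \<inter> E. 1 / real p)"
    using fin by (subst sum.union_disjoint[symmetric]) (auto intro!: sum.cong)
  also have "(\<Sum>p\<in>?P \<inter> E. 1 / real p) \<le> (\<Sum>p\<in>?P \<inter> E. 1)"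
    by (intro sum_mono) (auto dest!: prime_gt_0_nat)
  also have "\<dots> \<le> real (card E)" using assms by (simp add: card_mono)
  finally have "C \<le> (\<Sum>p\<in>?P - E. 1 / real p)" using D by (simp add: D_def)
  then show ?thesis by (intro that[of "?P - E"]) (use fin in auto)
qed

section \<open>Density of the integers with few exact prime divisors in a finite set\<close>

definition exact_dvd :: "nat \<Rightarrow> nat \<Rightarrow> bool" where
  "exact_dvd p n \<longleftrightarrow> p dvd n \<and> \<not> p\<^sup>2 dvd n"

abbreviation count_avoiding :: "nat set \<Rightarrow> nat \<Rightarrow> nat" where
  "count_avoiding S N \<equiv> card {n\<in>{1..N}. \<forall>p\<in>S. \<not> exact_dvd p n}"

lemma exact_dvd_mult_left:
  assumes "prime p" "prime q" "p \<noteq> q"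
  shows "exact_dvd p (q * n) \<longleftrightarrow> exact_dvd p n"
proof -
  have "coprime p q" "coprime (p\<^sup>2) q" using assms by (auto intro: primes_coprime)
  then show ?thesis by (simp add: exact_dvd_def coprime_dvd_mult_right_iff)
qed

lemma real_div_over_tendsto:
  assumes "d > 0"
  shows "(\<lambda>N. real (N div d) / real N) \<longlonglongrightarrow> 1 / real d"
proof (rule real_tendsto_sandwich[of "\<lambda>N. 1 / real d - 1 / real N" _ _ "\<lambda>N. 1 / real d"])
  have *: "real N / real d - 1 \<le> real (N div d)" "real (N div d) \<le> real N / real d" for N
  proof -
    have "N < (N div d) * d + d" using assms dividend_less_div_times[of d N] by (simp add: add.commute)
    then have "real N \<le> real (N div d) * real d + real d"
      by (simp only: of_nat_add[symmetric] of_nat_mult[symmetric] of_nat_le_iff)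
    then show "real N / real d - 1 \<le> real (N div d)" using assms by (simp add: field_simps)
    show "real (N div d) \<le> real N / real d" by (rule of_nat_div_le_of_nat)
  qed
  show "\<forall>\<^sub>F N in sequentially. 1 / real d - 1 / real N \<le> real (N div d) / real N"
    using eventually_gt_at_top[of 0]
  proof eventually_elim
    case (elim N)
    have "1 / real d - 1 / real N = (real N / real d - 1) / real N"
      using elim by (simp add: field_simps)
    also have "\<dots> \<le> real (N div d) / real N" by (intro divide_right_mono *) auto
    finally show ?case .
  qed
  show "\<forall>\<^sub>F N in sequentially. real (N div d) / real N \<le> 1 / real d"
    using eventually_gt_at_top[of 0]
  proof eventually_elim
    case (elim N)
    have "real (N div d) / real N \<le> (real N / real d) / real N" by (intro divide_right_mono *) auto
    then show ?case using elim by simp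
  qed
  show "(\<lambda>N. 1 / real d - 1 / real N) \<longlonglongrightarrow> 1 / real d" by real_asymp
qed auto

lemma card_multiples:
  fixes d N :: nat
  assumes "d > 0" "\<And>m. P (d * m) \<longleftrightarrow> Q m"
  shows "card {n\<in>{1..N}. d dvd n \<and> P n} = card {n\<in>{1..N div d}. Q n}"
proof (rule bij_betw_same_card[symmetric])
  show "bij_betw (\<lambda>m. d * m) {n\<in>{1..N div d}. Q n} {n\<in>{1..N}. d dvd n \<and> P n}"
  proof (rule bij_betwI[where g = "\<lambda>n. n div d"])
    have le: "m \<le> N div d \<longleftrightarrow> d * m \<le> N" for m
      using less_eq_div_iff_mult_less_eq[OF assms(1), of m N] by (simp only: mult.commute)
    show "(\<lambda>m. d * m) \<in> {n\<in>{1..N div d}. Q n} \<rightarrow> {n\<in>{1..N}. d dvd n \<and> P n}"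
    proof
      fix m assume "m \<in> {n\<in>{1..N div d}. Q n}"
      then show "d * m \<in> {n\<in>{1..N}. d dvd n \<and> P n}"
        using assms le[of m] by (simp add: Suc_le_eq)
    qed
    show "(\<lambda>n. n div d) \<in> {n\<in>{1..N}. d dvd n \<and> P n} \<rightarrow> {n\<in>{1..N div d}. Q n}"
    proof
      fix n assume n: "n \<in> {n\<in>{1..N}. d dvd n \<and> P n}"
      then obtain m where m: "n = d * m" by blast
      have "m > 0" using n m by (cases "m = 0") auto
      then show "n div d \<in> {n\<in>{1..N div d}. Q n}"
        using n assms le[of m] unfolding m by (simp add: Suc_le_eq)
    qed
  qed (use assms in \<open>auto elim!: dvdE\<close>)
qed

text \<open>Adding a prime \<open>q\<close> to the set removes the multiples of \<open>q\<close> and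
  restores those of \<open>q^2\<close>. Multiplication by \<open>q\<close> does not change exact
  divisibility by the other primes, so both classes are counted by the old function at
  \<open>N div q\<close> and \<open>N div q^2\<close>; this yields the factor
  \<open>1 - 1/q + 1/q^2\<close>.\<close>

lemma density_no_exact_dvd:
  assumes "finite S" "\<And>p. p \<in> S \<Longrightarrow> prime p"
  shows "(\<lambda>N. real (count_avoiding S N) / real N)
           \<longlonglongrightarrow> (\<Prod>p\<in>S. 1 - 1 / real p + 1 / real p ^ 2)"
  using assms
proof (induction S rule: finite_induct)
  case empty
  have "count_avoiding {} N = N" for N
  proof -
    have "{n\<in>{1..N}. \<forall>p\<in>{}. \<not> exact_dvd p n} = {1..N}" by auto
    then show ?thesis by (simp only: card_atLeastAtMost)
  qed
  moreover have "(\<lambda>N. real N / real N) \<longlonglongrightarrow> 1" by real_asymp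
  ultimately show ?case by (simp only: prod.empty)
next
  case (insert q S)
  define c where "c N = count_avoiding S N" for N
  define L where "L = (\<Prod>p\<in>S. 1 - 1 / real p + 1 / real p ^ 2)"
  have q: "prime q" and q0: "q > 0" using insert by (auto simp: prime_gt_0_nat)
  have IH: "(\<lambda>N. real (c N) / real N) \<longlonglongrightarrow> L" using insert by (simp add: c_def L_def)
  have shift: "(\<lambda>N. real (c (N div d)) / real N) \<longlonglongrightarrow> L * (1 / real d)" if "d > 0" for d
  proof (rule Lim_transform_eventually)
    have "filterlim (\<lambda>N. N div d) at_top sequentially"
      unfolding filterlim_at_top eventually_at_top_linorder
    proof (intro allI exI impI)
      fix Z N assume "Z * d \<le> N"
      then show "Z \<le> N div d" using that by (simp add: less_eq_div_iff_mult_less_eq)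
    qed
    then have "(\<lambda>N. real (c (N div d)) / real (N div d)) \<longlonglongrightarrow> L"
      by (rule filterlim_compose[OF IH])
    then show "(\<lambda>N. real (c (N div d)) / real (N div d) * (real (N div d) / real N)) \<longlonglongrightarrow> L * (1 / real d)"
      by (intro tendsto_mult real_div_over_tendsto that)
    \<comment> \<open>If \<open>N div d = 0\<close>, the quotient by zero on the left is 0, and so
      is the numerator on the right.\<close>
    have "c 0 = 0" by (simp add: c_def)
    then show "\<forall>\<^sub>F N in sequentially. real (c (N div d)) / real (N div d) * (real (N div d) / real N) =
        real (c (N div d)) / real N"
      by (intro always_eventually allI) (simp add: field_simps)
  qed
  have count: "real (count_avoiding (insert q S) N) =
      real (c N) - real (c (N div q)) + real (c (N div q\<^sup>2))" for N
  proof -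
    let ?A = "{n\<in>{1..N}. \<forall>p\<in>S. \<not> exact_dvd p n}"
    let ?B = "{n\<in>{1..N}. q dvd n \<and> (\<forall>p\<in>S. \<not> exact_dvd p n)}"
    let ?C = "{n\<in>{1..N}. q\<^sup>2 dvd n \<and> (\<forall>p\<in>S. \<not> exact_dvd p n)}"
    have ex: "exact_dvd p (q * m) \<longleftrightarrow> exact_dvd p m" if "p \<in> S" for p m
      using that insert q by (intro exact_dvd_mult_left) auto
    have B: "card ?B = c (N div q)" unfolding c_def
      by (rule card_multiples) (use q0 ex in auto)
    have C: "card ?C = c (N div q\<^sup>2)" unfolding c_def
      by (rule card_multiples) (use q0 ex in \<open>auto simp: power2_eq_square mult.assoc\<close>)
    have sub: "?C \<subseteq> ?B" "?B \<subseteq> ?A" by (auto simp: power2_eq_square)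
    have "{n\<in>{1..N}. \<forall>p\<in>insert q S. \<not> exact_dvd p n} = ?A - (?B - ?C)"
      by (auto simp: exact_dvd_def power2_eq_square)
    then have "count_avoiding (insert q S) N = card (?A - (?B - ?C))"
      by (simp only:)
    also have "\<dots> = card ?A - card (?B - ?C)"
      by (rule card_Diff_subset) (use sub in auto)
    also have "card (?B - ?C) = card ?B - card ?C"
      by (rule card_Diff_subset) (use sub in auto)
    finally have "real (count_avoiding (insert q S) N) =
        real (card ?A - (card ?B - card ?C))" by (simp only:)
    also have "\<dots> = real (card ?A) - (real (card ?B) - real (card ?C))"
      using card_mono[OF _ sub(1)] card_mono[OF _ sub(2)] by (subst of_nat_diff; simp add: of_nat_diff)
    finally show ?thesis unfolding B C by (simp add: c_def)
  qed
  have "(\<lambda>N. real (c N) / real N - real (c (N div q)) / real N + real (c (N div q\<^sup>2)) / real N)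
      \<longlonglongrightarrow> L - L * (1 / real q) + L * (1 / real (q\<^sup>2))"
    by (intro tendsto_add tendsto_diff IH shift) (use q0 in auto)
  moreover have "L - L * (1 / real q) + L * (1 / real (q\<^sup>2)) =
      (\<Prod>p\<in>insert q S. 1 - 1 / real p + 1 / real p ^ 2)"
    using insert by (simp add: L_def algebra_simps)
  ultimately show ?case by (simp only: count add_divide_distrib diff_divide_distrib)
qed

text \<open>Since \<open>p \<ge> 2\<close>, each density factor is at most
  \<open>1 - 1/(2 p)\<close> and hence at most \<open>exp (- 1/(2 p))\<close>. The halved exponent
  explains the 2 in \<open>- 2 * ln (e / 2)\<close>, and \<open>e / 2\<close> leaves room for a
  strict inequality in the limit.\<close>

lemma eventually_few_without_exact_prime:
  fixes e :: real
  assumes "e > 0" "finite E"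
  obtains S where "finite S" "S \<inter> E = {}" "\<And>p. p \<in> S \<Longrightarrow> prime p"
    "\<forall>\<^sub>F N in sequentially. real (count_avoiding S N) \<le> e * real N"
proof -
  obtain S where S: "finite S" "S \<inter> E = {}" "\<And>p. p \<in> S \<Longrightarrow> prime p"
      "(\<Sum>p\<in>S. 1 / real p) \<ge> - 2 * ln (e / 2)"
    using sum_inverse_primes_unbounded[OF assms(2)] by blast
  have "(\<Prod>p\<in>S. 1 - 1 / real p + 1 / real p ^ 2) \<le> (\<Prod>p\<in>S. exp (- (1 / real p) / 2))"
  proof (intro prod_mono conjI)
    fix p assume "p \<in> S"
    then have p: "real p \<ge> 2" using S(3) prime_ge_2_nat by force
    then have "1 / real p ^ 2 \<le> 1 / real p / 2" by (simp add: field_simps power2_eq_square)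
    then have "1 - 1 / real p + 1 / real p ^ 2 \<le> 1 + (- (1 / real p) / 2)" by simp
    also have "\<dots> \<le> exp (- (1 / real p) / 2)" by (rule exp_ge_add_one_self)
    finally show "1 - 1 / real p + 1 / real p ^ 2 \<le> exp (- (1 / real p) / 2)" .
    have "1 / real p \<le> 1" using p by simp
    then show "0 \<le> 1 - 1 / real p + 1 / real p ^ 2" by (smt (verit) zero_le_divide_1_iff zero_le_power2)
  qed
  also have "\<dots> = exp (- (\<Sum>p\<in>S. 1 / real p) / 2)"
    using S(1) by (simp add: exp_sum[symmetric] sum_negf sum_divide_distrib)
  also have "\<dots> \<le> exp (ln (e / 2))" using S(4) by simp
  also have "\<dots> < e" using assms by simp
  finally have lt: "(\<Prod>p\<in>S. 1 - 1 / real p + 1 / real p ^ 2) < e" .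
  have "\<forall>\<^sub>F N in sequentially. real (count_avoiding S N) / real N < e"
    using order_tendstoD(2)[OF density_no_exact_dvd lt] S by blast
  then have "\<forall>\<^sub>F N in sequentially. real (count_avoiding S N) \<le> e * real N"
    using eventually_gt_at_top[of 0] by eventually_elim (simp add: field_simps)
  then show ?thesis using that S by blast
qed

text \<open>One new block \<open>R\<close> of primes is spent per required divisor: an integer with
  fewer than \<open>Suc K\<close> exact divisors in \<open>S \<union> R\<close> has fewer than
  \<open>K\<close> in \<open>S\<close> or none in \<open>R\<close>. Each of the two exceptional sets
  receives half of \<open>e\<close>, and disjointness of the blocks keeps the divisors
  distinct.\<close>

lemma eventually_few_with_few_exact_primes:
  fixes e :: real
  assumes "e > 0" "finite E"
  shows "\<exists>S. finite S \<and> S \<inter> E = {} \<and> (\<forall>p\<in>S. prime p) \<and>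
    (\<forall>\<^sub>F N in sequentially. real (card {n\<in>{1..N}. card {p\<in>S. exact_dvd p n} < K}) \<le> e * real N)"
  using assms
proof (induction K arbitrary: e E)
  case 0
  then show ?case by (intro exI[of _ "{}"]) auto
next
  case (Suc K)
  obtain S where S: "finite S" "S \<inter> E = {}" "\<forall>p\<in>S. prime p"
    "\<forall>\<^sub>F N in sequentially. real (card {n\<in>{1..N}. card {p\<in>S. exact_dvd p n} < K}) \<le> (e/2) * real N"
    using Suc.IH[of "e/2" E, OF half_gt_zero[OF Suc.prems(1)] Suc.prems(2)] by blast
  obtain R where R: "finite R" "R \<inter> (E \<union> S) = {}" "\<And>p. p \<in> R \<Longrightarrow> prime p"
    "\<forall>\<^sub>F N in sequentially. real (count_avoiding R N) \<le> (e/2) * real N"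
    by (rule eventually_few_without_exact_prime[OF half_gt_zero[OF Suc.prems(1)] finite_UnI[OF Suc.prems(2) S(1)]])
       (rule that)
  have "\<forall>\<^sub>F N in sequentially.
     real (card {n\<in>{1..N}. card {p\<in>S \<union> R. exact_dvd p n} < Suc K}) \<le> e * real N"
    using S(4) R(4)
  proof eventually_elim
    case (elim N)
    let ?A = "{n\<in>{1..N}. card {p\<in>S. exact_dvd p n} < K}"
    let ?B = "{n\<in>{1..N}. \<forall>p\<in>R. \<not> exact_dvd p n}"
    have "{n\<in>{1..N}. card {p\<in>S \<union> R. exact_dvd p n} < Suc K} \<subseteq> ?A \<union> ?B"
    proof (rule subsetI, rule ccontr)
      fix n assume n: "n \<in> {n\<in>{1..N}. card {p\<in>S \<union> R. exact_dvd p n} < Suc K}" "n \<notin> ?A \<union> ?B"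
      then obtain q where q: "q \<in> R" "exact_dvd q n" by auto
      have "card (insert q {p\<in>S. exact_dvd p n}) \<le> card {p\<in>S \<union> R. exact_dvd p n}"
        by (intro card_mono) (use S(1) R(1) q in auto)
      moreover have "q \<notin> S" using q R(2) by auto
      ultimately show False using n S(1) by simp
    qed
    then have "card {n\<in>{1..N}. card {p\<in>S \<union> R. exact_dvd p n} < Suc K} \<le> card (?A \<union> ?B)"
      by (intro card_mono) auto
    also have "\<dots> \<le> card ?A + card ?B" by (rule card_Un_le)
    finally show ?case using elim by linarith
  qed
  then show ?case using S R by (intro exI[of _ "S \<union> R"]) auto
qed

lemma density_one_if_many_exact_primes:
  assumes "\<And>n S. \<lbrakk>n > 0; finite S; card S = K; \<And>p. p \<in> S \<Longrightarrow> prime p \<and> odd p \<and> exact_dvd p n\<rbrakk> \<Longrightarrow> P n"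
  shows "((\<lambda>X::real. real (card {n::nat. real n \<le> X \<and> P n}) / X) \<longlongrightarrow> 1) at_top"
proof (rule tendstoI)
  fix e :: real assume e: "e > 0"
  \<comment> \<open>Excluding 2 forces the primes to be odd, as the Hecke operators require.\<close>
  have fin: "finite {2::nat}" by simp
  from eventually_few_with_few_exact_primes[OF half_gt_zero[OF e] fin, of K]
  obtain S where S: "finite S" "S \<inter> {2} = {}" "\<forall>p\<in>S. prime p"
    "\<forall>\<^sub>F N in sequentially. real (card {n\<in>{1..N}. card {p\<in>S. exact_dvd p n} < K}) \<le> (e/2) * real N"
    by (elim exE conjE)
  have good: "P n" if n: "n > 0" "\<not> card {p\<in>S. exact_dvd p n} < K" for n
  proof -
    obtain T where T: "T \<subseteq> {p\<in>S. exact_dvd p n}" "card T = K"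
      using obtain_subset_with_card_n[of K "{p\<in>S. exact_dvd p n}"] n(2) by auto
    have "odd p" if "p \<in> S" for p
    proof -
      have "prime p" "p \<noteq> 2" using S(2,3) that by auto
      then show ?thesis by (metis primes_dvd_imp_eq two_is_prime_nat)
    qed
    then have "\<And>p. p \<in> T \<Longrightarrow> prime p \<and> odd p \<and> exact_dvd p n" using T(1) S(3) by blast
    moreover have "finite T" 
      by (rule finite_subset[OF T(1)]) (use S(1) in simp)
    ultimately show ?thesis using assms n(1) T(2) by blast
  qed
  have "filterlim (\<lambda>X::real. nat \<lfloor>X\<rfloor>) at_top at_top"
    by (intro filterlim_compose[OF filterlim_nat_sequentially] filterlim_floor_sequentially)
  \<comment> \<open>Beyond \<open>2 / e\<close> the rounding error 1 is smaller than
    \<open>(e / 2) * X\<close>, the half of the allowance that the bad integers leave.\<close>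
  from eventually_compose_filterlim[OF S(4) this] eventually_gt_at_top[of "max 1 (2/e)"]
  show "\<forall>\<^sub>F X in at_top. dist (real (card {n. real n \<le> X \<and> P n}) / X) 1 < e"
  proof eventually_elim
    case (elim X)
    define N where "N = nat \<lfloor>X\<rfloor>"
    have N: "real N \<le> X" "X < real N + 1" using elim by (auto simp: N_def)
    let ?A = "{n. real n \<le> X \<and> P n}" and ?B = "{n\<in>{1..N}. card {p\<in>S. exact_dvd p n} < K}"
    have sub: "?A \<subseteq> {..N}" using N by auto
    have "card ?A \<le> N + 1" using card_mono[OF _ sub] by simp
    then have upper: "real (card ?A) \<le> X + 1" using N by linarith
    have "{1..N} \<subseteq> ?A \<union> ?B"
    proof
      fix n assume n: "n \<in> {1..N}"
      then have "real n \<le> X" using N(1) of_nat_le_iff[of n N, where 'a = real] by simp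
      then show "n \<in> ?A \<union> ?B" using good[of n] n by auto
    qed
    then have "card {1..N} \<le> card (?A \<union> ?B)"
      by (intro card_mono) (use finite_subset[OF sub] in auto)
    also have "\<dots> \<le> card ?A + card ?B" by (rule card_Un_le)
    finally have "real N \<le> real (card ?A) + real (card ?B)" by simp
    moreover have "real (card ?B) \<le> (e/2) * X"
    proof -
      have "(e/2) * real N \<le> (e/2) * X" using N(1) e by (intro mult_left_mono) auto
      then show ?thesis using elim(1) unfolding N_def[symmetric] by (rule order_trans[rotated])
    qed
    ultimately have lower: "X - real (card ?A) \<le> 1 + (e/2) * X" using N by linarith
    have X: "X > 0" "1 < (e/2) * X" using elim e by (auto simp: field_simps)
    have "\<bar>real (card ?A) - X\<bar> < e * X" using upper lower X by linarith
    moreover have "real (card ?A) / X - 1 = (real (card ?A) - X) / X"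
      using X by (simp add: diff_divide_distrib)
    ultimately show ?case using X by (simp add: dist_real_def pos_divide_less_eq)
  qed
qed

section \<open>Theta series\<close>

text \<open>Roots of both signs are counted, so that the coefficients of \<open>phi\<close> are 1
  and 2 and products of theta series count lattice points.\<close>

definition square_roots :: "nat \<Rightarrow> int set" where
  "square_roots n = {x. x\<^sup>2 = int n}"

definition phi :: "int fps" where
  "phi = Abs_fps (\<lambda>n. int (card (square_roots n)))"

text \<open>The substitution of \<open>- q\<close> for \<open>q\<close>; on the upper half plane it
  becomes the translation \<open>\<tau> + 1\<close>.\<close>

definition fps_alt :: "'a::comm_ring_1 fps \<Rightarrow> 'a fps" where
  "fps_alt f = Abs_fps (\<lambda>n. (-1) ^ n * fps_nth f n)"

definition fps_dilate :: "'a::comm_ring_1 fps \<Rightarrow> 'a fps" where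
  "fps_dilate f = Abs_fps (\<lambda>n. if even n then fps_nth f (n div 2) else 0)"

lemma fps_alt_nth [simp]: "fps_nth (fps_alt f) n = (-1) ^ n * fps_nth f n"
  by (simp add: fps_alt_def)

lemma fps_alt_add [simp]: "fps_alt (f + g) = fps_alt f + fps_alt g"
  by (simp add: fps_eq_iff algebra_simps)

lemma fps_alt_diff [simp]: "fps_alt (f - g) = fps_alt f - fps_alt g"
  by (simp add: fps_eq_iff algebra_simps)

lemma fps_alt_mult [simp]: "fps_alt (f * g) = fps_alt f * fps_alt g"
proof (rule fps_ext)
  fix n
  have "(-1) ^ n * (fps_nth f i * fps_nth g (n - i)) =
      (((-1) ^ i * fps_nth f i) * ((-1) ^ (n - i) * fps_nth g (n - i)))" if "i \<in> {0..n}" for i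
  proof -
    have "(-1) ^ n = ((-1) ^ i * (-1) ^ (n - i) :: 'a)"
      using that by (simp flip: power_add)
    then show ?thesis by (simp only: mult_ac)
  qed
  then show "fps_nth (fps_alt (f * g)) n = fps_nth (fps_alt f * fps_alt g) n"
    by (simp add: fps_mult_nth sum_distrib_left)
qed

lemma fps_alt_const [simp]: "fps_alt (fps_const c) = fps_const c"
  by (simp add: fps_eq_iff)

lemma fps_alt_1 [simp]: "fps_alt 1 = 1"
  by (simp add: fps_eq_iff)

lemma fps_alt_power [simp]: "fps_alt (f ^ n) = fps_alt f ^ n"
  by (induction n) auto

lemma fps_alt_alt [simp]: "fps_alt (fps_alt f) = f"
  by (simp add: fps_eq_iff mult.assoc[symmetric] flip: power_add mult_2)

lemma finite_square_roots: "finite (square_roots n)"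
proof (rule finite_subset)
  show "square_roots n \<subseteq> {- int n..int n}"
  proof
    fix x assume "x \<in> square_roots n"
    then have x: "x\<^sup>2 = int n" by (simp add: square_roots_def)
    have "\<bar>x\<bar> \<le> \<bar>x\<bar> * \<bar>x\<bar>" using mult_left_mono[of 1 "\<bar>x\<bar>" "\<bar>x\<bar>"] by (cases "x = 0") auto
    then have "\<bar>x\<bar> \<le> x\<^sup>2" by (simp add: power2_eq_square)
    then show "x \<in> {- int n..int n}" using x by auto
  qed
qed simp

lemma card_square_roots:
  "card (square_roots n) = (if n = 0 then 1 else if is_square n then 2 else 0)"
proof -
  consider "n = 0" | "n \<noteq> 0" "\<not> is_square n" | m where "n = m\<^sup>2" "m \<noteq> 0"
    by (metis is_nth_power_def zero_power2)
  then show ?thesis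
  proof cases
    case 1
    then have "square_roots n = {0}" by (auto simp: square_roots_def)
    then show ?thesis using 1 by simp
  next
    case 2
    have "square_roots n = {}"
    proof -
      have "n = (nat \<bar>x\<bar>)\<^sup>2" if "x\<^sup>2 = int n" for x
        using that by (metis nat_int nat_power_eq abs_ge_zero power2_abs)
      then show ?thesis using 2 by (auto simp: square_roots_def is_nth_power_def)
    qed
    then show ?thesis using 2 by simp
  next
    case 3
    have "square_roots n = {int m, - int m}"
      using 3 by (auto simp: square_roots_def power2_eq_iff)
    then show ?thesis using 3 by auto
  qed
qed

section \<open>Sums of two squares and the duplication identities of theta\<close>

definition norm_pairs :: "nat \<Rightarrow> (int \<times> int) set" where
  "norm_pairs n = {(x, y). x\<^sup>2 + y\<^sup>2 = int n}"

lemma norm_pairs_fiber: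
  assumes "i \<le> n"
  shows "{p \<in> norm_pairs n. nat ((fst p)\<^sup>2) = i} = square_roots i \<times> square_roots (n - i)"
  using assms by (auto simp: norm_pairs_def square_roots_def of_nat_diff)

lemma finite_norm_pairs: "finite (norm_pairs n)"
proof (rule finite_subset)
  show "norm_pairs n \<subseteq> (\<Union>i\<le>n. square_roots i \<times> square_roots (n - i))"
  proof
    fix p assume p: "p \<in> norm_pairs n"
    then have "(fst p)\<^sup>2 \<le> int n" by (auto simp: norm_pairs_def) (smt (verit) zero_le_power2)
    then have "nat ((fst p)\<^sup>2) \<le> n" by simp
    then show "p \<in> (\<Union>i\<le>n. square_roots i \<times> square_roots (n - i))"
      using norm_pairs_fiber[of "nat ((fst p)\<^sup>2)" n] p by blast
  qed
qed (use finite_square_roots in auto)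

text \<open>The weights \<open>a\<close> and \<open>b\<close> allow one statement to serve
  \<open>phi^2\<close> and the product \<open>phi * fps_alt phi\<close>, where the sign sits on one
  factor only.\<close>

lemma theta_product_nth:
  fixes a b :: "nat \<Rightarrow> int"
  shows "fps_nth (Abs_fps (\<lambda>i. a i * fps_nth phi i) * Abs_fps (\<lambda>i. b i * fps_nth phi i)) n
     = (\<Sum>(x,y)\<in>norm_pairs n. a (nat (x\<^sup>2)) * b (nat (y\<^sup>2)))"
proof -
  have "(\<Sum>(x,y)\<in>norm_pairs n. a (nat (x\<^sup>2)) * b (nat (y\<^sup>2))) =
     (\<Sum>i\<in>{0..n}. \<Sum>p\<in>{p \<in> norm_pairs n. nat ((fst p)\<^sup>2) = i}.
        a (nat ((fst p)\<^sup>2)) * b (nat ((snd p)\<^sup>2)))"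
  proof (subst sum.group)
    show "(\<lambda>p. nat ((fst p)\<^sup>2)) ` norm_pairs n \<subseteq> {0..n}"
      by (auto simp: norm_pairs_def nat_le_iff) (smt (verit) zero_le_power2)
  qed (auto simp: finite_norm_pairs case_prod_beta)
  also have "\<dots> = (\<Sum>i\<in>{0..n}. \<Sum>p\<in>square_roots i \<times> square_roots (n - i). a i * b (n - i))"
    by (intro sum.cong refl) (auto simp: norm_pairs_fiber square_roots_def simp del: of_nat_diff)
  also have "\<dots> = (\<Sum>i\<in>{0..n}. a i * fps_nth phi i * (b (n - i) * fps_nth phi (n - i)))"
    by (intro sum.cong) (simp_all add: phi_def card_cartesian_product)
  finally show ?thesis by (simp add: fps_mult_nth)
qed

lemma phi_square_nth: "fps_nth (phi\<^sup>2) n = int (card (norm_pairs n))"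
  using theta_product_nth[of "\<lambda>_. 1" "\<lambda>_. 1" n]
  by (simp add: power2_eq_square case_prod_beta fps_nth_inverse)

text \<open>On Gaussian integers this map is conjugation followed by multiplication by
  \<open>1 + \<i>\<close>. It is onto because the two entries of a pair of norm \<open>2 * n\<close>
  have equal parity.\<close>

lemma bij_betw_norm_pairs_double:
  "bij_betw (\<lambda>(u,v). (u + v, u - v)) (norm_pairs n) (norm_pairs (2 * n))"
proof (rule bij_betwI[where g = "\<lambda>(x,y). ((x + y) div 2, (x - y) div 2)"])
  show "(\<lambda>(u,v). (u + v, u - v)) \<in> norm_pairs n \<rightarrow> norm_pairs (2 * n)"
    by (auto simp: norm_pairs_def power2_eq_square algebra_simps)
  have par: "\<exists>u v. x = u + v \<and> y = u - v" if "(x, y) \<in> norm_pairs (2 * n)" for x y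
  proof -
    have "x\<^sup>2 + y\<^sup>2 = 2 * int n" using that by (simp add: norm_pairs_def)
    then have "even (x\<^sup>2 + y\<^sup>2)" by simp
    then have "even (x + y)" by simp
    then obtain k where "x + y = 2 * k" by blast
    then show ?thesis by (intro exI[of _ k] exI[of _ "x - k"]) simp
  qed
  show "(\<lambda>(x,y). ((x + y) div 2, (x - y) div 2)) \<in> norm_pairs (2 * n) \<rightarrow> norm_pairs n"
  proof safe
    fix x y assume xy: "(x, y) \<in> norm_pairs (2 * n)"
    then obtain u v where uv: "x = u + v" "y = u - v" using par by blast
    have "2 * (u\<^sup>2 + v\<^sup>2) = 2 * int n"
      using xy by (simp add: uv norm_pairs_def power2_eq_square algebra_simps)
    then show "((x + y) div 2, (x - y) div 2) \<in> norm_pairs n"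
      by (simp add: uv norm_pairs_def)
  qed
  show "(\<lambda>(u,v). (u + v, u - v)) ((\<lambda>(x,y). ((x + y) div 2, (x - y) div 2)) p) = p"
    if "p \<in> norm_pairs (2 * n)" for p
    using par[of "fst p" "snd p"] that by (cases p) auto
qed auto

lemma phi_square_double: "fps_nth (phi\<^sup>2) (2 * n) = fps_nth (phi\<^sup>2) n"
  unfolding phi_square_nth using bij_betw_same_card[OF bij_betw_norm_pairs_double[of n]] by simp

lemma phi_square_add_alt:
  "phi\<^sup>2 + (fps_alt phi)\<^sup>2 = 2 * fps_dilate (phi\<^sup>2)"
proof (rule fps_ext)
  fix n
  show "fps_nth (phi\<^sup>2 + (fps_alt phi)\<^sup>2) n = fps_nth (2 * fps_dilate (phi\<^sup>2)) n"
    unfolding fps_alt_power[symmetric]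
    by (cases "even n")
       (auto simp: fps_dilate_def fps_mult_numeral_left phi_square_double simp del: fps_alt_power elim!: evenE)
qed

text \<open>For even \<open>n = 2 m\<close> the doubling bijection turns \<open>y\<close> into
  \<open>u - v\<close>, whose square has the parity of \<open>m\<close>, so all signs agree. For odd
  \<open>n\<close> exactly one of \<open>x\<close> and \<open>y\<close> is odd, and exchanging them
  reverses every sign.\<close>

lemma phi_mult_alt:
  "phi * fps_alt phi = fps_dilate ((fps_alt phi)\<^sup>2)"
proof (rule fps_ext)
  fix n
  have "fps_nth (phi * fps_alt phi) n = (\<Sum>(x,y)\<in>norm_pairs n. (-1) ^ nat (y\<^sup>2))"
    using theta_product_nth[of "\<lambda>_. 1" "\<lambda>i. (-1) ^ i" n]
    by (simp add: fps_alt_def fps_nth_inverse)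
  also have "\<dots> = fps_nth (fps_dilate (fps_alt (phi\<^sup>2))) n"
  proof (cases "even n")
    case True
    then obtain m where m: "n = 2 * m" by blast
    have "(\<Sum>(x,y)\<in>norm_pairs n. (-1) ^ nat (y\<^sup>2)) = (\<Sum>(u,v)\<in>norm_pairs m. (-1 :: int) ^ nat ((u - v)\<^sup>2))"
      unfolding m by (subst sum.reindex_bij_betw[OF bij_betw_norm_pairs_double, symmetric])
        (simp add: case_prod_beta)
    also have "\<dots> = (\<Sum>(u,v)\<in>norm_pairs m. (-1) ^ m)"
    proof (intro sum.cong refl, clarify)
      fix u v assume "(u, v) \<in> norm_pairs m"
      then have "int m = (u - v)\<^sup>2 + 2 * (u * v)"
        by (simp add: norm_pairs_def power2_eq_square algebra_simps)
      then have "even (int m) \<longleftrightarrow> even ((u - v)\<^sup>2)" by simp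
      moreover have "even (nat ((u - v)\<^sup>2)) \<longleftrightarrow> even ((u - v)\<^sup>2)"
        by (subst even_nat_iff) auto
      ultimately show "(-1) ^ nat ((u - v)\<^sup>2) = (-1 :: int) ^ m"
        by (simp add: minus_one_power_iff)
    qed
    finally show ?thesis by (simp add: m fps_dilate_def phi_square_nth case_prod_beta del: fps_alt_power)
  next
    case False
    let ?s = "\<Sum>(x,y)\<in>norm_pairs n. (-1 :: int) ^ nat (y\<^sup>2)"
    have "?s = (\<Sum>(x,y)\<in>norm_pairs n. (-1) ^ nat (x\<^sup>2))"
      by (rule sum.reindex_bij_witness[of _ prod.swap prod.swap])
         (auto simp: norm_pairs_def add.commute)
    also have "\<dots> = (\<Sum>(x,y)\<in>norm_pairs n. - ((-1) ^ nat (y\<^sup>2)))"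
    proof (intro sum.cong refl, clarify)
      fix x y assume "(x, y) \<in> norm_pairs n"
      then have "int n = x\<^sup>2 + y\<^sup>2" by (simp add: norm_pairs_def)
      then have "even (int n) \<longleftrightarrow> (even x \<longleftrightarrow> even y)" by simp
      moreover have "even (nat (z\<^sup>2)) \<longleftrightarrow> even z" for z :: int
        by (subst even_nat_iff) auto
      ultimately show "(-1) ^ nat (x\<^sup>2) = - ((-1 :: int) ^ nat (y\<^sup>2))"
        using False by (simp add: minus_one_power_iff)
    qed
    also have "\<dots> = - ?s" by (simp add: case_prod_beta sum_negf)
    finally show ?thesis using False by (simp add: fps_dilate_def)
  qed
  finally show "fps_nth (phi * fps_alt phi) n = fps_nth (fps_dilate ((fps_alt phi)\<^sup>2)) n"
    by simp
qed

section \<open>Splitting theta by parity of the exponent; the forms A and F\<close>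

definition theta_odd :: "int fps" where
  "theta_odd = Abs_fps (\<lambda>n. if odd n \<and> is_square n then 1 else 0)"

definition theta_even :: "int fps" where
  "theta_even = Abs_fps (\<lambda>n. if even n then fps_nth phi n else 0)"

lemma phi_decomp: "phi = theta_even + 2 * theta_odd"
  by (rule fps_ext)
     (auto simp: theta_even_def theta_odd_def phi_def card_square_roots fps_mult_numeral_left
        elim: oddE)

lemma fps_alt_theta_decomp: "fps_alt phi = theta_even - 2 * theta_odd"
  by (rule fps_ext)
     (auto simp: theta_even_def theta_odd_def phi_def card_square_roots fps_mult_numeral_left
        elim: oddE)

definition modA :: "int fps" where "modA = phi ^ 4"

text \<open>With \<open>E\<close> and \<open>O\<close> for the even and odd parts,
  \<open>(E + 2 O)^4 - (E - 2 O)^4 = 16 E O (E^2 + 4 O^2)\<close>. The closed form makes the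
  division by 16 integral from the start.\<close>

definition modF :: "int fps" where
  "modF = theta_even * theta_odd * (theta_even\<^sup>2 + 4 * theta_odd\<^sup>2)"

lemma modA_diff_alt: "modA - fps_alt modA = 16 * modF"
  unfolding modA_def modF_def fps_alt_power fps_alt_theta_decomp
  unfolding phi_decomp by (simp add: power4_eq_xxxx power2_eq_square algebra_simps)

lemma theta_even_nth_0: "fps_nth theta_even 0 = 1"
  by (simp add: theta_even_def phi_def card_square_roots)

lemma phi_nth_0: "fps_nth phi 0 = 1"
  by (simp add: phi_def card_square_roots)

lemma theta_odd_nth: "fps_nth theta_odd 0 = 0" "fps_nth theta_odd 1 = 1"
  by (simp_all add: theta_odd_def)

lemma modA_nth_0: "fps_nth modA 0 = 1"
  by (simp add: modA_def phi_nth_0 fps_power_zeroth)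

lemma modF_nth: "fps_nth modF 0 = 0" "fps_nth modF 1 = 1"
  using theta_even_nth_0 theta_odd_nth
  by (simp_all add: modF_def fps_mult_nth_1 power2_eq_square numeral_fps_const)

section \<open>Integer power series evaluated on the unit disc\<close>

definition of_ints :: "int fps \<Rightarrow> 'a::comm_ring_1 fps" where
  "of_ints f = Abs_fps (\<lambda>n. of_int (fps_nth f n))"

lemma of_ints_nth [simp]: "fps_nth (of_ints f) n = of_int (fps_nth f n)"
  by (simp add: of_ints_def)

lemma of_ints_hom [simp]:
  "of_ints (f + g) = of_ints f + of_ints g"
  "of_ints (f - g) = of_ints f - of_ints g"
  "of_ints (f * g) = of_ints f * of_ints g"
  "of_ints 1 = 1" "of_ints 0 = 0" "of_ints (fps_const c) = fps_const (of_int c)"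
  "of_ints (fps_alt f) = fps_alt (of_ints f)"
  "of_ints (fps_dilate f) = fps_dilate (of_ints f)"
  by (simp_all add: fps_eq_iff fps_mult_nth fps_dilate_def)

lemma of_ints_power [simp]: "of_ints (f ^ n) = of_ints f ^ n"
  by (induction n) auto

lemma of_ints_sum [simp]: "of_ints (sum f A) = (\<Sum>x\<in>A. of_ints (f x))"
  by (induction A rule: infinite_finite_induct) auto

lemma of_ints_numeral [simp]: "of_ints (numeral k) = numeral k"
  by (metis fps_numeral_fps_const of_ints_hom(6) of_int_numeral)

lemma of_ints_eq_iff [simp]:
  "(of_ints f :: 'a::{comm_ring_1,ring_char_0} fps) = of_ints g \<longleftrightarrow> f = g"
  by (simp add: fps_eq_iff)

abbreviation cfps :: "int fps \<Rightarrow> complex fps" where "cfps \<equiv> of_ints"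
abbreviation rfps :: "int fps \<Rightarrow> real fps" where "rfps \<equiv> of_ints"

abbreviation conv_disc :: "'a::{banach,real_normed_div_algebra} fps \<Rightarrow> bool" where
  "conv_disc f \<equiv> fps_conv_radius f \<ge> 1"

lemma conv_disc_bounded:
  fixes f :: "'a::{banach,real_normed_div_algebra} fps"
  assumes "\<And>n. norm (fps_nth f n) \<le> C"
  shows "conv_disc f"
  unfolding fps_conv_radius_def
proof (rule conv_radius_geI_ex')
  fix r :: real assume r: "0 < r" "ereal r < 1"
  have "summable (\<lambda>n. C * r ^ n)" using r by (intro summable_mult summable_geometric) auto
  then show "summable (\<lambda>n. fps_nth f n * of_real r ^ n)"
    by (rule summable_comparison_test'[of _ 0])
       (use r assms in \<open>auto simp: norm_mult norm_power intro!: mult_right_mono\<close>)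
qed

lemma fps_conv_radius_alt [simp]:
  fixes f :: "'a::{banach,real_normed_field} fps"
  shows "fps_conv_radius (fps_alt f) = fps_conv_radius f"
  unfolding fps_conv_radius_def
  by (rule conv_radius_cong) (simp_all add: norm_mult norm_power)

lemma norm_theta_nth_le: "\<bar>real_of_int (fps_nth phi n)\<bar> \<le> 2"
  by (simp add: phi_def card_square_roots)

lemma conv_disc_theta:
  "conv_disc (rfps phi)" "conv_disc (cfps phi)"
  using norm_theta_nth_le by (auto intro!: conv_disc_bounded[where C = 2] simp: norm_of_int)

lemma conv_disc_mult:
  fixes f g :: "'a::{banach,real_normed_div_algebra,comm_ring_1} fps"
  assumes "conv_disc f" "conv_disc g"
  shows "conv_disc (f * g)"
  using fps_conv_radius_mult[of f g] assms by (meson min.boundedI order_trans)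

lemma conv_disc_power:
  fixes f :: "'a::{banach,real_normed_div_algebra,comm_ring_1} fps"
  assumes "conv_disc f"
  shows "conv_disc (f ^ n)"
  using fps_conv_radius_power[of f n] assms by (meson order_trans)

lemma conv_disc_add:
  fixes f g :: "'a::{banach,real_normed_div_algebra} fps"
  assumes "conv_disc f" "conv_disc g"
  shows "conv_disc (f + g)" "conv_disc (f - g)"
  using fps_conv_radius_add[of f g] fps_conv_radius_diff[of f g] assms by (meson min.boundedI order_trans)+

lemma eval_fps_alt: "eval_fps (fps_alt f) z = eval_fps f (- z)"
proof -
  have "(-1) ^ n * fps_nth f n * z ^ n = fps_nth f n * (- z) ^ n" for n
    by (simp add: power_minus[of z])
  then show ?thesis by (simp add: eval_fps_def)
qed

lemma eval_fps_dilate: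
  fixes f :: "'a::{banach,real_normed_field} fps"
  assumes "norm (z\<^sup>2) < fps_conv_radius f"
  shows "eval_fps (fps_dilate f) z = eval_fps f (z\<^sup>2)"
proof -
  have "(\<lambda>n. fps_nth f n * (z\<^sup>2) ^ n) sums eval_fps f (z\<^sup>2)"
    by (rule sums_eval_fps[OF assms])
  then have "(\<lambda>n. fps_nth (fps_dilate f) (2 * n) * z ^ (2 * n)) sums eval_fps f (z\<^sup>2)"
    by (simp add: fps_dilate_def power_mult)
  then have "(\<lambda>n. fps_nth (fps_dilate f) n * z ^ n) sums eval_fps f (z\<^sup>2)"
    by (subst (asm) sums_mono_reindex)
       (auto simp: strict_mono_def fps_dilate_def elim!: evenE)
  then show ?thesis by (simp add: eval_fps_def sums_iff)
qed

lemma ereal_less_conv_radius: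
  assumes "conv_disc f" "norm z < 1"
  shows "ereal (norm z) < fps_conv_radius f"
  using assms by (metis ereal_less(3) less_le_trans one_ereal_def)

text \<open>Polymorphic in the field: the real instance drives the arithmetic-geometric mean, the
  complex one the transformation laws.\<close>

lemma eval_theta_identities:
  fixes z :: "'a::{banach,real_normed_field}"
  assumes z: "norm z < 1" and cv: "conv_disc (of_ints phi :: 'a fps)"
  defines "\<theta> \<equiv> eval_fps (of_ints phi)"
  shows "\<theta> z * \<theta> (- z) = (\<theta> (- (z\<^sup>2)))\<^sup>2"
    and "(\<theta> z)\<^sup>2 + (\<theta> (- z))\<^sup>2 = 2 * (\<theta> (z\<^sup>2))\<^sup>2"
proof -
  let ?f = "of_ints phi :: 'a fps"
  have z2: "norm (z\<^sup>2) < 1" "norm (- (z\<^sup>2)) < 1" "norm (- z) < 1"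
    using z by (simp_all add: norm_power power_less_one_iff)
  have cva: "conv_disc (fps_alt ?f)"
    using cv by simp
  note r = ereal_less_conv_radius
  have "of_ints (phi * fps_alt phi) = (fps_dilate ((fps_alt ?f)\<^sup>2))"
    unfolding phi_mult_alt by simp
  then have "eval_fps (?f * fps_alt ?f) z = eval_fps (fps_dilate ((fps_alt ?f)\<^sup>2)) z"
    by simp
  then show "\<theta> z * \<theta> (- z) = (\<theta> (- (z\<^sup>2)))\<^sup>2"
    using r[OF conv_disc_power[OF cva] z2(1)] r[OF cva z2(1)] r[OF cv z] r[OF cva z]
    by (simp add: eval_fps_mult eval_fps_dilate eval_fps_power eval_fps_alt \<theta>_def del: fps_alt_power)
  have "of_ints (phi\<^sup>2 + (fps_alt phi)\<^sup>2) = 2 * (fps_dilate (?f\<^sup>2))"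
    unfolding phi_square_add_alt by simp
  then have "?f\<^sup>2 + (fps_alt ?f)\<^sup>2 = fps_dilate (?f\<^sup>2) + fps_dilate (?f\<^sup>2)"
    unfolding mult_2 by simp
  moreover have "fps_dilate (?f\<^sup>2) + fps_dilate (?f\<^sup>2) = fps_dilate (?f\<^sup>2 + ?f\<^sup>2)"
    by (simp add: fps_eq_iff fps_dilate_def)
  ultimately have "eval_fps (?f\<^sup>2 + (fps_alt ?f)\<^sup>2) z = eval_fps (?f\<^sup>2 + ?f\<^sup>2) (z\<^sup>2)"
    using r[OF conv_disc_add(1)[OF conv_disc_power[OF cv] conv_disc_power[OF cv]] z2(1)]
    by (simp only: eval_fps_dilate)
  moreover have "eval_fps (?f\<^sup>2 + (fps_alt ?f)\<^sup>2) z = (\<theta> z)\<^sup>2 + (\<theta> (- z))\<^sup>2"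
    using r[OF conv_disc_power[OF cva] z] r[OF conv_disc_power[OF cv] z] r[OF cv z] r[OF cva z]
    by (simp add: eval_fps_add eval_fps_power eval_fps_alt \<theta>_def del: fps_alt_power)
  moreover have "eval_fps (?f\<^sup>2 + ?f\<^sup>2) (z\<^sup>2) = (\<theta> (z\<^sup>2))\<^sup>2 + (\<theta> (z\<^sup>2))\<^sup>2"
    using r[OF conv_disc_power[OF cv] z2(1)] r[OF cv z2(1)]
    by (simp only: eval_fps_add eval_fps_power \<theta>_def)
  ultimately show "(\<theta> z)\<^sup>2 + (\<theta> (- z))\<^sup>2 = 2 * (\<theta> (z\<^sup>2))\<^sup>2" by simp
qed

section \<open>The inversion formula on the imaginary axis\<close>

definition rtheta :: "real \<Rightarrow> real" where
  "rtheta x = eval_fps (rfps phi) x"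

lemma rtheta_sums:
  assumes "\<bar>x\<bar> < 1"
  shows "(\<lambda>n. real_of_int (fps_nth phi n) * x ^ n) sums rtheta x"
  using sums_eval_fps[OF ereal_less_conv_radius[OF conv_disc_theta(1)], of x] assms
  by (simp add: rtheta_def)

lemma rtheta_sums_squares:
  assumes "\<bar>x\<bar> < 1"
  shows "(\<lambda>m. 2 * x ^ (Suc m)\<^sup>2) sums (rtheta x - 1)"
proof -
  have sm: "strict_mono (\<lambda>m::nat. m\<^sup>2)" by (auto simp: strict_mono_def power_strict_mono)
  have "(\<lambda>m. real_of_int (fps_nth phi (m\<^sup>2)) * x ^ (m\<^sup>2)) sums rtheta x"
    by (subst sums_mono_reindex[OF sm])
       (use rtheta_sums[OF assms] in \<open>auto simp: phi_def card_square_roots is_nth_power_def\<close>)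
  then have "(\<lambda>m. real_of_int (fps_nth phi ((Suc m)\<^sup>2)) * x ^ ((Suc m)\<^sup>2)) sums
      (rtheta x - real_of_int (fps_nth phi (0\<^sup>2)) * x ^ 0\<^sup>2)"
    using sums_Suc_iff[of "\<lambda>m. real_of_int (fps_nth phi (m\<^sup>2)) * x ^ (m\<^sup>2)"
        "rtheta x - real_of_int (fps_nth phi (0\<^sup>2)) * x ^ 0\<^sup>2"] by simp
  then show ?thesis
    by (simp add: phi_def card_square_roots is_nth_power_nth_power del: power_Suc)
qed

lemma rtheta_mono:
  assumes "0 \<le> x" "x \<le> y" "y < 1"
  shows "rtheta x \<le> rtheta y"
proof -
  have "rtheta x - 1 \<le> rtheta y - 1"
    by (rule sums_le[OF _ rtheta_sums_squares rtheta_sums_squares])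
       (use assms in \<open>auto intro!: mult_left_mono power_mono\<close>)
  then show ?thesis by simp
qed

lemma rtheta_ge_1:
  assumes "0 \<le> x" "x < 1"
  shows "rtheta x \<ge> 1"
  using suminf_nonneg[OF sums_summable[OF rtheta_sums_squares[of x]]] assms
  by (simp add: sums_unique[OF rtheta_sums_squares[of x], symmetric])

section \<open>Size of theta near 1 by comparison with the Gaussian integral\<close>

lemma gaussian_integral_tendsto:
  "((\<lambda>y. integral {0..y} (\<lambda>x::real. exp (- x\<^sup>2))) \<longlongrightarrow> sqrt pi / 2) at_top"
proof -
  let ?f = "\<lambda>x::real. indicator {0..} x *\<^sub>R exp (- x\<^sup>2)"
  have "((\<lambda>y. \<integral>x. indicator {..y} x *\<^sub>R ?f x \<partial>lborel) \<longlongrightarrow> (\<integral>x. ?f x \<partial>lborel)) at_top"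
    by (rule tendsto_integral_at_top[OF _ integrable.intros[OF gaussian_moment_0]]) simp
  moreover have "(\<integral>x. indicator {..y} x *\<^sub>R ?f x \<partial>lborel) = integral {0..y} (\<lambda>x. exp (- x\<^sup>2))" for y
  proof -
    have "set_integrable lborel {0..y} (\<lambda>x. exp (- x\<^sup>2))"
      by (intro borel_integrable_atLeastAtMost') (auto intro!: continuous_intros)
    then have "(LINT x:{0..y}|lborel. exp (- x\<^sup>2)) = integral {0..y} (\<lambda>x. exp (- x\<^sup>2))"
      by (rule set_borel_integral_eq_integral)
    moreover have "indicator {..y} x *\<^sub>R ?f x = indicator {0..y} x *\<^sub>R exp (- x\<^sup>2)" for x
      by (auto simp: indicator_def)
    ultimately show ?thesis by (simp only: set_lebesgue_integral_def)
  qed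
  ultimately show ?thesis
    unfolding has_bochner_integral_integral_eq[OF gaussian_moment_0] by (simp only:)
qed

lemma gaussian_step_bounds:
  fixes h :: real
  assumes "h > 0"
  defines "f \<equiv> \<lambda>x::real. exp (- x\<^sup>2)"
  shows "(\<Sum>n<N. h * f (real (Suc n) * h)) \<le> integral {0..real N * h} f"
    and "integral {0..real N * h} f \<le> (\<Sum>n<N. h * f (real n * h))"
proof -
  have int: "f integrable_on {a..b}" for a b
    unfolding f_def by (intro integrable_continuous_interval continuous_intros)
  have step: "integral {0..real (Suc N) * h} f = integral {0..real N * h} f + integral {real N * h..real (Suc N) * h} f" for N
    by (rule Henstock_Kurzweil_Integration.integral_combine[symmetric]) (use assms(1) int in \<open>auto simp: algebra_simps\<close>)
  have len: "integral {real N * h..real (Suc N) * h} (\<lambda>_. c) = h * c" for N and c :: real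
    using assms(1) by (simp add: algebra_simps)
  have lo: "h * f (real (Suc N) * h) \<le> integral {real N * h..real (Suc N) * h} f" for N
  proof -
    have "integral {real N * h..real (Suc N) * h} (\<lambda>_. f (real (Suc N) * h)) \<le> integral {real N * h..real (Suc N) * h} f"
    proof (rule integral_le[OF _ int])
      fix x assume x: "x \<in> {real N * h..real (Suc N) * h}"
      moreover have "0 \<le> real N * h" using assms(1) by simp
      ultimately show "f (real (Suc N) * h) \<le> f x" by (auto simp: f_def intro!: power_mono)
    qed auto
    then show ?thesis by (simp only: len)
  qed
  have up: "integral {real N * h..real (Suc N) * h} f \<le> h * f (real N * h)" for N
  proof -
    have "integral {real N * h..real (Suc N) * h} f \<le> integral {real N * h..real (Suc N) * h} (\<lambda>_. f (real N * h))"
    proof (rule integral_le[OF int])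
      fix x assume x: "x \<in> {real N * h..real (Suc N) * h}"
      moreover have "0 \<le> real N * h" using assms(1) by simp
      ultimately show "f x \<le> f (real N * h)" by (auto simp: f_def intro!: power_mono)
    qed auto
    then show ?thesis by (simp only: len)
  qed
  show "(\<Sum>n<N. h * f (real (Suc n) * h)) \<le> integral {0..real N * h} f"
  proof (induction N)
    case (Suc N)
    then show ?case using lo[of N] step[of N] by (simp only: sum.lessThan_Suc)
  qed simp
  show "integral {0..real N * h} f \<le> (\<Sum>n<N. h * f (real n * h))"
  proof (induction N)
    case (Suc N)
    then show ?case using up[of N] step[of N] by (simp only: sum.lessThan_Suc)
  qed simp
qed

text \<open>With step \<open>h = sqrt (pi * e)\<close> the theta series is a Riemann sum of the
  decreasing function \<open>exp (- x^2)\<close>. Left and right sums differ by the single term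
  \<open>h\<close>, which encloses \<open>S\<close> in an interval of length 1 and
  \<open>rtheta = 2 S + 1\<close> in one of length 2 centred at \<open>1 / sqrt e\<close>.\<close>

lemma rtheta_near_1:
  assumes e: "e > 0"
  shows "\<bar>rtheta (exp (- (pi * e))) - 1 / sqrt e\<bar> \<le> 1"
proof -
  define h where "h = sqrt (pi * e)"
  have h: "h > 0" "h\<^sup>2 = pi * e" using e by (auto simp: h_def)
  let ?x = "exp (- (pi * e))"
  define f where "f = (\<lambda>x::real. exp (- x\<^sup>2))"
  have x: "\<bar>?x\<bar> < 1" using e by simp
  have f_eq: "f (real n * h) = ?x ^ (n\<^sup>2)" for n
    unfolding f_def by (simp add: power_mult_distrib h exp_of_nat_mult[symmetric] mult_ac)
  define S where "S = (rtheta ?x - 1) / 2"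
  have S: "(\<lambda>n. f (real (Suc n) * h)) sums S"
    using sums_divide[OF rtheta_sums_squares[OF x], of 2] unfolding f_eq S_def by simp
  have lim: "(\<lambda>N. integral {0..real N * h} f) \<longlonglongrightarrow> sqrt pi / 2"
    unfolding f_def
    by (rule filterlim_compose[OF gaussian_integral_tendsto])
       (use h in \<open>intro filterlim_at_top_mult_tendsto_pos[OF tendsto_const] filterlim_real_sequentially; simp\<close>)
  have lim1: "(\<lambda>N. \<Sum>n<N. h * f (real (Suc n) * h)) \<longlonglongrightarrow> h * S"
    using sums_mult[OF S, of h] by (simp add: sums_def)
  have "(\<lambda>n. f (real n * h)) sums (S + f (real 0 * h))"
    using S by (subst (asm) sums_Suc_iff) 
  then have lim2: "(\<lambda>N. \<Sum>n<N. h * f (real n * h)) \<longlonglongrightarrow> h * (S + 1)"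
    using sums_mult[of "\<lambda>n. f (real n * h)" "S + 1" h] by (simp add: sums_def f_def)
  have b1: "h * S \<le> sqrt pi / 2"
    by (rule LIMSEQ_le[OF lim1 lim]) (use gaussian_step_bounds(1)[OF h(1)] in \<open>auto simp: f_def\<close>)
  have b2: "sqrt pi / 2 \<le> h * (S + 1)"
    by (rule LIMSEQ_le[OF lim lim2]) (use gaussian_step_bounds(2)[OF h(1)] in \<open>auto simp: f_def\<close>)
  have hs: "sqrt pi = h * (1 / sqrt e)" using e by (simp add: h_def real_sqrt_mult)
  have "h * (rtheta ?x - 1) \<le> h * (1 / sqrt e)" using b1 hs by (simp add: S_def)
  then have "rtheta ?x - 1 \<le> 1 / sqrt e" by (rule mult_left_le_imp_le[OF _ h(1)])
  moreover have "h * (1 / sqrt e) \<le> h * (rtheta ?x + 1)" using b2 hs by (simp add: S_def field_simps)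
  then have "1 / sqrt e \<le> rtheta ?x + 1" by (rule mult_left_le_imp_le[OF _ h(1)])
  ultimately show ?thesis by (simp only: abs_le_iff) linarith
qed

text \<open>The mean iteration is monotone and homogeneous of degree 1. After scaling both sequences
  to the same first entry, the order of the second entries persists and passes to the limits;
  cross-multiplication expresses the scaling without division.\<close>

lemma agm_compare:
  fixes a b a' b' :: "nat \<Rightarrow> real"
  assumes "\<And>n. a (Suc n) = (a n + b n) / 2" "\<And>n. b (Suc n) = sqrt (a n * b n)"
    and "\<And>n. a' (Suc n) = (a' n + b' n) / 2" "\<And>n. b' (Suc n) = sqrt (a' n * b' n)"
    and nonneg: "\<And>n. a n \<ge> 0" "\<And>n. b n \<ge> 0" "\<And>n. a' n \<ge> 0" "\<And>n. b' n \<ge> 0"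
    and init: "b 0 * a' 0 \<le> b' 0 * a 0"
    and lim: "a \<longlonglongrightarrow> l" "a' \<longlonglongrightarrow> l'"
  shows "l * a' 0 \<le> l' * a 0"
proof -
  have "a n * a' 0 \<le> a' n * a 0 \<and> b n * a' 0 \<le> b' n * a 0" for n
  proof (induction n)
    case (Suc n)
    have "b (Suc n) * a' 0 = sqrt ((a n * a' 0) * (b n * a' 0))"
      using nonneg by (simp add: assms(2) real_sqrt_mult mult_ac)
    also have "\<dots> \<le> sqrt ((a' n * a 0) * (b' n * a 0))"
      using Suc nonneg
      by (intro real_sqrt_le_mono mult_mono[of "a n * a' 0" "a' n * a 0" "b n * a' 0" "b' n * a 0"]) auto
    also have "\<dots> = b' (Suc n) * a 0"
      using nonneg by (simp add: assms(4) real_sqrt_mult mult_ac)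
    finally have "b (Suc n) * a' 0 \<le> b' (Suc n) * a 0" .
    moreover have "a (Suc n) * a' 0 \<le> a' (Suc n) * a 0"
      using Suc by (simp add: assms(1,3) algebra_simps)
    ultimately show ?case by simp
  qed (use init in auto)
  then show ?thesis
    by (intro LIMSEQ_le[OF tendsto_mult_right[OF lim(1)] tendsto_mult_right[OF lim(2)]]) auto
qed

text \<open>The squares of the Jacobi theta constants \<open>\<theta>\<^sub>3\<close>, \<open>\<theta>\<^sub>4\<close>, \<open>\<theta>\<^sub>2\<close> at \<open>\<i> t\<close>.\<close>
definition thA :: "real \<Rightarrow> real" where "thA t = (rtheta (exp (- (pi * t))))\<^sup>2"
definition thB :: "real \<Rightarrow> real" where "thB t = (rtheta (- exp (- (pi * t))))\<^sup>2"
definition thC :: "real \<Rightarrow> real" where "thC t = thA (t / 2) - thA t"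

lemma thAB_double:
  assumes "t > 0"
  shows "thA (2 * t) = (thA t + thB t) / 2" "thB (2 * t) = sqrt (thA t * thB t)"
    "(thB (2 * t))\<^sup>2 = thA t * thB t"
proof -
  let ?x = "exp (- (pi * t))"
  have x: "norm ?x < 1" using assms by simp
  have x2: "exp (- (pi * (2 * t))) = ?x\<^sup>2" by (simp add: power2_eq_square flip: exp_add)
  note id = eval_theta_identities[OF x conv_disc_theta(1), folded rtheta_def]
  show "thA (2 * t) = (thA t + thB t) / 2"
    unfolding thA_def thB_def x2 using id(2) by simp
  have "thB (2 * t) = rtheta ?x * rtheta (- ?x)"
    unfolding thB_def x2 using id(1) by simp
  then show sq: "(thB (2 * t))\<^sup>2 = thA t * thB t"
    by (simp add: thA_def thB_def power_mult_distrib)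
  have "thB (2 * t) \<ge> 0" by (simp add: thB_def)
  then show "thB (2 * t) = sqrt (thA t * thB t)" unfolding sq[symmetric] by simp
qed

lemma thC_nonneg: "t > 0 \<Longrightarrow> thC t \<ge> 0"
  using rtheta_mono[of "exp (- (pi * t))" "exp (- (pi * (t/2)))"] rtheta_ge_1[of "exp (- (pi * t))"]
  by (simp add: thC_def thA_def power_mono)

text \<open>Duplication at \<open>t / 2\<close> gives
  \<open>thC t = (thA (t / 2) - thB (t / 2)) / 2\<close>. Jacobi's quartic identity and the halving
  step are algebraic consequences.\<close>

lemma thABC:
  assumes "t > 0"
  shows "(thA t)\<^sup>2 = (thB t)\<^sup>2 + (thC t)\<^sup>2" "thA (t / 2) = thA t + thC t"
    "thC (t / 2) = 2 * sqrt (thA t * thC t)"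
proof -
  have t: "t / 2 > 0" using assms by simp
  note d = thAB_double[OF t]
  show 2: "thA (t / 2) = thA t + thC t" by (simp add: thC_def)
  have sq: "(thA s)\<^sup>2 = (thB s)\<^sup>2 + (thC s)\<^sup>2" if "s > 0" for s
  proof -
    have "s / 2 > 0" using that by simp
    note e = thAB_double[OF this]
    have "thA s = (thA (s/2) + thB (s/2)) / 2" "(thB s)\<^sup>2 = thA (s/2) * thB (s/2)"
      using e by simp_all
    moreover from this have "thC s = (thA (s/2) - thB (s/2)) / 2" by (simp add: thC_def)
    ultimately show ?thesis by (simp only:) (simp add: power2_eq_square field_simps)
  qed
  show "(thA t)\<^sup>2 = (thB t)\<^sup>2 + (thC t)\<^sup>2" by (rule sq[OF assms])
  have "(thC (t / 2))\<^sup>2 = (thA (t/2))\<^sup>2 - (thB (t/2))\<^sup>2" using sq[OF t] by simp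
  also have "\<dots> = 4 * (thA t * thC t)"
  proof -
    have "thA t = (thA (t/2) + thB (t/2)) / 2" using d(1) by simp
    moreover from this have "thC t = (thA (t/2) - thB (t/2)) / 2" by (simp add: thC_def)
    ultimately show ?thesis by (simp only:) (simp add: power2_eq_square field_simps)
  qed
  finally have "thC (t / 2) = sqrt (4 * (thA t * thC t))"
    using thC_nonneg[OF t] by (metis real_sqrt_unique)
  then show "thC (t / 2) = 2 * sqrt (thA t * thC t)" by (simp add: real_sqrt_mult)
qed

lemma thA_at_infinity:
  assumes "t > 0"
  shows "(\<lambda>n. thA (2 ^ n * t)) \<longlonglongrightarrow> 1"
proof -
  have "(\<lambda>n. exp (- (pi * t)) ^ n) \<longlonglongrightarrow> 0"
    using assms by (intro LIMSEQ_power_zero) simp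
  then have "(\<lambda>n. exp (- (pi * t)) ^ (2 ^ n)) \<longlonglongrightarrow> 0"
    by (rule filterlim_compose) (rule filterlim_subseq, auto simp: strict_mono_def)
  moreover have "exp (- (pi * t)) ^ (2 ^ n) = exp (- (pi * (2 ^ n * t)))" for n :: nat
    by (simp add: exp_of_nat_mult[symmetric] mult_ac)
  ultimately have "(\<lambda>n. exp (- (pi * (2 ^ n * t)))) \<longlonglongrightarrow> 0" by simp
  moreover have "isCont (eval_fps (rfps phi)) 0"
    by (intro continuous_eval_fps continuous_ident)
       (use ereal_less_conv_radius[OF conv_disc_theta(1), of 0] in auto)
  ultimately have "(\<lambda>n. rtheta (exp (- (pi * (2 ^ n * t))))) \<longlonglongrightarrow> eval_fps (rfps phi) 0"
    unfolding rtheta_def by (rule isCont_tendsto_compose[rotated])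
  then show ?thesis
    unfolding thA_def using tendsto_power[where n = 2] by (fastforce simp: eval_fps_at_0 phi_nth_0)
qed

lemma thA_at_zero:
  assumes "t > 0"
  shows "(\<lambda>n. thA (t / 2 ^ n) / 2 ^ n) \<longlonglongrightarrow> 1 / t"
proof -
  define e where "e n = t / 2 ^ n" for n :: nat
  have e: "e n > 0" for n using assms by (simp add: e_def)
  have e0: "(\<lambda>n. sqrt (e n)) \<longlonglongrightarrow> 0"
  proof -
    have "e \<longlonglongrightarrow> 0" unfolding e_def by real_asymp
    from tendsto_real_sqrt[OF this] show ?thesis by simp
  qed
  have "(\<lambda>n. sqrt (e n) * rtheta (exp (- (pi * e n))) - 1) \<longlonglongrightarrow> 0"
  proof (rule Lim_null_comparison[OF _ e0], intro always_eventually allI)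
    fix n
    have "sqrt (e n) * rtheta (exp (- (pi * e n))) - 1 =
        sqrt (e n) * (rtheta (exp (- (pi * e n))) - 1 / sqrt (e n))"
      using e[of n] by (simp add: field_simps)
    then have "norm (sqrt (e n) * rtheta (exp (- (pi * e n))) - 1) =
        sqrt (e n) * \<bar>rtheta (exp (- (pi * e n))) - 1 / sqrt (e n)\<bar>"
      using e[of n] by (simp only: real_norm_def abs_mult) simp
    also have "\<dots> \<le> sqrt (e n) * 1"
      by (intro mult_left_mono rtheta_near_1[OF e]) (use e[of n] in auto)
    finally show "norm (sqrt (e n) * rtheta (exp (- (pi * e n))) - 1) \<le> sqrt (e n)" by simp
  qed
  then have "(\<lambda>n. sqrt (e n) * rtheta (exp (- (pi * e n)))) \<longlonglongrightarrow> 1" by (simp add: LIM_zero_iff)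
  then have "(\<lambda>n. (sqrt (e n) * rtheta (exp (- (pi * e n))))\<^sup>2 / t) \<longlonglongrightarrow> 1\<^sup>2 / t"
    using assms by (intro tendsto_intros) auto
  moreover have "(sqrt (e n) * rtheta (exp (- (pi * e n))))\<^sup>2 / t = thA (t / 2 ^ n) / 2 ^ n" for n
    using assms e[of n] by (simp add: power_mult_distrib thA_def) (simp add: e_def)
  ultimately show ?thesis by simp
qed

text \<open>
  Doubling \<open>t\<close> is an arithmetic-geometric mean step for the pair \<open>(thA t, thB t)\<close> and halving it
  is one for \<open>(thA t, thC t)\<close>.  Comparing the two iterations at \<open>t\<close> and \<open>1/t\<close> replaces Poisson
  summation.
\<close>
lemma thA_inversion:
  assumes t: "t > 0"
  shows "thA (1 / t) = t * thA t"
proof -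
  have AB: "\<And>n. thA (2 ^ Suc n * u) = (thA (2 ^ n * u) + thB (2 ^ n * u)) / 2"
     "\<And>n. thB (2 ^ Suc n * u) = sqrt (thA (2 ^ n * u) * thB (2 ^ n * u))" if "u > 0" for u
    using thAB_double[of "2 ^ _ * u"] that by (simp_all add: mult.assoc)
  have AC: "\<And>n. thA (u / 2 ^ Suc n) / 2 ^ Suc n = (thA (u / 2 ^ n) / 2 ^ n + thC (u / 2 ^ n) / 2 ^ n) / 2"
     "\<And>n. thC (u / 2 ^ Suc n) / 2 ^ Suc n = sqrt ((thA (u / 2 ^ n) / 2 ^ n) * (thC (u / 2 ^ n) / 2 ^ n))"
    if u: "u > 0" for u
  proof -
    fix n :: nat
    have *: "u / 2 ^ Suc n = (u / 2 ^ n) / 2" "u / 2 ^ n > 0" using u by simp_all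
    show "thA (u / 2 ^ Suc n) / 2 ^ Suc n = (thA (u / 2 ^ n) / 2 ^ n + thC (u / 2 ^ n) / 2 ^ n) / 2"
      unfolding *(1) thABC(2)[OF *(2)] by (simp add: field_simps)
    have "sqrt ((thA (u / 2 ^ n) / 2 ^ n) * (thC (u / 2 ^ n) / 2 ^ n)) =
        sqrt (thA (u / 2 ^ n) * thC (u / 2 ^ n) / (2 ^ n)\<^sup>2)"
      by (simp add: power2_eq_square)
    also have "\<dots> = sqrt (thA (u / 2 ^ n) * thC (u / 2 ^ n)) / 2 ^ n"
      by (simp add: real_sqrt_divide)
    finally show "thC (u / 2 ^ Suc n) / 2 ^ Suc n = sqrt ((thA (u / 2 ^ n) / 2 ^ n) * (thC (u / 2 ^ n) / 2 ^ n))"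
      unfolding *(1) thABC(3)[OF *(2)] by simp
  qed
  have nn: "thA u \<ge> 0" "thB u \<ge> 0" for u by (simp_all add: thA_def thB_def)
  \<comment> \<open>Doubling drives \<open>u\<close> to infinity, where the mean tends to 1; halving
    drives \<open>v\<close> to zero, where the rescaled mean tends to \<open>1 / v\<close>.\<close>
  have up: "thA v \<le> thA u / v" if uv: "u > 0" "v > 0" "thB u * thA v \<le> thC v * thA u" for u v
  proof -
    have C: "thC (v / 2 ^ n) / 2 ^ n \<ge> 0" for n using uv by (simp add: thC_nonneg)
    have "1 * (thA (v / 2 ^ 0) / 2 ^ 0) \<le> (1 / v) * thA (2 ^ 0 * u)"
      by (rule agm_compare[where a = "\<lambda>n. thA (2 ^ n * u)" and b = "\<lambda>n. thB (2 ^ n * u)" and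
            a' = "\<lambda>n. thA (v / 2 ^ n) / 2 ^ n" and b' = "\<lambda>n. thC (v / 2 ^ n) / 2 ^ n",
          OF AB(1)[OF uv(1)] AB(2)[OF uv(1)] AC(1)[OF uv(2)] AC(2)[OF uv(2)] nn(1) nn(2) _ C _
            thA_at_infinity[OF uv(1)] thA_at_zero[OF uv(2)]])
         (use nn uv in auto)
    then show ?thesis by simp
  qed
  have down: "thA u / v \<le> thA v" if uv: "u > 0" "v > 0" "thC v * thA u \<le> thB u * thA v" for u v
  proof -
    have C: "thC (v / 2 ^ n) / 2 ^ n \<ge> 0" for n using uv by (simp add: thC_nonneg)
    have "(1 / v) * thA (2 ^ 0 * u) \<le> 1 * (thA (v / 2 ^ 0) / 2 ^ 0)"
      by (rule agm_compare[where a' = "\<lambda>n. thA (2 ^ n * u)" and b' = "\<lambda>n. thB (2 ^ n * u)" and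
            a = "\<lambda>n. thA (v / 2 ^ n) / 2 ^ n" and b = "\<lambda>n. thC (v / 2 ^ n) / 2 ^ n",
          OF AC(1)[OF uv(2)] AC(2)[OF uv(2)] AB(1)[OF uv(1)] AB(2)[OF uv(1)] _ C nn(1) nn(2) _
            thA_at_zero[OF uv(2)] thA_at_infinity[OF uv(1)]])
         (use nn uv in auto)
    then show ?thesis by simp
  qed
  have sq: "(x * y)\<^sup>2 \<le> (z * w)\<^sup>2 \<longleftrightarrow> x * y \<le> z * w" if "x \<ge> 0" "y \<ge> 0" "z \<ge> 0" "w \<ge> 0" for x y z w :: real
    using that by (simp add: power2_le_iff_abs_le)
  define s where "s = 1 / t"
  have s: "s > 0" using t by (simp add: s_def)
  \<comment> \<open>After squaring, \<open>thA^2 = thB^2 + thC^2\<close> shows that the comparison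
    is symmetric in \<open>u\<close> and \<open>v\<close>. Whichever way it falls for
    \<open>1 / t\<close> and \<open>t\<close>, it falls the same way with the roles exchanged, and
    the two resulting inequalities are opposite.\<close>
  have flip: "thB u * thA v \<le> thC v * thA u \<longleftrightarrow> thB v * thA u \<le> thC u * thA v" if "u > 0" "v > 0" for u v
  proof -
    have "thB u * thA v \<le> thC v * thA u \<longleftrightarrow> (thB u)\<^sup>2 * (thA v)\<^sup>2 \<le> (thC v)\<^sup>2 * (thA u)\<^sup>2"
      using sq[of "thB u" "thA v" "thC v" "thA u"] nn thC_nonneg that by (simp add: power_mult_distrib)
    also have "\<dots> \<longleftrightarrow> (thB v)\<^sup>2 * (thA u)\<^sup>2 \<le> (thC u)\<^sup>2 * (thA v)\<^sup>2"
      using thABC(1)[OF that(1)] thABC(1)[OF that(2)] by (simp add: algebra_simps)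
    also have "\<dots> \<longleftrightarrow> thB v * thA u \<le> thC u * thA v"
      using sq[of "thB v" "thA u" "thC u" "thA v"] nn thC_nonneg that by (simp add: power_mult_distrib)
    finally show ?thesis .
  qed
  have "thA s = t * thA t"
  proof (cases "thB s * thA t \<le> thC t * thA s")
    case True
    have "thA t \<le> thA s / t" "thA s \<le> thA t / s"
      using up[OF s t True] up[OF t s] flip[OF s t] True by auto
    then show ?thesis using t by (simp add: s_def field_simps)
  next
    case False
    then have "thC t * thA s \<le> thB s * thA t" "thC s * thA t \<le> thB t * thA s"
      using flip[OF s t] by auto
    then have "thA s / t \<le> thA t" "thA t / s \<le> thA s"
      using down s t by auto
    then show ?thesis using t by (simp add: s_def field_simps)
  qed
  then show ?thesis by (simp add: s_def)
qed

section \<open>Modular forms on the upper half plane\<close>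

definition nome :: "complex \<Rightarrow> complex" where
  "nome \<tau> = exp (\<i> * of_real pi * \<tau>)"

definition qeval :: "complex fps \<Rightarrow> complex \<Rightarrow> complex" where
  "qeval f \<tau> = eval_fps f (nome \<tau>)"

text \<open>Approach to the cusp, uniform in the real part: the half planes
  \<open>Im \<tau> > Y\<close> form a base of this filter.\<close>

definition at_ii :: "complex filter" where
  "at_ii = filtercomap Im at_top"

lemma norm_nome: "norm (nome \<tau>) = exp (- (pi * Im \<tau>))"
  by (simp add: nome_def)

lemma norm_nome_less_1: "Im \<tau> > 0 \<Longrightarrow> norm (nome \<tau>) < 1"
  by (simp add: norm_nome)

lemma nome_nonzero: "nome \<tau> \<noteq> 0"
  by (simp add: nome_def)

lemma nome_add_1: "nome (\<tau> + 1) = - nome \<tau>"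
proof -
  have "nome (\<tau> + 1) = nome \<tau> * exp (\<i> * of_real pi)"
    unfolding nome_def by (simp add: ring_distribs exp_add)
  then show ?thesis by (simp add: exp_pi_i')
qed

lemma nome_double: "nome (2 * \<tau>) = (nome \<tau>)\<^sup>2"
  unfolding nome_def power2_eq_square exp_add[symmetric] by (simp add: algebra_simps)

lemma qeval_cong_nome: "nome \<sigma> = nome \<tau> \<Longrightarrow> qeval f \<sigma> = qeval f \<tau>"
  by (simp add: qeval_def)

lemma qeval_add_2: "qeval f (\<tau> + 2) = qeval f \<tau>"
proof (rule qeval_cong_nome)
  have "nome (\<tau> + 2) = nome ((\<tau> + 1) + 1)" by (simp add: add.assoc)
  then show "nome (\<tau> + 2) = nome \<tau>" by (simp only: nome_add_1) simp
qed

lemma qeval_alt: "qeval (fps_alt f) \<tau> = qeval f (\<tau> + 1)"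
  by (simp add: qeval_def nome_add_1 eval_fps_alt)

lemma nome_in_conv_radius:
  assumes "conv_disc f" "Im \<tau> > 0"
  shows "ereal (norm (nome \<tau>)) < fps_conv_radius f"
  using ereal_less_conv_radius[OF assms(1) norm_nome_less_1[OF assms(2)]] .

lemma
  assumes "conv_disc f" "conv_disc g" "Im \<tau> > 0"
  shows qeval_add: "qeval (f + g) \<tau> = qeval f \<tau> + qeval g \<tau>"
    and qeval_diff: "qeval (f - g) \<tau> = qeval f \<tau> - qeval g \<tau>"
    and qeval_mult: "qeval (f * g) \<tau> = qeval f \<tau> * qeval g \<tau>"
  using nome_in_conv_radius[OF assms(1,3)] nome_in_conv_radius[OF assms(2,3)]
  by (simp_all add: qeval_def eval_fps_add eval_fps_diff eval_fps_mult)

lemma qeval_power: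
  assumes "conv_disc f" "Im \<tau> > 0"
  shows "qeval (f ^ n) \<tau> = qeval f \<tau> ^ n"
  using nome_in_conv_radius[OF assms] by (simp add: qeval_def eval_fps_power)

lemma qeval_const: "qeval (fps_const c) \<tau> = c"
  by (simp add: qeval_def)

abbreviation uhp :: "complex set" where
  "uhp \<equiv> {\<tau>. Im \<tau> > 0}"

lemma open_uhp: "open uhp"
  using open_halfspace_Im_gt[of 0] by simp

lemma connected_uhp: "connected uhp"
  by (intro convex_connected convex_halfspace_Im_gt)

text \<open>Feeds the countability of the zero set of a nonconstant holomorphic function on the half
  plane.\<close>

lemma fsigma_uhp: "fsigma uhp"
proof -
  have "uhp = (\<Union>n. {\<tau>. Im \<tau> \<ge> inverse (real (Suc n))})"
  proof safe
    fix \<tau> assume "Im \<tau> > 0"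
    then obtain n where "inverse (real (Suc n)) < Im \<tau>" using reals_Archimedean by blast
    then show "\<tau> \<in> (\<Union>n. {\<tau>. Im \<tau> \<ge> inverse (real (Suc n))})" by (auto intro: less_imp_le)
  next
    fix \<tau> n assume "inverse (real (Suc n)) \<le> Im \<tau>"
    moreover have "inverse (real (Suc n)) > 0" by simp
    ultimately show "Im \<tau> > 0" by linarith
  qed
  moreover have "fsigma (\<Union>n. {\<tau>. Im \<tau> \<ge> inverse (real (Suc n))})"
    by (rule fsigma.intros) (rule closed_halfspace_Im_ge)
  ultimately show ?thesis by simp
qed

lemma Im_minus_inverse: "Im (- 1 / \<tau>) = Im \<tau> / (norm \<tau>)\<^sup>2"
  by (simp only: Im_divide cmod_power2) simp

lemma Im_inversion_pos: "Im \<tau> > 0 \<Longrightarrow> Im (- 1 / \<tau>) > 0"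
  by (subst Im_minus_inverse) (auto intro!: divide_pos_pos)

lemma holomorphic_nome [holomorphic_intros]:
  "f holomorphic_on A \<Longrightarrow> (\<lambda>z. nome (f z)) holomorphic_on A"
  unfolding nome_def by (intro holomorphic_intros)

lemma holomorphic_qeval:
  assumes "conv_disc f" "g holomorphic_on A" "\<And>z. z \<in> A \<Longrightarrow> Im (g z) > 0"
  shows "(\<lambda>z. qeval f (g z)) holomorphic_on A"
proof -
  have "eval_fps f holomorphic_on (nome ` g ` A)"
    by (rule holomorphic_on_eval_fps)
       (use nome_in_conv_radius[OF assms(1,3)] in auto)
  from holomorphic_on_compose_gen[OF holomorphic_nome[OF assms(2)] this]
  show ?thesis by (simp add: qeval_def o_def image_image)
qed

lemma at_ii_neq_bot: "at_ii \<noteq> bot"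
  unfolding at_ii_def
  by (rule filtercomap_neq_bot_surj) (auto intro!: surjI[of _ "\<lambda>y. Complex 0 y"])

lemma eventually_at_ii: "eventually P at_ii \<longleftrightarrow> (\<exists>Y. \<forall>\<tau>. Im \<tau> > Y \<longrightarrow> P \<tau>)"
  unfolding at_ii_def eventually_filtercomap eventually_at_top_dense by (auto)

lemma nome_tendsto_0: "(nome \<longlongrightarrow> 0) at_ii"
proof (rule tendsto_norm_zero_cancel)
  have "((\<lambda>y. exp (- (pi * y))) \<longlongrightarrow> 0) at_top" by real_asymp
  then have "((\<lambda>\<tau>. exp (- (pi * Im \<tau>))) \<longlongrightarrow> 0) at_ii"
    unfolding at_ii_def by (rule filterlim_compose) (rule filterlim_filtercomap)
  then show "((\<lambda>\<tau>. norm (nome \<tau>)) \<longlongrightarrow> 0) at_ii" by (simp add: norm_nome)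
qed

lemma qeval_tendsto:
  assumes "conv_disc f"
  shows "(qeval f \<longlongrightarrow> fps_nth f 0) at_ii"
proof -
  have "isCont (eval_fps f) 0"
    by (intro continuous_eval_fps continuous_ident)
       (use ereal_less_conv_radius[OF assms, of 0] in auto)
  then have "((\<lambda>\<tau>. eval_fps f (nome \<tau>)) \<longlongrightarrow> eval_fps f 0) at_ii"
    by (rule isCont_tendsto_compose) (rule nome_tendsto_0)
  then show ?thesis by (simp add: qeval_def[abs_def] eval_fps_at_0)
qed

lemma filterlim_at_ii_shift: "filterlim (\<lambda>\<tau>. \<tau> + of_real x) at_ii at_ii"
  unfolding filterlim_iff eventually_at_ii
proof (intro allI impI)
  fix P :: "complex \<Rightarrow> bool"
  assume "\<exists>Y. \<forall>\<tau>. Im \<tau> > Y \<longrightarrow> P \<tau>"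
  then obtain Y where "\<And>\<tau>. Im \<tau> > Y \<Longrightarrow> P \<tau>" by blast
  then show "\<exists>Y. \<forall>\<tau>. Im \<tau> > Y \<longrightarrow> P (\<tau> + of_real x)"
    by (intro exI[of _ Y]) simp
qed

section \<open>Transformation laws of theta and of the forms A and B\<close>

definition theta :: "complex \<Rightarrow> complex" where
  "theta = qeval (cfps phi)"

lemma theta_identities:
  assumes "Im \<tau> > 0"
  shows "theta \<tau> * theta (\<tau> + 1) = (theta (2 * \<tau> + 1))\<^sup>2"
    and "(theta \<tau>)\<^sup>2 + (theta (\<tau> + 1))\<^sup>2 = 2 * (theta (2 * \<tau>))\<^sup>2"
  using eval_theta_identities[OF norm_nome_less_1[OF assms] conv_disc_theta(2)]
  by (simp_all add: theta_def qeval_def nome_add_1 nome_double)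

text \<open>By the product identity a zero at \<open>\<tau> + 1\<close> propagates to all points
  \<open>2^n * \<tau> + 1\<close>. These run into the cusp, where theta tends to 1.\<close>

lemma theta_nonzero:
  assumes "Im \<tau> > 0"
  shows "theta \<tau> \<noteq> 0"
proof -
  have 1: "theta (\<tau> + 1) \<noteq> 0" if "Im \<tau> > 0" for \<tau>
  proof
    assume 0: "theta (\<tau> + 1) = 0"
    have Im2: "Im (2 ^ n * \<tau>) = 2 ^ n * Im \<tau>" for n
    proof -
      have "Im (of_real (2 ^ n) * \<tau>) = 2 ^ n * Im \<tau>"
        by (simp only: times_complex.sel Re_complex_of_real Im_complex_of_real mult_zero_left add_0_right)
      then show ?thesis by simp
    qed
    have z: "theta (2 ^ n * \<tau> + 1) = 0" for n
    proof (induction n)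
      case (Suc n)
      have "Im (2 ^ n * \<tau>) > 0"
        using that by (simp add: Im2)
      from theta_identities(1)[OF this] Suc show ?case by (simp add: mult.assoc)
    qed (use 0 in simp)
    have "filterlim (\<lambda>n. 2 ^ n * \<tau> + 1) at_ii sequentially"
      unfolding at_ii_def filterlim_filtercomap_iff o_def
    proof -
      have "filterlim (\<lambda>n. 2 ^ n * Im \<tau>) at_top sequentially" using that by real_asymp
      then show "filterlim (\<lambda>n. Im (2 ^ n * \<tau> + 1)) at_top sequentially" by (simp add: Im2)
    qed
    then have "(\<lambda>n. theta (2 ^ n * \<tau> + 1)) \<longlonglongrightarrow> 1"
      using filterlim_compose[OF qeval_tendsto[OF conv_disc_theta(2)]]
      by (simp add: theta_def phi_nth_0)
    then have "(\<lambda>_::nat. 0::complex) \<longlonglongrightarrow> 1" unfolding z .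
    then show False by (simp add: LIMSEQ_const_iff)
  qed
  have "theta ((\<tau> - 1) + 1) \<noteq> 0" using assms by (intro 1) simp
  then show ?thesis by simp
qed

lemma theta_imaginary_axis:
  assumes "t > 0"
  shows "(theta (\<i> * of_real t))\<^sup>2 = of_real (thA t)"
proof -
  let ?x = "exp (- (pi * t))"
  have n: "nome (\<i> * of_real t) = of_real ?x"
  proof -
    have "\<i> * of_real pi * (\<i> * of_real t) = of_real (- (pi * t))"
      by (simp add: algebra_simps)
    then show ?thesis unfolding nome_def by (simp only: exp_of_real)
  qed
  have "\<bar>?x\<bar> < 1" using assms by simp
  from sums_of_real[OF rtheta_sums[OF this], where 'a = complex]
  have "theta (\<i> * of_real t) = of_real (rtheta ?x)"
    unfolding theta_def qeval_def n eval_fps_def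
    by (simp add: sums_iff)
  then show ?thesis by (simp add: thA_def)
qed

text \<open>Both sides are holomorphic and agree on the imaginary axis by the real inversion
  formula. Squaring keeps the factor of automorphy free of a square root.\<close>

lemma theta_inversion:
  assumes "Im \<tau> > 0"
  shows "(theta (- 1 / \<tau>))\<^sup>2 = - \<i> * \<tau> * (theta \<tau>)\<^sup>2"
proof -
  let ?f = "\<lambda>\<tau>. (theta (- 1 / \<tau>))\<^sup>2 - (- \<i> * \<tau> * (theta \<tau>)\<^sup>2)"
  have "?f \<tau> = 0"
  proof (rule analytic_continuation[of ?f "uhp" "(\<lambda>t. \<i> * of_real t) ` {0<..}" \<i>])
    show "?f holomorphic_on uhp"
      unfolding theta_def
      by (intro holomorphic_intros holomorphic_qeval conv_disc_theta) 
         (use Im_inversion_pos in auto)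
    show "\<i> islimpt (\<lambda>t. \<i> * of_real t) ` {0<..}"
    proof (rule islimpt_approachable[THEN iffD2], intro allI impI)
      fix e :: real assume "e > 0"
      then show "\<exists>x'\<in>(\<lambda>t. \<i> * of_real t) ` {0<..}. x' \<noteq> \<i> \<and> dist x' \<i> < e"
        by (intro bexI[of _ "\<i> * of_real (1 + e / 2)"])
           (auto simp: dist_norm algebra_simps norm_mult complex_eq_iff intro!: imageI)
    qed
    fix z assume "z \<in> (\<lambda>t. \<i> * complex_of_real t) ` {0<..}"
    then obtain t where t: "t > 0" "z = \<i> * of_real t" by auto
    have "- 1 / z = \<i> * of_real (1 / t)" using t by (simp add: field_simps)
    then have "(theta (- 1 / z))\<^sup>2 = of_real (t * thA t)"
      using theta_imaginary_axis[of "1 / t"] thA_inversion[OF t(1)] t by simp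
    moreover have "- \<i> * z = of_real t" using t by simp
    ultimately show "?f z = 0" using theta_imaginary_axis[OF t(1)] t(2) by simp
  qed (use assms open_uhp connected_uhp in \<open>auto\<close>)
  then show ?thesis by (simp only: right_minus_eq)
qed

definition cA :: "complex fps" where "cA = cfps modA"
definition cB :: "complex fps" where "cB = fps_alt cA"

lemma conv_disc_cAB: "conv_disc cA" "conv_disc cB"
  by (simp_all add: cA_def cB_def modA_def conv_disc_power conv_disc_theta)

lemma qeval_cA: "Im \<tau> > 0 \<Longrightarrow> qeval cA \<tau> = theta \<tau> ^ 4"
  unfolding cA_def modA_def theta_def by (simp add: qeval_power conv_disc_theta)

lemma qeval_cB: "Im \<tau> > 0 \<Longrightarrow> qeval cB \<tau> = theta (\<tau> + 1) ^ 4"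
  unfolding cB_def by (simp add: qeval_alt qeval_cA)

lemma qeval_cA_inversion:
  assumes "Im \<tau> > 0"
  shows "qeval cA (- 1 / \<tau>) = - (\<tau>\<^sup>2) * qeval cA \<tau>"
proof -
  have "theta (- 1 / \<tau>) ^ 4 = ((theta (- 1 / \<tau>))\<^sup>2)\<^sup>2" by (simp flip: power_mult)
  also have "\<dots> = - (\<tau>\<^sup>2) * theta \<tau> ^ 4"
    unfolding theta_inversion[OF assms] by (simp add: power_mult_distrib flip: power_mult)
  finally show ?thesis using assms Im_inversion_pos[OF assms] by (simp add: qeval_cA)
qed

text \<open>Duplication at \<open>- 1 / \<tau>\<close> expresses theta squared at
  \<open>- 1 / \<tau> + 1\<close> through the points \<open>- 1 / \<tau>\<close> and
  \<open>- 2 / \<tau>\<close>, to which the inversion formula at \<open>\<tau>\<close> and at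
  \<open>\<tau> / 2\<close> applies. Thus inversion carries the cusp form of \<open>cB\<close> to
  \<open>cA - cB\<close>, up to the weight factor.\<close>

lemma qeval_cB_inversion:
  assumes "Im \<tau> > 0"
  shows "qeval cB (- 1 / \<tau>) = - (\<tau>\<^sup>2) * (qeval cA \<tau> - qeval cB \<tau>)"
proof -
  let ?u = "- 1 / \<tau>" and ?s = "\<tau> / 2"
  have u: "Im ?u > 0" and s: "Im ?s > 0" using assms Im_inversion_pos by auto
  have 2: "2 * ?u = - 1 / ?s" "2 * ?s = \<tau>" by simp_all
  define X where "X = (theta ?s)\<^sup>2"
  define Y where "Y = (theta (?s + 1))\<^sup>2"
  have T: "(theta \<tau>)\<^sup>2 = (X + Y) / 2"
    using theta_identities(2)[OF s] unfolding 2 X_def Y_def by simp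
  have P: "theta (\<tau> + 1) ^ 4 = X * Y"
  proof -
    have "theta (\<tau> + 1) ^ 4 = ((theta (\<tau> + 1))\<^sup>2)\<^sup>2" by (simp flip: power_mult)
    also have "(theta (\<tau> + 1))\<^sup>2 = theta ?s * theta (?s + 1)"
      using theta_identities(1)[OF s] unfolding 2 by simp
    finally show ?thesis by (simp add: X_def Y_def power_mult_distrib)
  qed
  have "(theta (?u + 1))\<^sup>2 = 2 * (theta (- 1 / ?s))\<^sup>2 - (theta ?u)\<^sup>2"
    using theta_identities(2)[OF u] unfolding 2 by (simp add: algebra_simps)
  also have "\<dots> = - \<i> * \<tau> * (X - (theta \<tau>)\<^sup>2)"
    unfolding theta_inversion[OF s] theta_inversion[OF assms] X_def by (simp add: algebra_simps)
  also have "\<dots> = - \<i> * \<tau> * ((X - Y) / 2)"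
    unfolding T by (simp add: field_simps)
  finally have "(theta (?u + 1))\<^sup>2 = - \<i> * \<tau> * ((X - Y) / 2)" .
  moreover have "theta (?u + 1) ^ 4 = ((theta (?u + 1))\<^sup>2)\<^sup>2" by (simp flip: power_mult)
  ultimately have "theta (?u + 1) ^ 4 = (- \<i> * \<tau> * ((X - Y) / 2))\<^sup>2" by (simp only:)
  also have "\<dots> = - (\<tau>\<^sup>2) * ((X - Y) / 2)\<^sup>2"
    by (simp only: power_mult_distrib power2_minus power2_i) simp
  also have "((X - Y) / 2)\<^sup>2 = ((X + Y) / 2)\<^sup>2 - X * Y" by (simp add: power2_eq_square field_simps)
  also have "((X + Y) / 2)\<^sup>2 = theta \<tau> ^ 4" unfolding T[symmetric] by (simp flip: power_mult)
  finally show ?thesis using assms u by (simp only: qeval_cA qeval_cB P)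
qed

lemma cA_diff_cB: "cA - cB = 16 * cfps modF"
  using arg_cong[OF modA_diff_alt, of cfps] by (simp add: cA_def cB_def)

lemma qeval_cA_cB_nonzero:
  assumes "Im \<tau> > 0"
  shows "qeval cA \<tau> \<noteq> 0" "qeval cB \<tau> \<noteq> 0" "qeval cA \<tau> - qeval cB \<tau> \<noteq> 0"
proof -
  show "qeval cA \<tau> \<noteq> 0" using assms by (simp add: qeval_cA theta_nonzero)
  have B: "qeval cB \<sigma> \<noteq> 0" if "Im \<sigma> > 0" for \<sigma> using that by (simp add: qeval_cB theta_nonzero)
  show "qeval cB \<tau> \<noteq> 0" by (rule B[OF assms])
  show "qeval cA \<tau> - qeval cB \<tau> \<noteq> 0"
    using qeval_cB_inversion[OF assms] B[OF Im_inversion_pos[OF assms]] by auto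
qed

text \<open>A box of height at least 1/2 replaces the fundamental domain. Below it, in the strip
  \<open>\<bar>Re \<sigma>\<bar> \<le> 1 / 2\<close>, the squared norm is at most 1/2, so inversion
  at least doubles the imaginary part; induction on powers of 2 terminates.\<close>

lemma uhp_reduce:
  assumes "Im \<tau> > 0" and T: "\<And>\<tau>. Im \<tau> > 0 \<Longrightarrow> G (\<tau> + 1) = G \<tau>"
    and S: "\<And>\<tau>. Im \<tau> > 0 \<Longrightarrow> G (- 1 / \<tau>) = G \<tau>"
  shows "\<exists>\<sigma>. \<bar>Re \<sigma>\<bar> \<le> 1 / 2 \<and> Im \<sigma> \<ge> 1 / 2 \<and> G \<sigma> = G \<tau>"
proof -
  have shiftn: "G (\<tau> + of_nat n) = G \<tau>" if "Im \<tau> > 0" for \<tau> n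
  proof (induction n)
    case (Suc n)
    have "G (\<tau> + of_nat (Suc n)) = G ((\<tau> + of_nat n) + 1)" by (simp add: algebra_simps)
    also have "\<dots> = G \<tau>" using T[of "\<tau> + of_nat n"] Suc that by simp
    finally show ?case .
  qed simp
  have shift: "G (\<tau> + of_int n) = G \<tau>" if "Im \<tau> > 0" for \<tau> n
  proof (cases "n \<ge> 0")
    case True
    then show ?thesis using shiftn[OF that, of "nat n"] by simp
  next
    case False
    then show ?thesis using shiftn[of "\<tau> + of_int n" "nat (- n)"] that by simp
  qed
  have *: "\<exists>\<sigma>. \<bar>Re \<sigma>\<bar> \<le> 1 / 2 \<and> Im \<sigma> = Im \<tau> \<and> G \<sigma> = G \<tau>" if "Im \<tau> > 0" for \<tau>
  proof -
    have "\<bar>Re \<tau> - of_int (round (Re \<tau>))\<bar> \<le> 1 / 2"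
      using of_int_round_abs_le[of "Re \<tau>"] by (simp add: abs_minus_commute)
    then show ?thesis using shift[OF that, of "- round (Re \<tau>)"]
      by (intro exI[of _ "\<tau> + of_int (- round (Re \<tau>))"]) simp
  qed
  have "\<exists>\<sigma>. \<bar>Re \<sigma>\<bar> \<le> 1 / 2 \<and> Im \<sigma> \<ge> 1 / 2 \<and> G \<sigma> = G \<tau>"
    if "Im \<tau> \<ge> 1 / 2 / 2 ^ n" for n :: nat and \<tau>
    using that
  proof (induction n arbitrary: \<tau>)
    case 0
    then show ?case using *[of \<tau>] by force
  next
    case (Suc n)
    have "(1 :: real) / 2 / 2 ^ Suc n > 0" by simp
    then have "Im \<tau> > 0" using Suc.prems by linarith
    from *[OF this] obtain \<sigma> where \<sigma>: "\<bar>Re \<sigma>\<bar> \<le> 1 / 2" "Im \<sigma> = Im \<tau>" "G \<sigma> = G \<tau>" by blast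
    show ?case
    proof (cases "Im \<sigma> \<ge> 1 / 2")
      case True
      then show ?thesis using \<sigma> by blast
    next
      case False
      have pos: "Im \<sigma> > 0" using \<sigma>(2) \<open>Im \<tau> > 0\<close> by simp
      have "(Re \<sigma>)\<^sup>2 \<le> (1/2)\<^sup>2" "(Im \<sigma>)\<^sup>2 \<le> (1/2)\<^sup>2"
        using \<sigma>(1) False pos by (simp_all add: abs_le_square_iff[symmetric])
      then have n: "(norm \<sigma>)\<^sup>2 \<le> 1 / 2"
        unfolding cmod_power2 by (simp add: power2_eq_square)
      have n0: "(norm \<sigma>)\<^sup>2 > 0" using pos by auto
      have "Im \<sigma> * 2 \<le> Im \<sigma> / (norm \<sigma>)\<^sup>2"
        using n n0 pos by (simp add: pos_le_divide_eq)
      moreover have "1 / 2 / 2 ^ n \<le> Im \<sigma> * 2" using Suc.prems \<sigma>(2) by simp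
      ultimately have "1 / 2 / 2 ^ n \<le> Im (- 1 / \<sigma>)" unfolding Im_minus_inverse by linarith
      from Suc.IH[OF this] show ?thesis using S[OF pos] \<sigma>(3) by simp
    qed
  qed
  moreover obtain n where "Im \<tau> \<ge> 1 / 2 / 2 ^ n"
  proof -
    obtain n :: nat where "(1 / 2) ^ n < 2 * Im \<tau>"
      using real_arch_pow_inv[of "2 * Im \<tau>" "1/2"] assms(1) by auto
    then show ?thesis using that[of n] by (simp add: power_divide)
  qed
  ultimately show ?thesis by blast
qed

text \<open>Near the cusp the norm is smaller than at \<open>\<tau>\<close>, so by reduction its
  supremum is attained on a compact box. The maximum modulus principle then makes \<open>G\<close>
  constant, against its decay at the cusp.\<close>

lemma modular_invariant_vanishes:
  assumes hol: "G holomorphic_on uhp"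
    and T: "\<And>\<tau>. Im \<tau> > 0 \<Longrightarrow> G (\<tau> + 1) = G \<tau>"
    and S: "\<And>\<tau>. Im \<tau> > 0 \<Longrightarrow> G (- 1 / \<tau>) = G \<tau>"
    and lim: "(G \<longlongrightarrow> 0) at_ii"
    and \<tau>: "Im \<tau> > 0"
  shows "G \<tau> = 0"
proof (rule ccontr)
  assume "G \<tau> \<noteq> 0"
  then have "norm (G \<tau>) > 0" by simp
  then have "\<forall>\<^sub>F \<sigma> in at_ii. norm (G \<sigma>) < norm (G \<tau>)"
    by (intro order_tendstoD(2)[OF tendsto_norm_zero[OF lim]])
  then obtain Y where Y: "\<And>\<sigma>. Im \<sigma> > Y \<Longrightarrow> norm (G \<sigma>) < norm (G \<tau>)"
    by (auto simp: eventually_at_ii)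
  define K where "K = cbox (Complex (- 1 / 2) (1 / 2)) (Complex (1 / 2) Y)"
  have K: "\<sigma> \<in> K \<longleftrightarrow> \<bar>Re \<sigma>\<bar> \<le> 1 / 2 \<and> 1 / 2 \<le> Im \<sigma> \<and> Im \<sigma> \<le> Y" for \<sigma>
    by (auto simp: K_def in_cbox_complex_iff)
  have red: "\<exists>\<sigma>. \<bar>Re \<sigma>\<bar> \<le> 1 / 2 \<and> Im \<sigma> \<ge> 1 / 2 \<and> G \<sigma> = G \<rho>" if "Im \<rho> > 0" for \<rho>
    using uhp_reduce[of \<rho> G] that T S by blast
  obtain \<sigma>0 where \<sigma>0: "\<sigma>0 \<in> K" "G \<sigma>0 = G \<tau>"
    using red[OF \<tau>] Y unfolding K by (metis leI less_irrefl)
  have "continuous_on K (\<lambda>\<sigma>. norm (G \<sigma>))"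
    by (intro continuous_on_norm continuous_on_subset[OF holomorphic_on_imp_continuous_on[OF hol]])
       (auto simp: K)
  moreover have "compact K" by (simp add: K_def)
  ultimately obtain m where m: "m \<in> K" "\<And>\<sigma>. \<sigma> \<in> K \<Longrightarrow> norm (G \<sigma>) \<le> norm (G m)"
    using continuous_attains_sup[of K "\<lambda>\<sigma>. norm (G \<sigma>)"] \<sigma>0 by auto
  have max: "norm (G \<rho>) \<le> norm (G m)" if "Im \<rho> > 0" for \<rho>
  proof -
    obtain \<sigma> where \<sigma>: "\<bar>Re \<sigma>\<bar> \<le> 1 / 2" "Im \<sigma> \<ge> 1 / 2" "G \<sigma> = G \<rho>" using red[OF \<open>Im \<rho> > 0\<close>] by blast
    show ?thesis
    proof (cases "Im \<sigma> \<le> Y")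
      case True
      then show ?thesis using m(2)[of \<sigma>] \<sigma> by (simp add: K)
    next
      case False
      then have "norm (G \<rho>) < norm (G \<tau>)" using Y[of \<sigma>] \<sigma> by simp
      also have "\<dots> \<le> norm (G m)" using m(2)[OF \<sigma>0(1)] \<sigma>0(2) by simp
      finally show ?thesis by simp
    qed
  qed
  have "G constant_on uhp"
    by (rule maximum_modulus_principle[OF hol open_uhp connected_uhp open_uhp subset_refl, of m])
       (use m max in \<open>auto simp: K\<close>)
  then obtain c where c: "\<And>\<sigma>. Im \<sigma> > 0 \<Longrightarrow> G \<sigma> = c" by (auto simp: constant_on_def)
  have "norm (G (Complex 0 (max 1 (Y + 1)))) < norm (G \<tau>)" by (rule Y) simp
  then show False using c[of \<tau>] c[of "Complex 0 (max 1 (Y + 1))"] \<tau> by simp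
qed

text \<open>
  The product of \<open>R\<close> over the six cosets of \<open>\<Gamma>(2)\<close> is invariant under the full modular group.
\<close>
lemma modular_function_vanishes:
  assumes hol: "R holomorphic_on uhp"
    and R: "\<And>\<tau>. Im \<tau> > 0 \<Longrightarrow> R (\<tau> + 2) = R \<tau>"
    and RS: "\<And>\<tau>. Im \<tau> > 0 \<Longrightarrow> R (- 1 / (\<tau> + 2)) = R (- 1 / \<tau>)"
    and RTS: "\<And>\<tau>. Im \<tau> > 0 \<Longrightarrow> R (1 - 1 / (\<tau> + 2)) = R (1 - 1 / \<tau>)"
    and lim: "(R \<longlongrightarrow> 0) at_ii" and limS: "((\<lambda>\<tau>. R (- 1 / \<tau>)) \<longlongrightarrow> l1) at_ii"
    and limTS: "((\<lambda>\<tau>. R (1 - 1 / \<tau>)) \<longlongrightarrow> l2) at_ii"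
    and \<tau>: "Im \<tau> > 0"
  shows "R \<tau> = 0"
proof -
  define U where "U = (\<lambda>\<tau>. R \<tau> * R (\<tau> + 1))"
  define V where "V = (\<lambda>\<tau>. R (- 1 / \<tau>) * R (- 1 / (\<tau> + 1)))"
  define W where "W = (\<lambda>\<tau>. R (1 - 1 / \<tau>) * R (1 - 1 / (\<tau> + 1)))"
  define G where "G = (\<lambda>\<tau>. U \<tau> * V \<tau> * W \<tau>)"
  have im: "Im (1 / \<tau>) < 0" if "Im \<tau> > 0" for \<tau> using Im_inversion_pos[OF that] by simp
  have "G \<tau> = 0" if "Im \<tau> > 0" for \<tau>
  proof (rule modular_invariant_vanishes[OF _ _ _ _ that])
    have comp: "(\<lambda>\<tau>. R (f \<tau>)) holomorphic_on uhp"
      if "f holomorphic_on uhp" "\<And>\<tau>. Im \<tau> > 0 \<Longrightarrow> Im (f \<tau>) > 0" for f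
      using holomorphic_on_compose_gen[OF that(1) hol] that(2) by (auto simp: o_def)
    show "G holomorphic_on uhp"
      unfolding G_def U_def V_def W_def
      by (intro holomorphic_on_mult comp holomorphic_intros) (use im in \<open>auto simp: complex_eq_iff\<close>)
    show "G (\<tau> + 1) = G \<tau>" if "Im \<tau> > 0" for \<tau>
      using R[OF that] RS[OF that] RTS[OF that]
      by (simp add: G_def U_def V_def W_def add.assoc mult_ac)
    \<comment> \<open>Inversion permutes the six factors up to translations; the period 2 of
      \<open>R\<close> and of its two transforms identifies the rest.\<close>
    show "G (- 1 / \<tau>) = G \<tau>" if t: "Im \<tau> > 0" for \<tau>
    proof -
      have nz: "\<tau> \<noteq> 0" "\<tau> - 1 \<noteq> 0" using t by auto
      have t1: "Im (\<tau> - 1) > 0" using t by simp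
      have imt: "Im (- 1 / (\<tau> - 1) - 1) > 0" using Im_inversion_pos[OF t1] by simp
      have a1: "- 1 / (- 1 / \<tau>) = \<tau>" using nz by simp
      have a2: "- 1 / (- 1 / \<tau> + 1) = - 1 / (\<tau> - 1) - 1" using nz by (simp add: field_simps)
      have a3: "1 - 1 / (- 1 / \<tau> + 1) = - 1 / (\<tau> - 1)" using nz by (simp add: field_simps)
      have e1: "R (- 1 / (- 1 / \<tau> + 1)) = R (1 - 1 / (\<tau> + 1))"
      proof -
        have "R (- 1 / (- 1 / \<tau> + 1)) = R (- 1 / (\<tau> - 1) - 1 + 2)"
          unfolding a2 using R[OF imt] by simp
        also have "- 1 / (\<tau> - 1) - 1 + 2 = 1 - 1 / (\<tau> - 1)" by simp
        also have "R (1 - 1 / (\<tau> - 1)) = R (1 - 1 / (\<tau> - 1 + 2))" using RTS[OF t1] by simp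
        also have "\<tau> - 1 + 2 = \<tau> + 1" by simp
        finally show ?thesis .
      qed
      have e2: "R (1 - 1 / (- 1 / \<tau> + 1)) = R (- 1 / (\<tau> + 1))"
      proof -
        have "R (- 1 / (\<tau> - 1)) = R (- 1 / (\<tau> - 1 + 2))" using RS[OF t1] by simp
        also have "\<tau> - 1 + 2 = \<tau> + 1" by simp
        finally show ?thesis unfolding a3 .
      qed
      have "U (- 1 / \<tau>) = R (- 1 / \<tau>) * R (1 - 1 / \<tau>)" by (simp add: U_def)
      moreover have "V (- 1 / \<tau>) = R \<tau> * R (1 - 1 / (\<tau> + 1))" unfolding V_def e1 a1 ..
      moreover have "W (- 1 / \<tau>) = R (\<tau> + 1) * R (- 1 / (\<tau> + 1))"
        unfolding W_def e2 using nz by (simp add: add.commute)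
      ultimately show ?thesis by (simp only: G_def) (simp add: U_def V_def W_def)
    qed
    have sh: "filterlim (\<lambda>\<tau>. \<tau> + 1) at_ii at_ii" using filterlim_at_ii_shift[of 1] by simp
    have "(G \<longlongrightarrow> 0 * 0 * (l1 * l1) * (l2 * l2)) at_ii"
      unfolding G_def U_def V_def W_def
      by (intro tendsto_mult lim limS limTS filterlim_compose[OF lim sh]
            filterlim_compose[OF limS sh] filterlim_compose[OF limTS sh])
    then show "(G \<longlongrightarrow> 0) at_ii" by simp
  qed
  note G0 = this
  show ?thesis
  proof (rule ccontr)
    assume "R \<tau> \<noteq> 0"
    \<comment> \<open>The zeros of a nonconstant \<open>R\<close> are countable. Since
      \<open>G\<close> vanishes identically, six injective preimages of this set would cover the
      half plane.\<close>
    let ?Z = "{z\<in>uhp. R z = 0}"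
    have nc: "\<not> R constant_on uhp"
    proof
      assume "R constant_on uhp"
      then obtain c where c: "\<And>\<sigma>. Im \<sigma> > 0 \<Longrightarrow> R \<sigma> = c" by (auto simp: constant_on_def)
      then have "c \<noteq> 0" using \<open>R \<tau> \<noteq> 0\<close> \<tau> by auto
      have "((\<lambda>_. c) \<longlongrightarrow> 0) at_ii"
        by (rule Lim_transform_eventually[OF lim]) (use c in \<open>auto simp: eventually_at_ii intro!: exI[of _ 0]\<close>)
      then show False using \<open>c \<noteq> 0\<close> at_ii_neq_bot by (simp add: tendsto_const_iff)
    qed
    have Z: "countable ?Z"
      using holomorphic_countable_zeros[OF hol open_uhp connected_uhp fsigma_uhp nc] .
    define fs where "fs = {\<lambda>\<sigma>. \<sigma>, \<lambda>\<sigma>. \<sigma> + 1, \<lambda>\<sigma>. - 1 / \<sigma>, \<lambda>\<sigma>. - 1 / (\<sigma> + 1), \<lambda>\<sigma>. 1 - 1 / \<sigma>,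
      \<lambda>\<sigma>. 1 - 1 / (\<sigma> + 1 :: complex)}"
    have "finite fs" by (simp add: fs_def)
    have cnt: "countable {\<sigma>. Im \<sigma> > 0 \<and> R (f \<sigma>) = 0}" if f: "f \<in> fs" for f
    proof (rule countable_image_inj_on)
      have "Im (f \<sigma>) > 0" if "Im \<sigma> > 0" for \<sigma>
        using f im[of \<sigma>] im[of "\<sigma> + 1"] that by (auto simp: fs_def)
      then show "countable (f ` {\<sigma>. Im \<sigma> > 0 \<and> R (f \<sigma>) = 0})"
        by (intro countable_subset[OF _ Z]) auto
      show "inj_on f {\<sigma>. Im \<sigma> > 0 \<and> R (f \<sigma>) = 0}"
        using f by (auto simp: inj_on_def fs_def)
    qed
    have "countable (\<Union>f\<in>fs. {\<sigma>. Im \<sigma> > 0 \<and> R (f \<sigma>) = 0})"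
      by (rule countable_UN[OF countable_finite[OF \<open>finite fs\<close>] cnt])
    moreover have "uhp \<subseteq> (\<Union>f\<in>fs. {\<sigma>. Im \<sigma> > 0 \<and> R (f \<sigma>) = 0})"
    proof
      fix \<sigma> assume "\<sigma> \<in> uhp"
      then show "\<sigma> \<in> (\<Union>f\<in>fs. {\<sigma>. Im \<sigma> > 0 \<and> R (f \<sigma>) = 0})"
        using G0[of \<sigma>] unfolding fs_def G_def U_def V_def W_def by (simp add: disj_ac)
    qed
    ultimately have "countable uhp" by (rule countable_subset[rotated])
    moreover have "ball \<i> 1 \<subseteq> uhp"
    proof
      fix z assume "z \<in> ball \<i> 1"
      then have "\<bar>Im (\<i> - z)\<bar> < 1" using abs_Im_le_cmod[of "\<i> - z"] by (simp add: dist_norm)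
      then show "z \<in> uhp" by simp
    qed
    ultimately show False using uncountable_ball[of 1 \<i>] countable_subset by auto
  qed
qed

text \<open>
  The form \<open>cA - cB\<close> vanishes at the cusp \<open>\<i>\<infinity>\<close> only, so dividing \<open>D\<close> by its \<open>j\<close>-th power gives a
  function of weight 0 that is finite at all cusps and vanishes at \<open>\<i>\<infinity>\<close>.
\<close>
lemma weight_vanishing:
  assumes D: "conv_disc D" and g: "conv_disc g1" "conv_disc g2"
    and S: "\<And>\<tau>. Im \<tau> > 0 \<Longrightarrow> qeval D (- 1 / \<tau>) = \<tau> ^ (2 * j) * qeval g1 \<tau>"
    and TS: "\<And>\<tau>. Im \<tau> > 0 \<Longrightarrow> qeval (fps_alt D) (- 1 / \<tau>) = \<tau> ^ (2 * j) * qeval g2 \<tau>"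
    and low: "\<And>n. n \<le> j \<Longrightarrow> fps_nth D n = 0"
  shows "D = 0"
proof -
  define C where "C = cA - cB"
  have C: "conv_disc C" "\<And>\<tau>. Im \<tau> > 0 \<Longrightarrow> qeval C \<tau> = qeval cA \<tau> - qeval cB \<tau>"
    unfolding C_def by (auto intro: conv_disc_add conv_disc_cAB qeval_diff)
  have C_nz: "qeval C \<tau> \<noteq> 0" if "Im \<tau> > 0" for \<tau>
    using qeval_cA_cB_nonzero(3)[OF that] C(2)[OF that] by simp
  have CS: "qeval C (- 1 / \<tau>) = - (\<tau>\<^sup>2) * qeval cB \<tau>" if "Im \<tau> > 0" for \<tau>
    unfolding C(2)[OF Im_inversion_pos[OF that]] qeval_cA_inversion[OF that] qeval_cB_inversion[OF that]
    by (simp add: algebra_simps)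
  have altC: "fps_alt C = - C" by (simp add: C_def cB_def)
  have CTS: "qeval C (1 - 1 / \<tau>) = \<tau>\<^sup>2 * qeval cB \<tau>" if "Im \<tau> > 0" for \<tau>
  proof -
    have "qeval C (1 - 1 / \<tau>) = qeval (fps_alt C) (- 1 / \<tau>)" by (simp add: qeval_alt)
    also have "\<dots> = - qeval C (- 1 / \<tau>)" by (simp add: altC qeval_def eval_fps_minus nome_in_conv_radius[OF C(1) Im_inversion_pos[OF that], simplified])
    finally show ?thesis using CS[OF that] by simp
  qed
  define R where "R = (\<lambda>\<tau>. qeval D \<tau> / qeval C \<tau> ^ j)"
  have R_S: "R (- 1 / \<tau>) = qeval g1 \<tau> / (- qeval cB \<tau>) ^ j" if "Im \<tau> > 0" for \<tau>
  proof -
    have "\<tau> \<noteq> 0" using that by auto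
    moreover have "(- (\<tau>\<^sup>2) * qeval cB \<tau>) ^ j = \<tau> ^ (2 * j) * (- qeval cB \<tau>) ^ j"
      by (simp add: power_mult power_mult_distrib[symmetric])
    ultimately show ?thesis unfolding R_def S[OF that] CS[OF that] by simp
  qed
  have R_TS: "R (1 - 1 / \<tau>) = qeval g2 \<tau> / qeval cB \<tau> ^ j" if "Im \<tau> > 0" for \<tau>
  proof -
    have "\<tau> \<noteq> 0" using that by auto
    moreover have "qeval D (1 - 1 / \<tau>) = \<tau> ^ (2 * j) * qeval g2 \<tau>"
      using TS[OF that] by (simp add: qeval_alt)
    moreover have "(\<tau>\<^sup>2 * qeval cB \<tau>) ^ j = \<tau> ^ (2 * j) * qeval cB \<tau> ^ j"
      by (simp add: power_mult power_mult_distrib)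
    ultimately show ?thesis unfolding R_def CTS[OF that] by simp
  qed
  have Bl: "(qeval cB \<longlongrightarrow> 1) at_ii"
    using qeval_tendsto[OF conv_disc_cAB(2)] by (simp add: cB_def cA_def modA_nth_0)
  have ev: "eventually (\<lambda>\<tau>. Im \<tau> > 0) at_ii" by (auto simp: eventually_at_ii)
  have R0: "R \<tau> = 0" if "Im \<tau> > 0" for \<tau>
  proof (rule modular_function_vanishes[OF _ _ _ _ _ _ _ that])
    show "R holomorphic_on uhp"
      unfolding R_def by (intro holomorphic_intros holomorphic_qeval D C(1)) (use C_nz in auto)
    show "R (\<tau> + 2) = R \<tau>" for \<tau> by (simp add: R_def qeval_add_2)
    show "R (- 1 / (\<tau> + 2)) = R (- 1 / \<tau>)" if "Im \<tau> > 0" for \<tau>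
      using R_S[of "\<tau> + 2"] R_S[OF that] that by (simp add: qeval_add_2)
    show "R (1 - 1 / (\<tau> + 2)) = R (1 - 1 / \<tau>)" if "Im \<tau> > 0" for \<tau>
      using R_TS[of "\<tau> + 2"] R_TS[OF that] that by (simp add: qeval_add_2)
    have "((\<lambda>\<tau>. qeval g1 \<tau> / (- qeval cB \<tau>) ^ j) \<longlongrightarrow> fps_nth g1 0 / (- 1) ^ j) at_ii"
      by (intro tendsto_intros qeval_tendsto g Bl) simp
    then show "((\<lambda>\<tau>. R (- 1 / \<tau>)) \<longlongrightarrow> fps_nth g1 0 / (- 1) ^ j) at_ii"
      by (rule Lim_transform_eventually) (use ev R_S in \<open>auto elim!: eventually_mono\<close>)
    have "((\<lambda>\<tau>. qeval g2 \<tau> / qeval cB \<tau> ^ j) \<longlongrightarrow> fps_nth g2 0 / 1 ^ j) at_ii"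
      by (intro tendsto_intros qeval_tendsto g Bl) simp
    then show "((\<lambda>\<tau>. R (1 - 1 / \<tau>)) \<longlongrightarrow> fps_nth g2 0 / 1 ^ j) at_ii"
      by (rule Lim_transform_eventually) (use ev R_TS in \<open>auto elim!: eventually_mono\<close>)
    show "(R \<longlongrightarrow> 0) at_ii"
    proof (cases "D = 0")
      case True
      then show ?thesis by (simp add: R_def qeval_def)
    next
      case False
      \<comment> \<open>The zero of \<open>D\<close> has order at least \<open>j + 1\<close>, that
        of \<open>C^j\<close> exactly \<open>j\<close>, because \<open>C\<close> starts with
        \<open>16 q\<close>. One factor \<open>nome \<tau>\<close> remains and forces the limit
        0.\<close>
      have subD: "j + 1 \<le> subdegree D"
        using low nth_subdegree_nonzero[OF False] by (metis Suc_eq_plus1 not_less_eq_eq)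
      define D' where "D' = fps_shift (j + 1) D"
      define C' where "C' = fps_shift 1 C"
      have C01: "fps_nth C 0 = 0" "fps_nth C 1 = 16"
        using modF_nth by (simp_all add: C_def cA_diff_cB fps_mult_numeral_left)
      have cv: "conv_disc D'" "conv_disc C'"
        using D C(1) by (simp_all add: D'_def C'_def)
      have Deq: "D = D' * fps_X ^ (j + 1)" unfolding D'_def by (rule fps_shift_times_fps_X_power[OF subD, symmetric])
      have "1 \<le> subdegree C"
        using C01 by (metis One_nat_def Suc_leI gr0I nth_subdegree_nonzero fps_zero_nth zero_neq_numeral)
      then have Ceq: "C = C' * fps_X ^ 1" unfolding C'_def by (rule fps_shift_times_fps_X_power[symmetric])
      have X: "conv_disc (fps_X ^ n :: complex fps)" for n by simp
      have eq: "nome \<tau> * qeval D' \<tau> / qeval C' \<tau> ^ j = R \<tau>" if "Im \<tau> > 0" for \<tau>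
      proof -
        have "qeval D \<tau> = qeval D' \<tau> * nome \<tau> ^ (j + 1)"
          unfolding Deq using qeval_mult[OF cv(1) X that, of "j + 1"] by (simp only: qeval_def eval_fps_X_power)
        moreover have "qeval C \<tau> = qeval C' \<tau> * nome \<tau>"
          unfolding Ceq using qeval_mult[OF cv(2) X that, of 1] by (simp add: qeval_def)
        ultimately show ?thesis using nome_nonzero[of \<tau>] by (simp add: R_def power_mult_distrib)
      qed
      have "((\<lambda>\<tau>. nome \<tau> * qeval D' \<tau> / qeval C' \<tau> ^ j) \<longlongrightarrow> 0 * fps_nth D' 0 / fps_nth C' 0 ^ j) at_ii"
        by (intro tendsto_intros nome_tendsto_0 qeval_tendsto cv) (use C01 in \<open>simp add: C'_def\<close>)
      then have "((\<lambda>\<tau>. nome \<tau> * qeval D' \<tau> / qeval C' \<tau> ^ j) \<longlongrightarrow> 0) at_ii" by simp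
      then show ?thesis
        by (rule Lim_transform_eventually) (rule eventually_mono[OF ev eq])
    qed
  qed
  have Q0: "qeval D \<tau> = 0" if "Im \<tau> > 0" for \<tau>
    using R0[OF that] C_nz[OF that] by (simp add: R_def)
  have E0: "eval_fps D z = 0" if z: "norm z < 1" "z \<noteq> 0" for z
  proof -
    define \<tau> where "\<tau> = Ln z / (\<i> * of_real pi)"
    have "nome \<tau> = z" using z by (simp add: nome_def \<tau>_def)
    moreover have "Im \<tau> > 0"
    proof -
      have "exp (- (pi * Im \<tau>)) < 1" using z(1) norm_nome[of \<tau>] \<open>nome \<tau> = z\<close> by simp
      then show ?thesis by (simp add: zero_less_mult_iff)
    qed
    ultimately show ?thesis using Q0[of \<tau>] by (simp add: qeval_def)
  qed
  show "D = 0"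
  proof (rule eval_fps_eqD)
    show "fps_conv_radius D > 0" using D by (rule less_le_trans[rotated]) simp
    have "eventually (\<lambda>z. z \<in> ball (0::complex) 1) (nhds 0)" by (intro eventually_nhds_in_open) auto
    then show "\<forall>\<^sub>F z in nhds 0. eval_fps D z = eval_fps 0 z"
      by eventually_elim (use E0 low[of 0] in \<open>force simp: eval_fps_at_0\<close>)
  qed simp
qed

section \<open>Stability under Hecke operators\<close>

text \<open>Homogeneous polynomials of degree \<open>j\<close> in \<open>cA\<close> and
  \<open>cB\<close>, hence of weight \<open>2 j\<close>. The inductive form turns stability under
  translation and inversion into rule inductions on the generators.\<close>

inductive theta_poly :: "nat \<Rightarrow> complex fps \<Rightarrow> bool" where
  const: "theta_poly 0 (fps_const c)"
| mult_A: "theta_poly j f \<Longrightarrow> theta_poly (Suc j) (cA * f)"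
| mult_B: "theta_poly j f \<Longrightarrow> theta_poly (Suc j) (cB * f)"
| add: "theta_poly j f \<Longrightarrow> theta_poly j g \<Longrightarrow> theta_poly j (f + g)"

lemma theta_poly_conv_disc: "theta_poly j f \<Longrightarrow> conv_disc f"
  by (induction rule: theta_poly.induct)
     (simp_all add: conv_disc_mult conv_disc_cAB conv_disc_add)

lemma theta_poly_alt: "theta_poly j f \<Longrightarrow> theta_poly j (fps_alt f)"
proof (induction rule: theta_poly.induct)
  case (mult_A j f)
  then show ?case using theta_poly.mult_B by (simp add: cB_def)
next
  case (mult_B j f)
  then show ?case using theta_poly.mult_A by (simp add: cB_def)
qed (auto intro: theta_poly.intros)

lemma theta_poly_scale: "theta_poly j f \<Longrightarrow> theta_poly j (fps_const c * f)"
proof (induction rule: theta_poly.induct)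
  case (const d)
  then show ?case using theta_poly.const[of "c * d"] by simp
next
  case (mult_A j f)
  then show ?case using theta_poly.mult_A by (simp add: mult.left_commute)
next
  case (mult_B j f)
  then show ?case using theta_poly.mult_B by (simp add: mult.left_commute)
qed (auto intro: theta_poly.intros simp: distrib_left)

lemma theta_poly_diff: "theta_poly j f \<Longrightarrow> theta_poly j g \<Longrightarrow> theta_poly j (f - g)"
  using theta_poly.add[OF _ theta_poly_scale[of j g "-1"], of f]
  by (simp flip: fps_const_neg)

lemma theta_poly_sum:
  "finite I \<Longrightarrow> I \<noteq> {} \<Longrightarrow> (\<And>i. i \<in> I \<Longrightarrow> theta_poly j (f i)) \<Longrightarrow> theta_poly j (sum f I)"
  by (induction I rule: finite_ne_induct) (auto intro: theta_poly.add)

lemma theta_poly_mult_C: "theta_poly j f \<Longrightarrow> theta_poly (Suc j) ((cA - cB) * f)"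
  using theta_poly_diff[OF theta_poly.mult_A theta_poly.mult_B] by (simp add: left_diff_distrib)

lemma theta_poly_monomial: "theta_poly (m + l) (cA ^ m * (cA - cB) ^ l)"
proof (induction m)
  case 0
  show ?case
  proof (induction l)
    case 0
    then show ?case using theta_poly.const[of 1] by simp
  next
    case (Suc l)
    then show ?case using theta_poly_mult_C by simp
  qed
next
  case (Suc m)
  then show ?case using theta_poly.mult_A by (simp add: mult.assoc)
qed

lemma inversion_mult:
  assumes "conv_disc h" "conv_disc h'" "conv_disc f" "conv_disc g"
    and "qeval h (- 1 / \<tau>) = - (\<tau>\<^sup>2) * qeval h' \<tau>" "qeval f (- 1 / \<tau>) = \<tau> ^ (2 * j) * qeval g \<tau>"
    and \<tau>: "Im \<tau> > 0"
  shows "qeval (h * f) (- 1 / \<tau>) = \<tau> ^ (2 * Suc j) * qeval (fps_const (- 1) * (h' * g)) \<tau>"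
proof -
  have c: "conv_disc (fps_const (- 1) :: complex fps)" by simp
  show ?thesis
    unfolding qeval_mult[OF assms(1,3) Im_inversion_pos[OF \<tau>]] qeval_mult[OF assms(2,4) \<tau>]
      qeval_mult[OF c conv_disc_mult[OF assms(2,4)] \<tau>] qeval_const assms(5,6)
    by (simp add: power2_eq_square)
qed

lemma theta_poly_inversion:
  assumes "theta_poly j f"
  shows "\<exists>g. theta_poly j g \<and> (\<forall>\<tau>. Im \<tau> > 0 \<longrightarrow> qeval f (- 1 / \<tau>) = \<tau> ^ (2 * j) * qeval g \<tau>)"
  using assms
proof (induction rule: theta_poly.induct)
  case (const c)
  show ?case by (intro exI[of _ "fps_const c"]) (auto simp: qeval_const intro: theta_poly.const)
next
  case (mult_A j f)
  then obtain g where g: "theta_poly j g" "\<And>\<tau>. Im \<tau> > 0 \<Longrightarrow> qeval f (- 1 / \<tau>) = \<tau> ^ (2 * j) * qeval g \<tau>"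
    by blast
  then have "theta_poly (Suc j) (fps_const (- 1) * (cA * g))"
    by (intro theta_poly_scale theta_poly.mult_A)
  then show ?case
    using inversion_mult[OF conv_disc_cAB(1,1) theta_poly_conv_disc[OF mult_A.hyps]
      theta_poly_conv_disc[OF g(1)] qeval_cA_inversion g(2)] by blast
next
  case (mult_B j f)
  then obtain g where g: "theta_poly j g" "\<And>\<tau>. Im \<tau> > 0 \<Longrightarrow> qeval f (- 1 / \<tau>) = \<tau> ^ (2 * j) * qeval g \<tau>"
    by blast
  have C: "conv_disc (cA - cB)" by (intro conv_disc_add conv_disc_cAB)
  have inv: "qeval cB (- 1 / \<tau>) = - (\<tau>\<^sup>2) * qeval (cA - cB) \<tau>" if "Im \<tau> > 0" for \<tau>
    unfolding qeval_diff[OF conv_disc_cAB that] by (rule qeval_cB_inversion[OF that])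
  have "theta_poly (Suc j) (fps_const (- 1) * ((cA - cB) * g))"
    by (intro theta_poly_scale theta_poly_mult_C g)
  then show ?case
    using inversion_mult[OF conv_disc_cAB(2) C theta_poly_conv_disc[OF mult_B.hyps]
      theta_poly_conv_disc[OF g(1)] inv g(2)] by blast
next
  case (add j f1 f2)
  then obtain g1 g2 where g: "theta_poly j g1" "\<And>\<tau>. Im \<tau> > 0 \<Longrightarrow> qeval f1 (- 1 / \<tau>) = \<tau> ^ (2 * j) * qeval g1 \<tau>"
     "theta_poly j g2" "\<And>\<tau>. Im \<tau> > 0 \<Longrightarrow> qeval f2 (- 1 / \<tau>) = \<tau> ^ (2 * j) * qeval g2 \<tau>"
    by blast
  note cv = theta_poly_conv_disc[OF add.hyps(1)] theta_poly_conv_disc[OF add.hyps(2)]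
    theta_poly_conv_disc[OF g(1)] theta_poly_conv_disc[OF g(3)]
  show ?case
  proof (intro exI conjI allI impI)
    show "theta_poly j (g1 + g2)" using g by (auto intro: theta_poly.add)
    fix \<tau> :: complex assume \<tau>: "Im \<tau> > 0"
    show "qeval (f1 + f2) (- 1 / \<tau>) = \<tau> ^ (2 * j) * qeval (g1 + g2) \<tau>"
      unfolding qeval_add[OF cv(1,2) Im_inversion_pos[OF \<tau>]] qeval_add[OF cv(3,4) \<tau>] g(2)[OF \<tau>] g(4)[OF \<tau>]
      by (simp add: distrib_left)
  qed
qed

section \<open>Invariance under matrices with even off-diagonal entries\<close>

lemma moebius_uhp:
  fixes A B C D :: int
  assumes "A * D - B * C = 1" "Im \<tau> > 0"
  shows "of_int C * \<tau> + of_int D \<noteq> 0"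
    and "Im ((of_int A * \<tau> + of_int B) / (of_int C * \<tau> + of_int D)) > 0"
proof -
  show nz: "of_int C * \<tau> + of_int D \<noteq> 0"
  proof
    assume 0: "of_int C * \<tau> + of_int D = 0"
    then have "Im (of_int C * \<tau> + of_int D) = 0" by simp
    then have "C = 0" using assms(2) by simp
    then show False using 0 assms(1) by simp
  qed
  have det: "real_of_int A * real_of_int D - real_of_int B * real_of_int C = 1"
    using assms(1) by (metis of_int_1 of_int_diff of_int_mult)
  have "Im ((of_int A * \<tau> + of_int B) / (of_int C * \<tau> + of_int D)) =
     ((real_of_int A * real_of_int D - real_of_int B * real_of_int C) * Im \<tau>) / (norm (of_int C * \<tau> + of_int D))\<^sup>2"
    unfolding Im_divide cmod_power2 by (simp add: algebra_simps)
  then show "Im ((of_int A * \<tau> + of_int B) / (of_int C * \<tau> + of_int D)) > 0"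
    unfolding det using assms(2) nz by simp
qed

lemma abs_diff_double_less:
  fixes a c :: int
  assumes "c \<noteq> 0" "\<bar>c\<bar> < \<bar>a\<bar>"
  shows "\<bar>a - 2 * (sgn a * sgn c) * c\<bar> < \<bar>a\<bar>"
  by (cases "a > 0"; cases "c > 0") (use assms in \<open>auto simp: sgn_if\<close>)

text \<open>Descent on \<open>\<bar>A\<bar> + \<bar>C\<bar>\<close>; parity of the entries excludes the case \<open>\<bar>A\<bar> = \<bar>C\<bar>\<close>.\<close>
lemma gamma2_invariance:
  fixes F :: "complex \<Rightarrow> complex" and A B C D :: int
  assumes T: "\<And>\<tau>. F (\<tau> + 2) = F \<tau>"
    and L: "\<And>\<tau> s. Im \<tau> > 0 \<Longrightarrow> s \<in> {2, -2} \<Longrightarrow> F (\<tau> / (s * \<tau> + 1)) = (s * \<tau> + 1) ^ (2 * j) * F \<tau>"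
    and det: "A * D - B * C = 1" and even: "even B" "even C" and \<tau>: "Im \<tau> > 0"
  shows "F ((of_int A * \<tau> + of_int B) / (of_int C * \<tau> + of_int D)) = (of_int C * \<tau> + of_int D) ^ (2 * j) * F \<tau>"
  using det even
proof (induction "nat \<bar>A\<bar> + nat \<bar>C\<bar>" arbitrary: A B C D rule: less_induct)
  case less
  have Tn: "F (\<tau> + 2 * of_nat n) = F \<tau>" for \<tau> n
  proof (induction n)
    case (Suc n)
    have "\<tau> + 2 * of_nat (Suc n) = (\<tau> + 2 * of_nat n) + 2" by (simp add: algebra_simps)
    then show ?case by (simp only: T Suc)
  qed simp
  have Ti: "F (\<tau> + 2 * of_int n) = F \<tau>" for \<tau> n
  proof (cases "n \<ge> 0")
    case True
    then show ?thesis using Tn[of \<tau> "nat n"] by simp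
  next
    case False
    then show ?thesis using Tn[of "\<tau> + 2 * of_int n" "nat (- n)"] by simp
  qed
  have "odd (A * D)" using less.prems by (metis dvd_mult_right even_add even_diff odd_one even_mult_iff)
  then have oddA: "odd A" by simp
  note nz = moebius_uhp(1)[OF less.prems(1) \<tau>]
  consider "C = 0" | "C \<noteq> 0" "\<bar>C\<bar> < \<bar>A\<bar>" | "\<bar>A\<bar> < \<bar>C\<bar>" | "\<bar>A\<bar> = \<bar>C\<bar>" by linarith
  then show ?case
  proof cases
    case 1
    then have AD: "A * D = 1" using less.prems by simp
    obtain k where k: "B = 2 * k" using less.prems by blast
    have "A = 1 \<and> D = 1 \<or> A = - 1 \<and> D = - 1" using AD by (rule zmult_eq_1_iff[THEN iffD1])
    then show ?thesis
    proof
      assume "A = 1 \<and> D = 1"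
      then show ?thesis using 1 k Ti[of \<tau> k] by simp
    next
      assume "A = - 1 \<and> D = - 1"
      moreover have "(- \<tau> + of_int (2 * k)) / - 1 = \<tau> + 2 * of_int (- k)" by simp
      ultimately show ?thesis using 1 k Ti[of \<tau> "- k"] by simp
    qed
  next
    case 2
    \<comment> \<open>Factoring out the translation by \<open>2 s\<close> on the left replaces the
      upper row by itself minus \<open>2 s\<close> times the lower row.\<close>
    define s where "s = sgn A * sgn C"
    define A' where "A' = A - 2 * s * C"
    define B' where "B' = B - 2 * s * D"
    have "\<bar>A'\<bar> < \<bar>A\<bar>" unfolding A'_def s_def by (rule abs_diff_double_less) (use 2 in auto)
    then have "F ((of_int A' * \<tau> + of_int B') / (of_int C * \<tau> + of_int D)) = (of_int C * \<tau> + of_int D) ^ (2 * j) * F \<tau>"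
      by (intro less.hyps) (use less.prems in \<open>auto simp: A'_def B'_def algebra_simps\<close>)
    moreover have "(of_int A * \<tau> + of_int B) / (of_int C * \<tau> + of_int D) =
        (of_int A' * \<tau> + of_int B') / (of_int C * \<tau> + of_int D) + 2 * of_int s"
      using nz by (simp add: A'_def B'_def field_simps)
    ultimately show ?thesis using Ti by simp
  next
    case 3
    \<comment> \<open>Now the lower triangular generator is factored out on the left: the lower row
      is reduced by the upper one, and \<open>z\<close> is the image under the reduced
      matrix.\<close>
    define s where "s = sgn C * sgn A"
    define C' where "C' = C - 2 * s * A"
    define D' where "D' = D - 2 * s * B"
    have "A \<noteq> 0" using oddA by auto
    have less': "\<bar>C'\<bar> < \<bar>C\<bar>" unfolding C'_def s_def by (rule abs_diff_double_less) (use 3 \<open>A \<noteq> 0\<close> in auto)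
    have det': "A * D' - B * C' = 1" using less.prems by (simp add: C'_def D'_def algebra_simps)
    define z where "z = (of_int A * \<tau> + of_int B) / (of_int C' * \<tau> + of_int D')"
    have z: "Im z > 0" and nz': "of_int C' * \<tau> + of_int D' \<noteq> 0"
      unfolding z_def using moebius_uhp[OF det' \<tau>] by auto
    have IH: "F z = (of_int C' * \<tau> + of_int D') ^ (2 * j) * F \<tau>"
      unfolding z_def using less' by (intro less.hyps) (use less.prems det' in \<open>auto simp: C'_def\<close>)
    have s2: "of_int (2 * s) \<in> {2, -2 :: complex}"
      using 3 \<open>A \<noteq> 0\<close> by (auto simp: s_def sgn_if)
    have q: "of_int (2 * s) * z + 1 = (of_int C * \<tau> + of_int D) / (of_int C' * \<tau> + of_int D')"
      using nz' by (simp add: z_def field_simps) (simp add: C'_def D'_def algebra_simps)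
    have "z / (of_int (2 * s) * z + 1) = (of_int A * \<tau> + of_int B) / (of_int C * \<tau> + of_int D)"
      unfolding q using nz nz' by (simp add: z_def)
    then have "F ((of_int A * \<tau> + of_int B) / (of_int C * \<tau> + of_int D)) =
        (of_int (2 * s) * z + 1) ^ (2 * j) * F z"
      using L[OF z s2] by (simp only:)
    then have "F ((of_int A * \<tau> + of_int B) / (of_int C * \<tau> + of_int D)) =
        ((of_int C * \<tau> + of_int D) / (of_int C' * \<tau> + of_int D')) ^ (2 * j) * F z"
      by (simp only: q)
    then show ?thesis using nz' by (simp add: IH power_divide)
  next
    case 4
    then have "even A" using less.prems(3) by (metis dvd_abs_iff)
    then show ?thesis using oddA by simp
  qed
qed

text \<open>The generator \<open>\<tau> / (s * \<tau> + 1)\<close> is an inversion, the translation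
  by \<open>- s\<close> and another inversion; the period 2 of \<open>g\<close> absorbs the
  translation.\<close>

lemma inversion_gamma2:
  assumes FG: "\<And>\<tau>. Im \<tau> > 0 \<Longrightarrow> qeval f (- 1 / \<tau>) = \<tau> ^ (2 * j) * qeval g \<tau>"
    and det: "A * D - B * C = 1" "even B" "even C" and \<tau>: "Im \<tau> > 0"
  shows "qeval f ((of_int A * \<tau> + of_int B) / (of_int C * \<tau> + of_int D))
      = (of_int C * \<tau> + of_int D) ^ (2 * j) * qeval f \<tau>"
proof (rule gamma2_invariance[where F = "qeval f" and j = j, OF qeval_add_2 _ det \<tau>])
  fix \<tau> s :: complex assume \<tau>: "Im \<tau> > 0" and s: "s \<in> {2, -2}"
  have nz: "\<tau> \<noteq> 0" using \<tau> by auto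
  define \<sigma> where "\<sigma> = - 1 / \<tau> - s"
  have im: "Im (- 1 / \<tau>) > 0" by (rule Im_inversion_pos[OF \<tau>])
  then have \<sigma>: "Im \<sigma> > 0" using s by (auto simp: \<sigma>_def)
  have per: "qeval g \<sigma> = qeval g (- 1 / \<tau>)"
    using s qeval_add_2[of g \<sigma>] qeval_add_2[of g "- 1 / \<tau>"] by (auto simp: \<sigma>_def)
  have prod: "\<sigma> * \<tau> = - (s * \<tau> + 1)" using nz by (simp add: \<sigma>_def field_simps)
  have \<sigma>0: "\<sigma> \<noteq> 0" using \<sigma> by auto
  have "- 1 / \<sigma> = \<tau> / (s * \<tau> + 1)"
  proof -
    have "s * \<tau> + 1 = - (\<sigma> * \<tau>)" using prod by simp
    then show ?thesis using nz \<sigma>0 by (simp add: field_simps)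
  qed
  then have "qeval f (\<tau> / (s * \<tau> + 1)) = \<sigma> ^ (2 * j) * qeval g (- 1 / \<tau>)"
    using FG[OF \<sigma>] per by simp
  also have "qeval g (- 1 / \<tau>) = \<tau> ^ (2 * j) * qeval f \<tau>"
  proof -
    have "qeval f \<tau> = (- 1 / \<tau>) ^ (2 * j) * qeval g (- 1 / \<tau>)" using FG[OF im] nz by simp
    moreover have "\<tau> ^ (2 * j) * (- 1 / \<tau>) ^ (2 * j) = 1"
      using nz by (simp add: power_mult_distrib[symmetric])
    ultimately show ?thesis by (simp add: mult.assoc[symmetric])
  qed
  also have "\<sigma> ^ (2 * j) * (\<tau> ^ (2 * j) * qeval f \<tau>) = (\<sigma> * \<tau>) ^ (2 * j) * qeval f \<tau>"
    by (simp add: power_mult_distrib)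
  also have "\<dots> = (s * \<tau> + 1) ^ (2 * j) * qeval f \<tau>"
    unfolding prod by (simp only: power_mult power2_minus)
  finally show "qeval f (\<tau> / (s * \<tau> + 1)) = (s * \<tau> + 1) ^ (2 * j) * qeval f \<tau>" .
qed

section \<open>Hecke operators and their compatibility with inversion\<close>

definition fps_U :: "nat \<Rightarrow> 'a::comm_ring_1 fps \<Rightarrow> 'a fps" where
  "fps_U p f = Abs_fps (\<lambda>n. fps_nth f (p * n))"

definition fps_V :: "nat \<Rightarrow> 'a::comm_ring_1 fps \<Rightarrow> 'a fps" where
  "fps_V p f = Abs_fps (\<lambda>n. if p dvd n then fps_nth f (n div p) else 0)"

text \<open>The operator for weight \<open>2 j\<close>; for \<open>j = 0\<close> the truncated exponent is not the right one.\<close>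
definition hecke :: "nat \<Rightarrow> nat \<Rightarrow> 'a::comm_ring_1 fps \<Rightarrow> 'a fps" where
  "hecke j p f = fps_U p f + fps_const (of_nat p ^ (2 * j - 1)) * fps_V p f"

lemma hecke_nth: "fps_nth (hecke j p f) n =
    fps_nth f (p * n) + of_nat p ^ (2 * j - 1) * (if p dvd n then fps_nth f (n div p) else 0)"
  by (simp add: hecke_def fps_U_def fps_V_def)

lemma hecke_of_ints: "hecke j p (of_ints f) = of_ints (hecke j p f)"
  by (simp add: fps_eq_iff hecke_nth)

lemma hecke_alt:
  assumes "odd p"
  shows "hecke j p (fps_alt f) = fps_alt (hecke j p f)"
proof (rule fps_ext)
  fix n
  have "(-1 :: 'a) ^ (p * n) = (-1) ^ n" using assms by (simp add: minus_one_power_iff)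
  moreover have "(-1 :: 'a) ^ (n div p) = (-1) ^ n" if n: "p dvd n"
  proof -
    obtain k where "n = p * k" using n by blast
    then show ?thesis using assms by (simp add: minus_one_power_iff odd_pos)
  qed
  ultimately show "fps_nth (hecke j p (fps_alt f)) n = fps_nth (fps_alt (hecke j p f)) n"
    by (auto simp: hecke_nth algebra_simps)
qed

lemma conv_disc_fps_U:
  fixes f :: "complex fps"
  assumes "conv_disc f" "p > 0"
  shows "conv_disc (fps_U p f)"
  unfolding fps_conv_radius_def
proof (rule conv_radius_geI_ex')
  fix r :: real assume r: "0 < r" "ereal r < 1"
  define s where "s = root p r"
  have s: "0 < s" "s < 1" "s ^ p = r" using r assms(2) by (auto simp: s_def)
  have "summable (\<lambda>n. norm (fps_nth f n * of_real s ^ n))"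
    by (rule norm_summable_fps) (rule ereal_less_conv_radius[OF assms(1)], use s in simp)
  then have "summable ((\<lambda>n. norm (fps_nth f n * of_real s ^ n)) \<circ> (\<lambda>n. p * n))"
    by (rule summable_reindex) (use assms(2) in \<open>auto simp: inj_on_def\<close>)
  then have "summable (\<lambda>n. norm (fps_nth (fps_U p f) n * of_real r ^ n))"
    by (simp add: o_def fps_U_def power_mult flip: s(3))
  then show "summable (\<lambda>n. fps_nth (fps_U p f) n * of_real r ^ n)" by (rule summable_norm_cancel)
qed

lemma fps_V_sums:
  fixes f :: "complex fps"
  assumes "conv_disc f" "p > 0" "norm z < 1"
  shows "(\<lambda>n. fps_nth (fps_V p f) n * z ^ n) sums eval_fps f (z ^ p)"
proof -
  have "norm (z ^ p) < 1" using assms by (simp add: norm_power power_less_one_iff)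
  then have "(\<lambda>n. fps_nth f n * (z ^ p) ^ n) sums eval_fps f (z ^ p)"
    by (intro sums_eval_fps ereal_less_conv_radius assms(1))
  then have "(\<lambda>n. fps_nth (fps_V p f) (p * n) * z ^ (p * n)) sums eval_fps f (z ^ p)"
    using assms(2) by (simp add: fps_V_def power_mult)
  then show ?thesis
    by (subst (asm) sums_mono_reindex)
       (use assms(2) in \<open>auto simp: strict_mono_def fps_V_def elim!: dvdE\<close>)
qed

lemma conv_disc_fps_V:
  fixes f :: "complex fps"
  assumes "conv_disc f" "p > 0"
  shows "conv_disc (fps_V p f)"
  unfolding fps_conv_radius_def
proof (rule conv_radius_geI_ex')
  fix r :: real assume r: "0 < r" "ereal r < 1"
  then show "summable (\<lambda>n. fps_nth (fps_V p f) n * of_real r ^ n)"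
    using fps_V_sums[OF assms, of "of_real r"] by (simp add: sums_iff)
qed

lemma conv_disc_hecke:
  fixes f :: "complex fps"
  assumes "conv_disc f" "p > 0"
  shows "conv_disc (hecke j p f)"
  unfolding hecke_def
  by (intro conv_disc_add conv_disc_mult conv_disc_fps_U conv_disc_fps_V assms) simp

lemma root_of_unity_filter:
  assumes "p > 0"
  shows "(\<Sum>b<p. exp (2 * of_real pi * \<i> * of_nat b / of_nat p) ^ n) = (if p dvd n then of_nat p else 0)"
proof -
  define w where "w = exp (2 * of_real pi * \<i> * of_nat n / of_nat p)"
  have "exp (2 * of_real pi * \<i> * of_nat b / of_nat p) ^ n = w ^ b" for b
    by (simp add: w_def exp_of_nat_mult[symmetric] mult_ac)
  then have eq: "(\<Sum>b<p. exp (2 * of_real pi * \<i> * of_nat b / of_nat p) ^ n) = (\<Sum>b<p. w ^ b)" by simp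
  have w1: "w = 1 \<longleftrightarrow> p dvd n"
    unfolding w_def using complex_root_unity_eq_1[of p n] assms by simp
  show ?thesis
  proof (cases "p dvd n")
    case True
    then show ?thesis unfolding eq using w1 by simp
  next
    case False
    have "w ^ p = exp (2 * of_real pi * \<i> * of_nat n)"
      using assms by (simp add: w_def exp_of_nat_mult[symmetric])
    also have "\<dots> = 1" unfolding exp_eq_1 by (auto intro!: exI[of _ "int n"])
    finally show ?thesis unfolding eq using False w1 by (simp add: geometric_sum)
  qed
qed

text \<open>The translates are by \<open>2 b\<close> because the nome has period 2. Averaging over
  them is a root-of-unity filter that keeps the exponents divisible by \<open>p\<close>.\<close>

lemma qeval_hecke:
  assumes cv: "conv_disc f" and p: "p > 0" and \<tau>: "Im \<tau> > 0"
  shows "qeval (hecke j p f) \<tau> = of_nat p ^ (2 * j - 1) * qeval f (of_nat p * \<tau>) +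
     (\<Sum>b<p. qeval f ((\<tau> + 2 * of_nat b) / of_nat p)) / of_nat p"
proof -
  have V: "qeval (fps_V p f) \<tau> = qeval f (of_nat p * \<tau>)"
  proof -
    have "nome (of_nat p * \<tau>) = nome \<tau> ^ p"
      by (simp add: nome_def exp_of_nat_mult[symmetric] mult_ac)
    then show ?thesis
      using fps_V_sums[OF cv p norm_nome_less_1[OF \<tau>]] by (simp add: qeval_def eval_fps_def sums_iff)
  qed
  define y where "y = nome (\<tau> / of_nat p)"
  define w where "w b = exp (2 * of_real pi * \<i> * of_nat b / of_nat p)" for b :: nat
  have yp: "y ^ p = nome \<tau>"
    using p by (simp add: y_def nome_def exp_of_nat_mult[symmetric])
  have nome_b: "nome ((\<tau> + 2 * of_nat b) / of_nat p) = y * w b" for b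
    unfolding y_def w_def nome_def exp_add[symmetric] by (rule arg_cong[where f = exp]) (simp add: field_simps add_divide_distrib)
  have im: "Im ((\<tau> + 2 * of_nat b) / of_nat p) > 0" for b
    using \<tau> p by (simp add: Im_divide_of_nat)
  have "(\<lambda>n. fps_nth f n * (y * w b) ^ n) sums qeval f ((\<tau> + 2 * of_nat b) / of_nat p)" for b
    using sums_eval_fps[OF nome_in_conv_radius[OF cv im]] by (simp add: nome_b qeval_def)
  then have "(\<lambda>n. \<Sum>b<p. fps_nth f n * (y * w b) ^ n) sums (\<Sum>b<p. qeval f ((\<tau> + 2 * of_nat b) / of_nat p))"
    by (intro sums_sum) auto
  moreover have "(\<Sum>b<p. fps_nth f n * (y * w b) ^ n) = (if p dvd n then of_nat p * (fps_nth f n * y ^ n) else 0)" for n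
  proof -
    have "(\<Sum>b<p. fps_nth f n * (y * w b) ^ n) = (fps_nth f n * y ^ n) * (\<Sum>b<p. w b ^ n)"
      by (simp add: power_mult_distrib sum_distrib_left mult_ac)
    then show ?thesis unfolding w_def root_of_unity_filter[OF p] by simp
  qed
  ultimately have s: "(\<lambda>n. if p dvd n then of_nat p * (fps_nth f n * y ^ n) else 0) sums
      (\<Sum>b<p. qeval f ((\<tau> + 2 * of_nat b) / of_nat p))" by (simp only:)
  have sm: "strict_mono (\<lambda>n. p * n)" using p by (auto simp: strict_mono_def)
  have "(\<lambda>n. of_nat p * (fps_nth f (p * n) * y ^ (p * n))) sums (\<Sum>b<p. qeval f ((\<tau> + 2 * of_nat b) / of_nat p))"
    using s by (subst (asm) sums_mono_reindex[OF sm, symmetric]) (auto elim!: dvdE)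
  then have "(\<lambda>n. of_nat p * (fps_nth (fps_U p f) n * nome \<tau> ^ n)) sums (\<Sum>b<p. qeval f ((\<tau> + 2 * of_nat b) / of_nat p))"
    by (simp add: fps_U_def power_mult yp)
  from sums_divide[OF this, of "of_nat p"]
  have U: "qeval (fps_U p f) \<tau> = (\<Sum>b<p. qeval f ((\<tau> + 2 * of_nat b) / of_nat p)) / of_nat p"
    using p by (simp add: qeval_def eval_fps_def sums_iff)
  have c: "conv_disc (fps_const (of_nat p ^ (2 * j - 1)) :: complex fps)" by simp
  show ?thesis
    unfolding hecke_def
      qeval_add[OF conv_disc_fps_U[OF cv p] conv_disc_mult[OF c conv_disc_fps_V[OF cv p]] \<tau>]
      qeval_mult[OF c conv_disc_fps_V[OF cv p] \<tau>] U V qeval_const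
    by simp
qed

text \<open>Inversion permutes the \<open>p + 1\<close> terms: the term \<open>b = 0\<close> is
  exchanged with the \<open>V\<close>-term, and the others are matched by
  \<open>b \<mapsto> \<psi> b\<close> with \<open>4 * b * \<psi> b \<equiv> -1\<close> modulo
  \<open>p\<close>. The 4 comes from the two translations by even numbers.\<close>

lemma hecke_inversion:
  assumes cv: "conv_disc f" "conv_disc g"
    and FG: "\<And>\<tau>. Im \<tau> > 0 \<Longrightarrow> qeval f (- 1 / \<tau>) = \<tau> ^ (2 * j) * qeval g \<tau>"
    and j: "j > 0" and p: "prime p" "odd p" and \<tau>: "Im \<tau> > 0"
  shows "qeval (hecke j p f) (- 1 / \<tau>) = \<tau> ^ (2 * j) * qeval (hecke j p g) \<tau>"
proof -
  have p0: "p > 0" using p prime_gt_0_nat by blast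
  have nz: "\<tau> \<noteq> 0" "of_nat p \<noteq> (0 :: complex)" using \<tau> p0 by auto
  have p1: "of_nat p ^ (2 * j) = of_nat p * (of_nat p ^ (2 * j - 1) :: complex)"
    using j by (subst power_Suc[symmetric]) simp
  have "\<exists>b'. b' \<in> {1..<p} \<and> p dvd 4 * b * b' + 1" if b: "b \<in> {1..<p}" for b
  proof -
    have "coprime (4 * b) p"
    proof -
      have "\<not> p dvd 4" 
      proof
        assume "p dvd 4"
        then have "p dvd 2 * 2" by simp
        then have "p dvd 2" using prime_dvd_mult_iff[OF p(1)] by blast
        then have "p = 2" using primes_dvd_imp_eq[OF p(1) two_is_prime_nat] by blast
        then show False using p(2) by simp
      qed
      moreover have "\<not> p dvd b" using b by (auto dest: dvd_imp_le)
      ultimately have "\<not> p dvd 4 * b" using prime_dvd_mult_iff[OF p(1)] by blast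
      then show ?thesis by (rule coprime_commute[THEN iffD1, OF prime_imp_coprime[OF p(1)]])
    qed
    then obtain x where x: "[4 * b * x = 1] (mod p)" 
      using cong_solve_coprime_nat[of "4 * b" p] by (metis One_nat_def)
    \<comment> \<open>The factor \<open>p - 1\<close> plays the role of \<open>-1\<close> modulo
      \<open>p\<close> within the natural numbers.\<close>
    define b' where "b' = (x * (p - 1)) mod p"
    have "[4 * b * b' = 4 * b * (x * (p - 1))] (mod p)"
      unfolding b'_def by (intro cong_mult cong_refl) (simp add: cong_def)
    also have "4 * b * (x * (p - 1)) = (4 * b * x) * (p - 1)" by (simp add: mult_ac)
    also have "[(4 * b * x) * (p - 1) = 1 * (p - 1)] (mod p)" by (intro cong_mult x cong_refl)
    finally have "[4 * b * b' + 1 = 1 * (p - 1) + 1] (mod p)" by (rule cong_add[OF _ cong_refl])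
    moreover have "1 * (p - 1) + 1 = p" using p0 by simp
    ultimately have "[4 * b * b' + 1 = p] (mod p)" by (simp only:)
    from cong_dvd_iff[OF this] have d: "p dvd 4 * b * b' + 1" by simp
    moreover have "b' \<noteq> 0"
    proof
      assume "b' = 0"
      then show False using d p(1) by simp
    qed
    moreover have "b' < p" using p0 by (simp add: b'_def)
    ultimately show ?thesis by (intro exI[of _ b']) auto
  qed
  then obtain \<psi> where \<psi>: "\<And>b. b \<in> {1..<p} \<Longrightarrow> \<psi> b \<in> {1..<p} \<and> p dvd 4 * b * \<psi> b + 1"
    by metis
  have inj: "inj_on \<psi> {1..<p}"
  proof (rule inj_onI)
    fix a b assume ab: "a \<in> {1..<p}" "b \<in> {1..<p}" "\<psi> a = \<psi> b"
    have "int p dvd int (4 * a * \<psi> a + 1) - int (4 * b * \<psi> b + 1)"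
      using \<psi>[OF ab(1)] \<psi>[OF ab(2)] by (intro dvd_diff) (simp_all only: of_nat_dvd_iff)
    also have "int (4 * a * \<psi> a + 1) - int (4 * b * \<psi> b + 1) = (int a - int b) * (4 * int (\<psi> b))"
      using ab(3) by (simp add: algebra_simps)
    finally have "int p dvd int a - int b \<or> int p dvd 4 * int (\<psi> b)"
      using prime_dvd_mult_iff[of "int p"] p(1) by simp
    moreover have "\<not> int p dvd 4 * int (\<psi> b)"
    proof
      assume "int p dvd 4 * int (\<psi> b)"
      then have "int p dvd int b * (4 * int (\<psi> b))" by (rule dvd_mult)
      moreover have "int p dvd int (4 * b * \<psi> b + 1)" using \<psi>[OF ab(2)] by (simp only: of_nat_dvd_iff)
      ultimately have "int p dvd int (4 * b * \<psi> b + 1) - int b * (4 * int (\<psi> b))" by (rule dvd_diff[rotated])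
      then show False using p(1) by (simp add: algebra_simps)
    qed
    ultimately have "int p dvd int a - int b" by blast
    moreover have "\<bar>int a - int b\<bar> < int p" using ab by auto
    ultimately show "a = b" using zdvd_imp_le[of "int p" "\<bar>int a - int b\<bar>"] by fastforce
  qed
  have bij: "bij_betw \<psi> {1..<p} {1..<p}"
  proof -
    have "\<psi> ` {1..<p} \<subseteq> {1..<p}" using \<psi> by blast
    then show ?thesis using inj endo_inj_surj[OF _ _ inj] by (simp add: bij_betw_def)
  qed
  have shift_term: "qeval f ((- 1 / \<tau> + 2 * of_nat b) / of_nat p) =
      \<tau> ^ (2 * j) * qeval g ((\<tau> + 2 * of_nat (\<psi> b)) / of_nat p)" if b: "b \<in> {1..<p}" for b
  proof -
    define c where "c = \<psi> b"
    \<comment> \<open>\<open>m\<close> completes the matrix with rows \<open>(m, 2 b)\<close> and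
      \<open>(2 c, p)\<close> to determinant 1. Its off-diagonal entries are even, so the invariance
      of \<open>f\<close> applies to it.\<close>
    obtain m where m: "4 * b * c + 1 = p * m" using \<psi>[OF b] unfolding c_def by blast
    have mc: "of_nat p * of_nat m = (4 * of_nat b * of_nat c + 1 :: complex)"
      using arg_cong[OF m[symmetric], of "of_nat :: nat \<Rightarrow> complex"] by (simp add: algebra_simps)
    have mi: "int p * int m = 4 * int b * int c + 1"
      using arg_cong[OF m[symmetric], of int] by (simp add: algebra_simps)
    define u where "u = (\<tau> + 2 * of_nat c) / of_nat p"
    have u: "Im u > 0" using \<tau> p0 by (simp add: u_def Im_divide_of_nat)
    have \<tau>u: "\<tau> = of_nat p * u - 2 * of_nat c" using nz by (simp add: u_def)
    have u0: "u \<noteq> 0" using u by auto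
    have det: "int m * int p - 2 * int b * (2 * int c) = 1" using mi by (simp add: algebra_simps)
    have "qeval f ((of_int (int m) * (- 1 / u) + of_int (2 * int b)) / (of_int (2 * int c) * (- 1 / u) + of_int (int p)))
       = (of_int (2 * int c) * (- 1 / u) + of_int (int p)) ^ (2 * j) * qeval f (- 1 / u)"
      by (rule inversion_gamma2[OF FG det _ _ Im_inversion_pos[OF u]]) auto
    moreover have den: "of_int (2 * int c) * (- 1 / u) + of_int (int p) = \<tau> / u"
      using u0 by (simp add: \<tau>u field_simps)
    moreover have "(of_int (int m) * (- 1 / u) + of_int (2 * int b)) / (\<tau> / u) = (- 1 / \<tau> + 2 * of_nat b) / of_nat p"
    proof -
      have "(of_int (int m) * (- 1 / u) + of_int (2 * int b)) / (\<tau> / u) = (2 * of_nat b * u - of_nat m) / \<tau>"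
        using u0 nz by (simp add: field_simps)
      also have "of_nat p * (2 * of_nat b * u - of_nat m) = 2 * of_nat b * \<tau> - 1"
        using mc by (simp add: \<tau>u algebra_simps)
      then have "2 * of_nat b * u - of_nat m = (2 * of_nat b * \<tau> - 1) / of_nat p"
        using nz by (simp add: field_simps)
      finally show ?thesis using nz by (simp add: field_simps)
    qed
    ultimately have "qeval f ((- 1 / \<tau> + 2 * of_nat b) / of_nat p) = (\<tau> / u) ^ (2 * j) * (u ^ (2 * j) * qeval g u)"
      by (simp only: FG[OF u])
    also have "\<dots> = \<tau> ^ (2 * j) * qeval g u" using u0 by (simp add: power_divide)
    finally show ?thesis by (simp only: u_def c_def)
  qed
  have split: "{..<p} = insert 0 {1..<p}" using p0 by auto
  have zero: "qeval f ((- 1 / \<tau> + 2 * of_nat 0) / of_nat p) = (of_nat p * \<tau>) ^ (2 * j) * qeval g (of_nat p * \<tau>)"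
  proof -
    have "Im (of_nat p * \<tau>) > 0" using \<tau> p0 by simp
    from FG[OF this] show ?thesis by (simp add: mult.commute)
  qed
  have V: "qeval f (of_nat p * (- 1 / \<tau>)) = (\<tau> / of_nat p) ^ (2 * j) * qeval g (\<tau> / of_nat p)"
  proof -
    have "Im (\<tau> / of_nat p) > 0" using \<tau> p0 by (simp add: Im_divide_of_nat)
    from FG[OF this] show ?thesis by simp
  qed
  let ?s = "\<Sum>b\<in>{1..<p}. qeval g ((\<tau> + 2 * of_nat b) / of_nat p)"
  have "(\<Sum>b\<in>{1..<p}. qeval f ((- 1 / \<tau> + 2 * of_nat b) / of_nat p)) = \<tau> ^ (2 * j) * ?s"
  proof -
    have "(\<Sum>b\<in>{1..<p}. qeval f ((- 1 / \<tau> + 2 * of_nat b) / of_nat p)) =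
        (\<Sum>b\<in>{1..<p}. \<tau> ^ (2 * j) * qeval g ((\<tau> + 2 * of_nat (\<psi> b)) / of_nat p))"
      by (rule sum.cong[OF refl shift_term])
    also have "\<dots> = \<tau> ^ (2 * j) * (\<Sum>b\<in>{1..<p}. qeval g ((\<tau> + 2 * of_nat (\<psi> b)) / of_nat p))"
      by (simp only: sum_distrib_left)
    also have "(\<Sum>b\<in>{1..<p}. qeval g ((\<tau> + 2 * of_nat (\<psi> b)) / of_nat p)) = ?s"
      by (rule sum.reindex_bij_betw[OF bij])
    finally show ?thesis .
  qed
  then have "qeval (hecke j p f) (- 1 / \<tau>) =
      of_nat p ^ (2 * j - 1) * ((\<tau> / of_nat p) ^ (2 * j) * qeval g (\<tau> / of_nat p)) +
      ((of_nat p * \<tau>) ^ (2 * j) * qeval g (of_nat p * \<tau>) + \<tau> ^ (2 * j) * ?s) / of_nat p"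
    unfolding qeval_hecke[OF cv(1) p0 Im_inversion_pos[OF \<tau>]] split V
    by (subst sum.insert) (simp_all add: zero[simplified])
  also have "\<dots> = \<tau> ^ (2 * j) * (of_nat p ^ (2 * j - 1) * qeval g (of_nat p * \<tau>) +
      (qeval g ((\<tau> + 2 * of_nat 0) / of_nat p) + ?s) / of_nat p)"
  proof -
    have a: "of_nat p ^ (2 * j - 1) * ((\<tau> / of_nat p) ^ (2 * j) * X) = \<tau> ^ (2 * j) * (X / of_nat p)" for X
      using nz by (simp add: power_divide p1)
    have b: "((of_nat p * \<tau>) ^ (2 * j) * Y) / of_nat p = \<tau> ^ (2 * j) * (of_nat p ^ (2 * j - 1) * Y)" for Y
      using nz by (simp add: power_mult_distrib p1)
    show ?thesis unfolding add_divide_distrib a b by (simp add: algebra_simps)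
  qed
  also have "\<dots> = \<tau> ^ (2 * j) * qeval (hecke j p g) \<tau>"
    unfolding qeval_hecke[OF cv(2) p0 \<tau>] split by (subst sum.insert) simp_all
  finally show ?thesis .
qed

text \<open>The Hecke image and \<open>k\<close> obey the same kind of inversion law, so their
  difference is subject to the vanishing theorem. The law is used for \<open>f\<close> and for
  \<open>fps_alt f\<close>, which reaches the two cusps other than
  \<open>\<i>\<infinity>\<close>.\<close>

lemma hecke_theta_poly:
  assumes f: "theta_poly j f" and k: "theta_poly j k" and j: "j > 0" and p: "prime p" "odd p"
    and low: "\<And>n. n \<le> j \<Longrightarrow> fps_nth (hecke j p f) n = fps_nth k n"
  shows "hecke j p f = k"
proof -
  have p0: "p > 0" using p prime_gt_0_nat by blast
  have main: "\<exists>h. conv_disc h \<and> (\<forall>\<tau>. Im \<tau> > 0 \<longrightarrow>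
      qeval (hecke j p f - k) (- 1 / \<tau>) = \<tau> ^ (2 * j) * qeval h \<tau>)"
    if fk: "theta_poly j f" "theta_poly j k" for f k
  proof -
    obtain g where g: "theta_poly j g" "\<And>\<tau>. Im \<tau> > 0 \<Longrightarrow> qeval f (- 1 / \<tau>) = \<tau> ^ (2 * j) * qeval g \<tau>"
      using theta_poly_inversion[OF fk(1)] by blast
    obtain l where l: "theta_poly j l" "\<And>\<tau>. Im \<tau> > 0 \<Longrightarrow> qeval k (- 1 / \<tau>) = \<tau> ^ (2 * j) * qeval l \<tau>"
      using theta_poly_inversion[OF fk(2)] by blast
    note cv = theta_poly_conv_disc[OF fk(1)] theta_poly_conv_disc[OF fk(2)]
      theta_poly_conv_disc[OF g(1)] theta_poly_conv_disc[OF l(1)]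
    show ?thesis
    proof (intro exI conjI allI impI)
      show "conv_disc (hecke j p g - l)"
        by (intro conv_disc_add conv_disc_hecke cv p0)
      fix \<tau> :: complex assume \<tau>: "Im \<tau> > 0"
      have "qeval (hecke j p f) (- 1 / \<tau>) = \<tau> ^ (2 * j) * qeval (hecke j p g) \<tau>"
        by (rule hecke_inversion[OF cv(1,3) g(2) j p \<tau>])
      then show "qeval (hecke j p f - k) (- 1 / \<tau>) = \<tau> ^ (2 * j) * qeval (hecke j p g - l) \<tau>"
        by (simp only: qeval_diff[OF conv_disc_hecke[OF cv(1) p0] cv(2) Im_inversion_pos[OF \<tau>]]
          qeval_diff[OF conv_disc_hecke[OF cv(3) p0] cv(4) \<tau>] l(2)[OF \<tau>] right_diff_distrib)
    qed
  qed
  obtain h1 where h1: "conv_disc h1" "\<And>\<tau>. Im \<tau> > 0 \<Longrightarrow>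
      qeval (hecke j p f - k) (- 1 / \<tau>) = \<tau> ^ (2 * j) * qeval h1 \<tau>"
    using main[OF f k] by blast
  obtain h2 where h2: "conv_disc h2" "\<And>\<tau>. Im \<tau> > 0 \<Longrightarrow>
      qeval (hecke j p (fps_alt f) - fps_alt k) (- 1 / \<tau>) = \<tau> ^ (2 * j) * qeval h2 \<tau>"
    using main[OF theta_poly_alt[OF f] theta_poly_alt[OF k]] by blast
  have "hecke j p f - k = 0"
  proof (rule weight_vanishing[OF _ h1(1) h2(1) h1(2)])
    show "conv_disc (hecke j p f - k)"
      by (intro conv_disc_add conv_disc_hecke p0 theta_poly_conv_disc[OF f] theta_poly_conv_disc[OF k])
    show "qeval (fps_alt (hecke j p f - k)) (- 1 / \<tau>) = \<tau> ^ (2 * j) * qeval h2 \<tau>" if "Im \<tau> > 0" for \<tau>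
      using h2(2)[OF that] by (simp add: hecke_alt[OF p(2)])
  qed (use low in auto)
  then show ?thesis by simp
qed

text \<open>The top coefficient is read off at the cusp where \<open>cA\<close> vanishes.\<close>
lemma hecke_top_coefficient:
  assumes i: "i > 0" and p: "prime p" "odd p"
    and eq: "hecke i p ((cA - cB) ^ i) = (\<Sum>l\<le>i. fps_const (c l) * (cA ^ (i - l) * (cA - cB) ^ l))"
  shows "c i = 1 + of_nat p ^ (2 * i - 1)"
proof -
  have p0: "p > 0" using p prime_gt_0_nat by blast
  let ?C = "cA - cB"
  have cvC: "conv_disc (- ?C)" "conv_disc ?C"
    using conv_disc_add(2)[OF conv_disc_cAB] conv_disc_add(2)[OF conv_disc_cAB(2,1)]
    by simp_all
  note cvB = conv_disc_cAB(2)
  have "fps_alt (hecke i p (?C ^ i)) = fps_alt (\<Sum>l\<le>i. fps_const (c l) * (cA ^ (i - l) * ?C ^ l))"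
    using eq by simp
  have alt_sum: "fps_alt (sum h {..n}) = (\<Sum>l\<le>n. fps_alt (h l))" for h :: "nat \<Rightarrow> complex fps" and n
    by (induction n) auto
  have altC: "fps_alt ?C = - ?C" by (simp add: cB_def)
  have altA: "fps_alt cA = cB" by (simp add: cB_def)
  \<comment> \<open>After \<open>q \<mapsto> - q\<close>, inversion exchanges \<open>cB\<close> and
    \<open>- ?C\<close> up to \<open>\<tau>^2\<close>. The term of index \<open>l\<close> then
    contains \<open>?C^(i - l)\<close>, so only \<open>l = i\<close> survives at
    \<open>\<i>\<infinity>\<close>, where \<open>?C\<close> tends to 0 and \<open>cB\<close> to
    1.\<close>
  have eq': "hecke i p ((- ?C) ^ i) = (\<Sum>l\<le>i. fps_const (c l) * (cB ^ (i - l) * (- ?C) ^ l))"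
  proof -
    have "hecke i p ((- ?C) ^ i) = fps_alt (hecke i p (?C ^ i))"
      by (simp only: hecke_alt[OF p(2), symmetric] fps_alt_power altC)
    also have "\<dots> = fps_alt (\<Sum>l\<le>i. fps_const (c l) * (cA ^ (i - l) * ?C ^ l))" by (simp only: eq)
    finally show ?thesis by (simp only: alt_sum fps_alt_mult fps_alt_const fps_alt_power altC altA)
  qed
  have CS: "qeval (- ?C) (- 1 / \<tau>) = \<tau>\<^sup>2 * qeval cB \<tau>" if \<tau>: "Im \<tau> > 0" for \<tau>
  proof -
    have "qeval (- ?C) (- 1 / \<tau>) = qeval (cB - cA) (- 1 / \<tau>)" by simp
    also have "\<dots> = qeval cB (- 1 / \<tau>) - qeval cA (- 1 / \<tau>)"
      by (rule qeval_diff[OF conv_disc_cAB(2,1) Im_inversion_pos[OF \<tau>]])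
    finally show ?thesis unfolding qeval_cA_inversion[OF \<tau>] qeval_cB_inversion[OF \<tau>]
      by (simp add: algebra_simps)
  qed
  have pw: "qeval ((- ?C) ^ i) (- 1 / \<tau>) = \<tau> ^ (2 * i) * qeval (cB ^ i) \<tau>" if \<tau>: "Im \<tau> > 0" for \<tau>
    unfolding qeval_power[OF cvC(1) Im_inversion_pos[OF \<tau>]] qeval_power[OF cvB \<tau>] CS[OF \<tau>]
    by (simp add: power_mult_distrib power_mult)
  have hB: "qeval (hecke i p (cB ^ i)) \<tau> = (\<Sum>l\<le>i. c l * ((- qeval ?C \<tau>) ^ (i - l) * qeval cB \<tau> ^ l))"
    if \<tau>: "Im \<tau> > 0" for \<tau>
  proof -
    note im = Im_inversion_pos[OF \<tau>]
    have qsum: "qeval (sum h {..n}) \<sigma> = (\<Sum>l\<le>n. qeval (h l) \<sigma>) \<and> conv_disc (sum h {..n})"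
      if "Im \<sigma> > 0" "\<And>l. conv_disc (h l)" for h :: "nat \<Rightarrow> complex fps" and n \<sigma>
      using that by (induction n) (auto simp: qeval_add conv_disc_add)
    have t: "qeval (fps_const (c l) * (cB ^ (i - l) * (- ?C) ^ l)) (- 1 / \<tau>) =
        \<tau> ^ (2 * i) * (c l * ((- qeval ?C \<tau>) ^ (i - l) * qeval cB \<tau> ^ l))" if "l \<le> i" for l
    proof -
      have cvc: "conv_disc (fps_const (c l))" by simp
      have cvp: "conv_disc (cB ^ (i - l))" "conv_disc ((- ?C) ^ l)"
        by (intro conv_disc_power cvB cvC)+
      have "qeval (fps_const (c l) * (cB ^ (i - l) * (- ?C) ^ l)) (- 1 / \<tau>) =
          c l * (qeval cB (- 1 / \<tau>) ^ (i - l) * qeval (- ?C) (- 1 / \<tau>) ^ l)"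
        unfolding qeval_mult[OF cvc conv_disc_mult[OF cvp] im] qeval_mult[OF cvp im]
          qeval_power[OF cvB im] qeval_power[OF cvC(1) im] qeval_const ..
      also have "\<dots> = c l * ((\<tau>\<^sup>2 * (- qeval ?C \<tau>)) ^ (i - l) * (\<tau>\<^sup>2 * qeval cB \<tau>) ^ l)"
        unfolding CS[OF \<tau>] qeval_cB_inversion[OF \<tau>] qeval_diff[OF conv_disc_cAB \<tau>]
        by (simp only: mult_minus_left mult_minus_right)
      also have "\<dots> = (\<tau>\<^sup>2) ^ ((i - l) + l) * (c l * ((- qeval ?C \<tau>) ^ (i - l) * qeval cB \<tau> ^ l))"
        by (simp only: power_mult_distrib power_add mult_ac)
      finally show ?thesis using that by (simp add: power_mult)
    qed
    have "\<tau> ^ (2 * i) * qeval (hecke i p (cB ^ i)) \<tau> = qeval (hecke i p ((- ?C) ^ i)) (- 1 / \<tau>)"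
      by (rule hecke_inversion[OF _ _ pw i p \<tau>, symmetric])
         (intro conv_disc_power cvC cvB)+
    also have "\<dots> = (\<Sum>l\<le>i. qeval (fps_const (c l) * (cB ^ (i - l) * (- ?C) ^ l)) (- 1 / \<tau>))"
      unfolding eq' by (rule qsum[OF im, THEN conjunct1])
        (intro conv_disc_mult conv_disc_power cvC cvB, simp)
    also have "\<dots> = \<tau> ^ (2 * i) * (\<Sum>l\<le>i. c l * ((- qeval ?C \<tau>) ^ (i - l) * qeval cB \<tau> ^ l))"
      unfolding sum_distrib_left by (intro sum.cong refl t) simp
    finally show ?thesis using \<tau> by auto
  qed
  have cB0: "fps_nth cB 0 = 1" by (simp add: cB_def cA_def modA_nth_0)
  have C0: "fps_nth ?C 0 = 0" by (simp add: cA_diff_cB fps_mult_numeral_left modF_nth)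
  have "((\<lambda>\<tau>. \<Sum>l\<le>i. c l * ((- qeval ?C \<tau>) ^ (i - l) * qeval cB \<tau> ^ l)) \<longlongrightarrow>
      (\<Sum>l\<le>i. c l * ((- 0) ^ (i - l) * 1 ^ l))) at_ii"
    by (intro tendsto_intros qeval_tendsto[OF cvC(2), unfolded C0] qeval_tendsto[OF cvB, unfolded cB0])
  also have "(\<Sum>l\<le>i. c l * ((- 0) ^ (i - l) * 1 ^ l)) = (\<Sum>l\<le>i. if l = i then c l else 0)"
    by (intro sum.cong) auto
  also have "\<dots> = c i" by simp
  finally have "((\<lambda>\<tau>. \<Sum>l\<le>i. c l * ((- qeval ?C \<tau>) ^ (i - l) * qeval cB \<tau> ^ l)) \<longlongrightarrow> c i) at_ii" .
  then have "(qeval (hecke i p (cB ^ i)) \<longlongrightarrow> c i) at_ii"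
    by (rule Lim_transform_eventually) (use hB in \<open>auto simp: eventually_at_ii intro!: exI[of _ 0]\<close>)
  moreover have "(qeval (hecke i p (cB ^ i)) \<longlongrightarrow> fps_nth (hecke i p (cB ^ i)) 0) at_ii"
    by (intro qeval_tendsto conv_disc_hecke conv_disc_power cvB p0)
  ultimately have "c i = fps_nth (hecke i p (cB ^ i)) 0"
    using tendsto_unique[OF at_ii_neq_bot] by blast
  also have "\<dots> = 1 + of_nat p ^ (2 * i - 1)"
    by (simp add: hecke_nth fps_power_zeroth cB0)
  finally show ?thesis .
qed

section \<open>Nilpotency modulo 2\<close>

definition theta_comb :: "nat \<Rightarrow> (nat \<Rightarrow> int) \<Rightarrow> int fps" where
  "theta_comb j c = (\<Sum>l\<le>j. fps_const (c l) * (modA ^ (j - l) * modF ^ l))"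

lemma modF_power_nth: "n < m \<Longrightarrow> fps_nth (modF ^ m) n = 0" "fps_nth (modF ^ m) m = 1"
  using startsby_zero_power_prefix[OF modF_nth(1), of m]
    startsby_zero_power_nth_same[OF modF_nth(1), of m] modF_nth(2) by simp_all

lemma mult_modF_power_nth:
  "n < m \<Longrightarrow> fps_nth (f * modF ^ m) n = 0" "fps_nth (f * modF ^ m) m = fps_nth f 0"
proof -
  show "fps_nth (f * modF ^ m) n = 0" if "n < m"
    using that by (simp add: fps_mult_nth modF_power_nth)
  have "fps_nth (f * modF ^ m) m = (\<Sum>i=0..m. if i = 0 then fps_nth f 0 else 0)"
    unfolding fps_mult_nth by (intro sum.cong) (auto simp: modF_power_nth)
  then show "fps_nth (f * modF ^ m) m = fps_nth f 0" by simp
qed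

text \<open>The basis element of index \<open>l\<close> starts with \<open>q^l\<close> with
  coefficient 1, so the coefficients can be corrected one after another over the integers.\<close>

lemma theta_comb_approx: "\<exists>c. \<forall>n\<le>j. fps_nth h n = fps_nth (theta_comb j c) n"
proof -
  have "\<exists>c. \<forall>n<m. fps_nth h n = fps_nth (theta_comb j c) n" if "m \<le> Suc j" for m
    using that
  proof (induction m)
    case (Suc m)
    then obtain c where c: "\<And>n. n < m \<Longrightarrow> fps_nth h n = fps_nth (theta_comb j c) n" by auto
    define d where "d = fps_nth h m - fps_nth (theta_comb j c) m"
    have "theta_comb j (c(m := c m + d)) = theta_comb j c +
        (\<Sum>l\<le>j. if l = m then fps_const d * (modA ^ (j - l) * modF ^ l) else 0)"
      unfolding theta_comb_def sum.distrib[symmetric]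
      by (intro sum.cong) (auto simp: distrib_right simp flip: fps_const_add)
    also have "\<dots> = theta_comb j c + fps_const d * (modA ^ (j - m) * modF ^ m)"
      using Suc.prems by simp
    finally have eq: "theta_comb j (c(m := c m + d)) =
        theta_comb j c + fps_const d * (modA ^ (j - m) * modF ^ m)" .
    have "fps_nth h n = fps_nth (theta_comb j (c(m := c m + d))) n" if "n < Suc m" for n
      unfolding eq using that c mult_modF_power_nth[where f = "modA ^ (j - m)" and m = m]
      by (cases "n = m") (auto simp: d_def fps_power_zeroth modA_nth_0)
    then show ?case by blast
  qed simp
  from this[of "Suc j"] show ?thesis by (auto simp: less_Suc_eq_le)
qed

lemma cphi_comb: "theta_poly j (cfps (theta_comb j c))"
proof -
  have F: "cfps modF = fps_const (1/16) * (cA - cB)"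
    unfolding cA_diff_cB by (simp add: fps_eq_iff fps_mult_numeral_left)
  have "cfps (theta_comb j c) = (\<Sum>l\<le>j. fps_const (of_int (c l) * (1/16) ^ l) * (cA ^ (j - l) * (cA - cB) ^ l))"
    unfolding theta_comb_def of_ints_sum
    by (intro sum.cong refl)
       (simp add: F cA_def[symmetric] power_mult_distrib fps_const_power mult_ac flip: fps_const_mult del: of_ints_eq_iff)
  also have "theta_poly j \<dots>"
  proof (rule theta_poly_sum)
    fix l assume "l \<in> {..j}"
    then show "theta_poly j (fps_const (of_int (c l) * (1/16) ^ l) * (cA ^ (j - l) * (cA - cB) ^ l))"
      using theta_poly_monomial[of "j - l" l] by (intro theta_poly_scale) simp
  qed auto
  finally show ?thesis .
qed

text \<open>Matching the coefficients up to \<open>q^j\<close> supplies an integral candidate; the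
  complex vanishing theorem makes it equal to the Hecke image.\<close>

lemma hecke_theta_comb:
  assumes "j > 0" "prime p" "odd p"
  shows "\<exists>c'. hecke j p (theta_comb j c) = theta_comb j c'"
proof -
  obtain c' where c': "\<And>n. n \<le> j \<Longrightarrow> fps_nth (hecke j p (theta_comb j c)) n = fps_nth (theta_comb j c') n"
    using theta_comb_approx by blast
  have "hecke j p (cfps (theta_comb j c)) = cfps (theta_comb j c')"
    by (rule hecke_theta_poly[OF cphi_comb cphi_comb assms])
       (simp add: hecke_of_ints c')
  then have "hecke j p (theta_comb j c) = theta_comb j c'"
    by (simp add: hecke_of_ints)
  then show ?thesis by (rule exI[where x = c'])
qed

lemma fps_const_dvd_iff: "fps_const m dvd f \<longleftrightarrow> (\<forall>n. m dvd fps_nth f n)" for m :: int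
proof
  assume "\<forall>n. m dvd fps_nth f n"
  then have "f = fps_const m * Abs_fps (\<lambda>n. fps_nth f n div m)" by (simp add: fps_eq_iff)
  then show "fps_const m dvd f" by (rule dvdI)
qed auto

lemma dvd_theta_minus_1: "2 dvd phi - 1"
proof -
  have "fps_const 2 dvd phi - 1"
    unfolding fps_const_dvd_iff by (auto simp: phi_def card_square_roots)
  then show ?thesis by (simp add: numeral_fps_const)
qed

lemma dvd_modA_minus_1: "2 dvd modA - 1"
proof -
  have "modA - 1 = (phi - 1) * (phi ^ 3 + phi ^ 2 + phi + 1)"
    by (simp add: modA_def algebra_simps power_numeral_reduce)
  then show ?thesis using dvd_theta_minus_1 by simp
qed

lemma dvd_modA_power_minus_1: "2 dvd modA ^ n - 1"
proof (induction n)
  case (Suc n)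
  have "modA ^ Suc n - 1 = modA * (modA ^ n - 1) + (modA - 1)" by (simp add: algebra_simps)
  then show ?case using Suc dvd_modA_minus_1 by (metis dvd_add dvd_mult)
qed simp

section \<open>Degree in F modulo 2\<close>

abbreviation F_poly :: "nat \<Rightarrow> (nat \<Rightarrow> int) \<Rightarrow> int fps" where
  "F_poly m e \<equiv> (\<Sum>l<m. fps_const (e l) * modF ^ l)"

text \<open>The degree in \<open>modF\<close> is below \<open>m\<close> after reduction modulo 2;
  for \<open>m = 0\<close> this says that 2 divides \<open>f\<close>.\<close>

definition low_degree :: "nat \<Rightarrow> int fps \<Rightarrow> bool" where
  "low_degree m f \<longleftrightarrow> (\<exists>e. 2 dvd f - F_poly m e)"

lemma low_degree_cong: "low_degree m f \<Longrightarrow> 2 dvd f - g \<Longrightarrow> low_degree m g"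
proof -
  assume "low_degree m f" and fg: "2 dvd f - g"
  then obtain e where e: "2 dvd f - F_poly m e" by (auto simp: low_degree_def)
  have "g - F_poly m e = (f - F_poly m e) - (f - g)"
    by simp
  then show "low_degree m g" unfolding low_degree_def using dvd_diff[OF e fg] by metis
qed

lemma low_degree_add: "low_degree m f \<Longrightarrow> low_degree m g \<Longrightarrow> low_degree m (f + g)"
proof -
  assume "low_degree m f" "low_degree m g"
  then obtain d e where "2 dvd f - F_poly m d"
      "2 dvd g - F_poly m e"
    by (auto simp: low_degree_def)
  from dvd_add[OF this]
  have "2 dvd (f + g) - (\<Sum>l<m. fps_const (d l + e l) * modF ^ l)"
    by (simp add: sum.distrib distrib_right algebra_simps flip: fps_const_add)
  then show "low_degree m (f + g)"
    unfolding low_degree_def by (rule exI[where x = "\<lambda>l. d l + e l"])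
qed

lemma low_degree_scale: "low_degree m f \<Longrightarrow> low_degree m (fps_const c * f)"
proof -
  assume "low_degree m f"
  then obtain e where e: "2 dvd f - F_poly m e" by (auto simp: low_degree_def)
  have "fps_const c * f - (\<Sum>l<m. fps_const (c * e l) * modF ^ l) =
      fps_const c * (f - F_poly m e)"
    by (simp add: right_diff_distrib sum_distrib_left mult.assoc flip: fps_const_mult)
  then have "2 dvd fps_const c * f - (\<Sum>l<m. fps_const (c * e l) * modF ^ l)"
    using e by (simp only: dvd_mult)
  then show "low_degree m (fps_const c * f)"
    unfolding low_degree_def by (rule exI[where x = "\<lambda>l. c * e l"])
qed

lemma low_degree_mono:
  assumes "low_degree m f" "m \<le> n"
  shows "low_degree n f"
proof -
  obtain e where e: "2 dvd f - F_poly m e"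
    using assms by (auto simp: low_degree_def)
  have "F_poly m e = (\<Sum>l<n. fps_const (if l < m then e l else 0) * modF ^ l)"
    by (rule sum.mono_neutral_cong_left) (use assms(2) in auto)
  then show ?thesis using e unfolding low_degree_def by (intro exI[of _ "\<lambda>l. if l < m then e l else 0"]) simp
qed

lemma low_degree_sum: "(\<And>i. i \<in> I \<Longrightarrow> low_degree m (f i)) \<Longrightarrow> low_degree m (sum f I)"
proof (induction I rule: infinite_finite_induct)
  case (insert x I)
  then show ?case by (simp add: low_degree_add)
qed (auto simp: low_degree_def intro!: exI[of _ "\<lambda>_. 0"])

lemma theta_comb_cong: "2 dvd theta_comb j c - (\<Sum>l\<le>j. fps_const (c l) * modF ^ l)"
proof -
  have "theta_comb j c - (\<Sum>l\<le>j. fps_const (c l) * modF ^ l) =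
     (\<Sum>l\<le>j. fps_const (c l) * modF ^ l * (modA ^ (j - l) - 1))"
    unfolding theta_comb_def sum_subtractf[symmetric]
    by (intro sum.cong) (auto simp: algebra_simps)
  also have "2 dvd \<dots>" by (intro dvd_sum dvd_mult dvd_modA_power_minus_1)
  finally show ?thesis .
qed

text \<open>Linear independence of the powers of \<open>modF\<close> modulo 2, read off from their
  triangular shape \<open>modF^l = q^l + ...\<close>.\<close>

lemma even_coeffs:
  assumes "2 dvd F_poly n e" "l < n"
  shows "even (e l)"
  using assms(2)
proof (induction l rule: less_induct)
  case (less l)
  have "fps_const 2 dvd F_poly n e"
    using assms(1) by (simp add: numeral_fps_const)
  then have "even (fps_nth (F_poly n e) l)"
    unfolding fps_const_dvd_iff by blast
  also have "fps_nth (F_poly n e) l =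
      (\<Sum>i<n. e i * fps_nth (modF ^ i) l)"
    by (simp add: fps_sum_nth)
  also have "\<dots> = e l * fps_nth (modF ^ l) l + (\<Sum>i\<in>{..<n} - {l}. e i * fps_nth (modF ^ i) l)"
    using less.prems by (subst sum.remove[of _ l]) auto
  finally have "even (e l + (\<Sum>i\<in>{..<n} - {l}. e i * fps_nth (modF ^ i) l))"
    by (simp add: modF_power_nth)
  moreover have "even (\<Sum>i\<in>{..<n} - {l}. e i * fps_nth (modF ^ i) l)"
  proof (rule dvd_sum)
    fix i assume "i \<in> {..<n} - {l}"
    then consider "i < l" "i < n" | "l < i" by fastforce
    then show "even (e i * fps_nth (modF ^ i) l)"
      by cases (use less.IH in \<open>auto simp: modF_power_nth\<close>)
  qed
  ultimately show ?case by simp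
qed

text \<open>Modulo 2 the combination is \<open>\<Sum>l\<le>j. c l * modF^l\<close>, so independence
  forces the coefficients beyond the degree to be even. For \<open>m = 0\<close> a factor 2 can be
  taken out of the whole combination.\<close>

lemma low_degree_theta_comb_even:
  assumes "low_degree m (theta_comb j c)" "m \<le> l" "l \<le> j"
  shows "even (c l)"
proof -
  obtain e where e: "2 dvd theta_comb j c - F_poly m e"
    using assms(1) by (auto simp: low_degree_def)
  define e' where "e' l = (if l < m then e l else 0)" for l
  have "F_poly m e = F_poly (Suc j) e'"
    by (rule sum.mono_neutral_cong_left) (use assms in \<open>auto simp: e'_def\<close>)
  then have "2 dvd theta_comb j c - F_poly (Suc j) e'"
    using e by (simp only:)
  from dvd_diff[OF this theta_comb_cong[of j c]]
  have "2 dvd (\<Sum>l\<le>j. fps_const (c l) * modF ^ l) - (\<Sum>l\<le>j. fps_const (e' l) * modF ^ l)"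
    unfolding lessThan_Suc_atMost by simp
  also have "(\<Sum>l\<le>j. fps_const (c l) * modF ^ l) - (\<Sum>l\<le>j. fps_const (e' l) * modF ^ l) =
      (\<Sum>l<Suc j. fps_const (c l - e' l) * modF ^ l)"
    unfolding lessThan_Suc_atMost
    by (simp add: sum_subtractf left_diff_distrib flip: fps_const_sub)
  finally have "2 dvd (\<Sum>l<Suc j. fps_const (c l - e' l) * modF ^ l)" .
  then have "even (c l - e' l)" by (rule even_coeffs) (use assms in auto)
  then show ?thesis using assms by (simp add: e'_def)
qed

lemma hecke_add: "hecke j p (f + g) = hecke j p f + hecke j p g"
  by (simp add: fps_eq_iff hecke_nth algebra_simps)

lemma hecke_diff: "hecke j p (f - g) = hecke j p f - hecke j p g"
  by (simp add: fps_eq_iff hecke_nth algebra_simps)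

lemma hecke_scale: "hecke j p (fps_const c * f) = fps_const c * hecke j p f"
  by (simp add: fps_eq_iff hecke_nth algebra_simps)

lemma hecke_zero [simp]: "hecke j p 0 = 0"
  by (simp add: fps_eq_iff hecke_nth)

lemma hecke_sum: "hecke j p (sum f I) = (\<Sum>i\<in>I. hecke j p (f i))"
  by (induction I rule: infinite_finite_induct) (auto simp: hecke_add)

lemma hecke_dvd:
  fixes f :: "int fps"
  assumes "fps_const m dvd f"
  shows "fps_const m dvd hecke j p f"
proof -
  obtain g where "f = fps_const m * g" using assms by blast
  then show ?thesis by (simp add: hecke_scale)
qed

lemma hecke_cong_2:
  fixes f g :: "int fps"
  assumes "2 dvd f - g"
  shows "2 dvd hecke j p f - hecke j p g"
  using hecke_dvd[of 2 "f - g" j p] assms by (simp add: hecke_diff numeral_fps_const)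

lemma hecke_weight_cong_2:
  fixes f :: "int fps"
  assumes "odd p"
  shows "2 dvd hecke i p f - hecke j p f"
proof -
  have "fps_const 2 dvd hecke i p f - hecke j p f"
    unfolding fps_const_dvd_iff using assms by (auto simp: hecke_nth)
  then show ?thesis by (simp add: numeral_fps_const)
qed

text \<open>Modulo 2 the operator does not see the weight, so the smallest weight may be used.\<close>
lemma hecke_modF_power:
  assumes p: "prime p" "odd p"
  shows "low_degree i (hecke j p (modF ^ i))"
proof (cases "i = 0")
  case True
  \<comment> \<open>Only the constant coefficient of this image is nonzero; it is
    \<open>1 + p^(2 j - 1)\<close>, even for every odd \<open>p\<close> and also for the truncated
    exponent 0.\<close>
  have "fps_const 2 dvd hecke j p (1 :: int fps)"
    unfolding fps_const_dvd_iff using p prime_gt_0_nat[OF p(1)] by (auto simp: hecke_nth)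
  then show ?thesis using True by (auto simp: low_degree_def numeral_fps_const)
next
  case False
  then have i: "i > 0" by simp
  have Fi: "modF ^ i = theta_comb i (\<lambda>l. if l = i then 1 else 0)"
  proof -
    have "theta_comb i (\<lambda>l. if l = i then 1 else 0) = (\<Sum>l\<le>i. if l = i then modF ^ i else 0)"
      unfolding theta_comb_def by (intro sum.cong) auto
    then show ?thesis by simp
  qed
  then obtain c where c: "hecke i p (modF ^ i) = theta_comb i c"
    using hecke_theta_comb[OF i p] by metis
  have F: "cA - cB = fps_const 16 * cfps modF" by (simp add: cA_diff_cB numeral_fps_const)
  \<comment> \<open>Passing from \<open>modF\<close> to \<open>cA - cB\<close> multiplies the
    coefficient of index \<open>l\<close> by \<open>16^(i - l)\<close>; the top one is
    unchanged.\<close>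
  have "hecke i p ((cA - cB) ^ i) = fps_const (16 ^ i) * cfps (hecke i p (modF ^ i))"
    by (simp only: F power_mult_distrib fps_const_power hecke_scale hecke_of_ints[symmetric] of_ints_power)
  also have "\<dots> = (\<Sum>l\<le>i. fps_const (16 ^ (i - l) * of_int (c l)) * (cA ^ (i - l) * (cA - cB) ^ l))"
    unfolding c theta_comb_def of_ints_sum sum_distrib_left
  proof (intro sum.cong refl)
    fix l assume "l \<in> {..i}"
    then have "(16 :: complex) ^ i = 16 ^ (i - l) * 16 ^ l" by (simp flip: power_add)
    then show "fps_const (16 ^ i) * cfps (fps_const (c l) * (modA ^ (i - l) * modF ^ l)) =
        fps_const (16 ^ (i - l) * of_int (c l)) * (cA ^ (i - l) * (cA - cB) ^ l)"
      unfolding F by (simp add: cA_def[symmetric] power_mult_distrib fps_const_power mult_ac flip: fps_const_mult)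
  qed
  finally have "16 ^ (i - i) * of_int (c i) = 1 + (of_nat p :: complex) ^ (2 * i - 1)"
    by (rule hecke_top_coefficient[OF i p])
  then have "of_int (c i) = (of_int (1 + int p ^ (2 * i - 1)) :: complex)" by simp
  then have "c i = 1 + int p ^ (2 * i - 1)" by (simp only: of_int_eq_iff)
  then have ci: "even (c i)" using p by simp
  have "low_degree i (theta_comb i c)"
  proof -
    have "(\<Sum>l\<le>i. fps_const (c l) * modF ^ l) = F_poly i c + fps_const (c i) * modF ^ i"
      by (simp flip: lessThan_Suc_atMost)
    moreover have "2 dvd fps_const (c i) * modF ^ i"
      using ci by (auto simp: numeral_fps_const simp flip: fps_const_mult)
    ultimately have eq: "theta_comb i c - F_poly i c =
        (theta_comb i c - (\<Sum>l\<le>i. fps_const (c l) * modF ^ l)) + fps_const (c i) * modF ^ i"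
      and 2: "2 dvd fps_const (c i) * modF ^ i"
      by (auto simp: algebra_simps)
    show ?thesis unfolding low_degree_def
      by (rule exI[where x = c]) (simp only: eq dvd_add[OF theta_comb_cong 2])
  qed
  then have "low_degree i (hecke i p (modF ^ i))" by (simp add: c)
  then show ?thesis by (rule low_degree_cong) (rule hecke_weight_cong_2[OF p(2)])
qed

lemma hecke_low_degree:
  assumes "low_degree (Suc m) f" and p: "prime p" "odd p"
  shows "low_degree m (hecke j p f)"
proof -
  obtain e where e: "2 dvd f - F_poly (Suc m) e"
    using assms(1) unfolding low_degree_def by blast
  have "low_degree m (hecke j p (F_poly (Suc m) e))"
    unfolding hecke_sum hecke_scale
    by (intro low_degree_sum low_degree_scale low_degree_mono[OF hecke_modF_power[OF p]]) auto
  moreover have "2 dvd hecke j p (F_poly (Suc m) e) - hecke j p f"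
    using hecke_cong_2[OF e, of j p] by (metis dvd_minus_iff minus_diff_eq)
  ultimately show ?thesis by (rule low_degree_cong)
qed

section \<open>Products of Hecke operators\<close>

lemma theta_comb_scale: "theta_comb j (\<lambda>l. m * c l) = fps_const m * theta_comb j c"
  by (simp add: theta_comb_def sum_distrib_left mult.assoc flip: fps_const_mult)

text \<open>Each operator keeps the lattice and removes one degree modulo 2, so \<open>Suc j\<close>
  of them leave nothing.\<close>

lemma heckes_theta_comb:
  assumes "j > 0" "\<And>p. p \<in> set ps \<Longrightarrow> prime p \<and> odd p" "length ps \<le> Suc j"
  shows "\<exists>c'. foldr (hecke j) ps (theta_comb j c) = theta_comb j c' \<and>
     low_degree (Suc j - length ps) (theta_comb j c')"
  using assms(2,3)
proof (induction ps)
  case Nil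
  have "low_degree (Suc j) (theta_comb j c)"
    using theta_comb_cong unfolding low_degree_def lessThan_Suc_atMost by blast
  then show ?case by auto
next
  case (Cons p ps)
  then obtain c1 where c1: "foldr (hecke j) ps (theta_comb j c) = theta_comb j c1"
     "low_degree (Suc j - length ps) (theta_comb j c1)" by auto
  have p: "prime p" "odd p" using Cons.prems by auto
  obtain c2 where c2: "hecke j p (theta_comb j c1) = theta_comb j c2"
    using hecke_theta_comb[OF assms(1) p] by blast
  have "Suc j - length ps = Suc (Suc j - length (p # ps))" using Cons.prems by auto
  then have "low_degree (Suc j - length (p # ps)) (hecke j p (theta_comb j c1))"
    using c1(2) by (intro hecke_low_degree p) simp
  then show ?case using c1(1) c2 by auto
qed

text \<open>The list is cut into blocks of length \<open>Suc j\<close>. Each block yields one factor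
  2, and by linearity the factors already gained pass through the other operators.\<close>

lemma heckes_nilpotent:
  assumes "j > 0" "\<And>p. p \<in> set ps \<Longrightarrow> prime p \<and> odd p" "length ps = k * Suc j"
  shows "\<exists>c'. foldr (hecke j) ps (theta_comb j c) = fps_const (2 ^ k) * theta_comb j c'"
  using assms(2,3)
proof (induction k arbitrary: ps)
  case 0
  then show ?case by auto
next
  case (Suc k)
  define qs where "qs = take (Suc j) ps"
  define rs where "rs = drop (Suc j) ps"
  have ps: "ps = qs @ rs" by (simp add: qs_def rs_def)
  have len: "length qs = Suc j" "length rs = k * Suc j" using Suc.prems(2) by (simp_all add: qs_def rs_def)
  obtain c1 where c1: "foldr (hecke j) rs (theta_comb j c) = fps_const (2 ^ k) * theta_comb j c1"
    using Suc.IH[of rs] Suc.prems(1) len(2) by (auto simp: ps)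
  obtain c2 where c2: "foldr (hecke j) qs (theta_comb j c1) = theta_comb j c2"
     "low_degree (Suc j - length qs) (theta_comb j c2)"
    using heckes_theta_comb[OF assms(1), of qs c1] Suc.prems(1) len(1) by (auto simp: ps)
  have even: "even (c2 l)" if "l \<le> j" for l
    using low_degree_theta_comb_even[OF c2(2) _ that] len(1) by simp
  have "theta_comb j c2 = theta_comb j (\<lambda>l. 2 * (c2 l div 2))"
    unfolding theta_comb_def by (intro sum.cong) (use even in auto)
  then have c3: "theta_comb j c2 = fps_const 2 * theta_comb j (\<lambda>l. c2 l div 2)"
    by (simp only: theta_comb_scale)
  have scale: "foldr (hecke j) xs (fps_const m * f) = fps_const m * foldr (hecke j) xs f" for xs m and f :: "int fps"
    by (induction xs) (auto simp: hecke_scale)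
  have "foldr (hecke j) ps (theta_comb j c) = fps_const (2 ^ k) * (fps_const 2 * theta_comb j (\<lambda>l. c2 l div 2))"
    by (simp add: ps c1 scale c2(1) c3)
  also have "\<dots> = fps_const (2 ^ Suc k) * theta_comb j (\<lambda>l. c2 l div 2)"
    by (simp add: mult.assoc[symmetric] mult.commute)
  finally show ?case by blast
qed

text \<open>For \<open>p\<close> not dividing \<open>n\<close> the \<open>V\<close>-term vanishes
  and \<open>T_p\<close> merely reads the coefficient at \<open>p * n\<close>. Distinctness keeps
  the remaining primes coprime to the growing index.\<close>

lemma heckes_nth:
  assumes "distinct ps" "\<And>p. p \<in> set ps \<Longrightarrow> prime p" "\<And>p. p \<in> set ps \<Longrightarrow> \<not> p dvd n"
  shows "fps_nth (foldr (hecke j) ps f) n = fps_nth f (prod_list ps * n)"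
  using assms
proof (induction ps arbitrary: n)
  case (Cons p ps)
  have "\<not> q dvd p * n" if "q \<in> set ps" for q
  proof -
    have "prime q" "prime p" "q \<noteq> p" "\<not> q dvd n" using Cons.prems that by auto
    then show ?thesis using prime_dvd_mult_iff[of q p n] primes_dvd_imp_eq[of q p] by blast
  qed
  then have "fps_nth (foldr (hecke j) ps f) (p * n) = fps_nth f (prod_list ps * (p * n))"
    using Cons by auto
  moreover have "\<not> p dvd n" using Cons.prems by simp
  ultimately show ?case by (simp add: hecke_nth mult_ac)
qed simp

lemma exact_primes_factor:
  assumes "finite S" "\<And>p. p \<in> S \<Longrightarrow> prime p" "\<And>p. p \<in> S \<Longrightarrow> exact_dvd p n"
  shows "\<exists>m. n = \<Prod>S * m \<and> (\<forall>p\<in>S. \<not> p dvd m)"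
  using assms
proof (induction S rule: finite_induct)
  case (insert q S)
  then obtain m where m: "n = \<Prod>S * m" "\<forall>p\<in>S. \<not> p dvd m" by auto
  have q: "prime q" "q dvd n" "\<not> q\<^sup>2 dvd n" using insert.prems by (auto simp: exact_dvd_def)
  have "\<not> q dvd \<Prod>S"
  proof
    assume "q dvd \<Prod>S"
    then obtain p where "p \<in> S" "q dvd p" using prime_dvd_prod_iff[OF insert.hyps(1) q(1)] by auto
    then show False using primes_dvd_imp_eq[OF q(1), of p] insert by auto
  qed
  then obtain m' where m': "m = q * m'" using q m(1) prime_dvd_mult_iff[OF q(1)] by blast
  have "\<not> q dvd m'"
  proof
    assume "q dvd m'"
    then have "q * q dvd m" unfolding m' by (intro mult_dvd_mono) auto
    then show False using q(3) m(1) by (simp add: power2_eq_square)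
  qed
  moreover have "\<forall>p\<in>S. \<not> p dvd m'" using m(2) by (auto simp: m')
  moreover have "n = \<Prod>(insert q S) * m'" using insert.hyps by (simp add: m(1) m' mult_ac)
  ultimately show ?case by blast
qed auto

lemma theta_comb_nth_dvd:
  assumes "j > 0" "finite S" "card S = k * Suc j"
    and S: "\<And>p. p \<in> S \<Longrightarrow> prime p \<and> odd p \<and> exact_dvd p n"
  shows "2 ^ k dvd fps_nth (theta_comb j c) n"
proof -
  obtain m where m: "n = \<Prod>S * m" "\<forall>p\<in>S. \<not> p dvd m"
    using exact_primes_factor[OF assms(2)] S by blast
  obtain ps where ps: "set ps = S" "distinct ps" using finite_distinct_list[OF assms(2)] by blast
  have "prod_list ps = \<Prod>S" using ps by (metis prod.distinct_set_conv_list list.map_ident)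
  then have "fps_nth (theta_comb j c) n = fps_nth (foldr (hecke j) ps (theta_comb j c)) m"
    using heckes_nth[OF ps(2), of m j "theta_comb j c"] S m ps(1) by simp
  moreover have "length ps = k * Suc j" using ps assms(3) distinct_card by metis
  then obtain c' where "foldr (hecke j) ps (theta_comb j c) = fps_const (2 ^ k) * theta_comb j c'"
    using heckes_nilpotent[OF assms(1), of ps k c] S ps(1) by blast
  ultimately show ?thesis by simp
qed

section \<open>Overcubic partition pairs\<close>

lemma qpochhammer_LIMSEQ:
  assumes "norm q < 1"
  shows "(\<lambda>N. \<Prod>i<N. 1 - a * q ^ i) \<longlonglongrightarrow> qpochhammer_inf a q"
proof -
  have "summable (\<lambda>n. norm (1 - a * q ^ n - 1))"
    using assms by (auto simp: norm_mult norm_power intro!: summable_mult summable_geometric)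
  then have "convergent_prod (\<lambda>n. 1 - a * q ^ n)"
    by (intro abs_convergent_prod_imp_convergent_prod summable_imp_abs_convergent_prod)
  then have "(\<lambda>N. \<Prod>n\<le>N. 1 - a * q ^ n) \<longlonglongrightarrow> qpochhammer_inf a q"
    unfolding qpochhammer_inf_def by (rule convergent_prod_LIMSEQ)
  then show ?thesis
    by (subst filterlim_sequentially_Suc[symmetric]) (simp only: lessThan_Suc_atMost)
qed

lemma eval_theta_neg_sums:
  assumes "norm q < 1"
  shows "(\<lambda>m. 2 * (-1) ^ Suc m * q ^ (Suc m)\<^sup>2) sums (eval_fps (cfps phi) (- q) - 1)"
proof -
  let ?f = "\<lambda>m. of_int (fps_nth phi (m\<^sup>2)) * (- q) ^ (m\<^sup>2)"
  have sm: "strict_mono (\<lambda>m::nat. m\<^sup>2)" by (auto simp: strict_mono_def power_strict_mono)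
  have "(\<lambda>n. fps_nth (cfps phi) n * (- q) ^ n) sums eval_fps (cfps phi) (- q)"
    by (rule sums_eval_fps) (rule ereal_less_conv_radius[OF conv_disc_theta(2)], use assms in simp)
  then have "?f sums eval_fps (cfps phi) (- q)"
    by (subst (asm) sums_mono_reindex[OF sm, symmetric])
       (auto simp: phi_def card_square_roots is_nth_power_def)
  then have "(\<lambda>m. ?f (Suc m)) sums (eval_fps (cfps phi) (- q) - ?f 0)"
    using sums_Suc_iff[of ?f "eval_fps (cfps phi) (- q) - ?f 0"] by simp
  moreover have "?f (Suc m) = 2 * (-1) ^ Suc m * q ^ (Suc m)\<^sup>2" for m
  proof -
    have "(- q) ^ (Suc m)\<^sup>2 = (-1) ^ (Suc m)\<^sup>2 * q ^ (Suc m)\<^sup>2" by (rule power_minus)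
    also have "(-1 :: complex) ^ (Suc m)\<^sup>2 = (-1) ^ Suc m"
      by (simp only: minus_one_power_iff even_power) simp
    finally show ?thesis
      by (simp add: phi_def card_square_roots is_nth_power_nth_power del: power_Suc)
  qed
  moreover have "?f 0 = 1" by (simp add: phi_def card_square_roots)
  ultimately show ?thesis by simp
qed

definition qratio :: "complex \<Rightarrow> nat \<Rightarrow> complex" where
  "qratio q n = (\<Prod>i<n. (1 - q ^ Suc i) / (1 + q ^ Suc i))"

text \<open>In Pochhammer notation \<open>(-1; q)_n / (q; q)_n\<close>. For positive
  \<open>n\<close> its factor 2 at \<open>i = 0\<close> becomes the coefficient 2 of the theta
  series.\<close>

definition qcoeff :: "complex \<Rightarrow> nat \<Rightarrow> complex" where
  "qcoeff q n = (\<Prod>i<n. (1 + q ^ i) / (1 - q ^ Suc i))"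

lemma one_plus_minus_power_nonzero:
  fixes q :: complex
  assumes "norm q < 1"
  shows "1 - q ^ Suc n \<noteq> 0" "1 + q ^ Suc n \<noteq> 0"
proof -
  have "norm (q ^ Suc n) < 1" using assms unfolding norm_power by (intro power_less_one_iff[THEN iffD2]) auto
  then have "q ^ Suc n \<noteq> 1" "q ^ Suc n \<noteq> - 1" by force+
  then show "1 - q ^ Suc n \<noteq> 0" "1 + q ^ Suc n \<noteq> 0" by (auto simp: add_eq_0_iff simp del: power_Suc)
qed

lemma qratio_qcoeff:
  assumes "norm q < 1"
  shows "qratio q n * (qcoeff q n * (1 + q ^ n)) = 2"
proof (induction n)
  case (Suc n)
  let ?X = "1 - q ^ Suc n" and ?Y = "1 + q ^ Suc n"
  have "qratio q (Suc n) * (qcoeff q (Suc n) * ?Y) =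
      qratio q n * (qcoeff q n * (1 + q ^ n)) * ((?X / ?X) * (?Y / ?Y))"
    by (simp add: qratio_def qcoeff_def mult_ac del: power_Suc)
  then show ?case using Suc one_plus_minus_power_nonzero[OF assms, of n] by (simp del: power_Suc)
qed (simp add: qratio_def qcoeff_def)

text \<open>The coefficients are chosen so that the difference of consecutive partial sums telescopes.\<close>
lemma finite_gauss_identity:
  assumes q: "norm q < 1"
  shows "qratio q n * (\<Sum>j\<le>n. (-1) ^ j * qcoeff q j * q ^ (Suc n * j)) = 1 + (\<Sum>m<n. 2 * (-1) ^ Suc m * q ^ (Suc m)\<^sup>2)"
proof (induction n)
  case 0
  show ?case by (simp add: qratio_def qcoeff_def)
next
  case (Suc n)
  define N where "N = Suc n"
  define e where "e = qcoeff q"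
  define T where "T k m = (\<Sum>j\<le>m. (-1) ^ j * e j * q ^ (k * j))" for k m
  \<comment> \<open>The primitive for the telescoping: \<open>step\<close> rewrites
    \<open>e (Suc j) * (1 - q^(Suc j))\<close>, so that the weighted difference of the two sums is
    \<open>h (Suc j) - h j\<close> termwise, and \<open>h 0 = 0\<close>.\<close>
  define h where "h j = (-1) ^ j * q ^ (N * j) * (e j * (1 - q ^ j))" for j
  note nz = one_plus_minus_power_nonzero[OF q]
  have step: "e (Suc j) * (1 - q ^ Suc j) = e j * (1 + q ^ j)" for j
    using nz(1)[of j] by (simp add: e_def qcoeff_def del: power_Suc)
  have "(-1) ^ j * e j * ((1 - q ^ N) * q ^ (Suc N * j) - (1 + q ^ N) * q ^ (N * j)) = h (Suc j) - h j" for j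
  proof -
    have "h (Suc j) = - ((-1) ^ j * q ^ (N * j) * q ^ N * (e j * (1 + q ^ j)))"
      unfolding h_def step by (simp add: power_add mult_ac)
    then show ?thesis by (simp add: h_def power_add algebra_simps)
  qed
  then have "(1 - q ^ N) * T (Suc N) N - (1 + q ^ N) * T N N = (\<Sum>j\<le>N. h (Suc j) - h j)"
    unfolding T_def sum_distrib_left sum_subtractf[symmetric]
    by (intro sum.cong refl) (simp add: algebra_simps)
  also have "\<dots> = h (Suc N)"
    using sum_telescope''[of 0 N "\<lambda>j. h j"] by (simp add: sum_lessThan_telescope flip: lessThan_Suc_atMost) (simp add: h_def)
  also have "\<dots> = - ((-1) ^ N * q ^ (N * N) * q ^ N * (e N * (1 + q ^ N)))"
    unfolding h_def step by (simp add: power_add mult_ac)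
  also have "T N N = T N n + (-1) ^ N * e N * q ^ (N * N)"
    by (simp add: T_def N_def)
  finally have rec: "(1 - q ^ N) * T (Suc N) N =
      (1 + q ^ N) * (T N n + (-1) ^ N * q ^ (N * N) * (e N * (1 - q ^ N)))"
    by (simp add: algebra_simps)
  have "qratio q N * T (Suc N) N = qratio q n * ((1 - q ^ N) * T (Suc N) N) / (1 + q ^ N)"
    by (simp add: qratio_def N_def)
  also have "\<dots> = qratio q n * T N n + (-1) ^ N * q ^ (N * N) * (qratio q n * (e n * (1 + q ^ n)))"
  proof -
    have stepN: "e N * (1 - q ^ N) = e n * (1 + q ^ n)" unfolding N_def by (rule step)
    have cancel: "r * ((1 + q ^ N) * x) / (1 + q ^ N) = r * x" for r x
      using nz(2)[of n] by (simp add: N_def del: power_Suc)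
    then show ?thesis unfolding rec stepN cancel by (simp add: distrib_left mult_ac)
  qed
  also have "qratio q n * (e n * (1 + q ^ n)) = 2" unfolding e_def by (rule qratio_qcoeff[OF q])
  also have "qratio q n * T N n = 1 + (\<Sum>m<n. 2 * (-1) ^ Suc m * q ^ (Suc m)\<^sup>2)"
    unfolding T_def e_def N_def by (rule Suc)
  finally show ?case by (simp add: T_def e_def N_def power2_eq_square del: power_Suc) 
qed

text \<open>In the finite identity the term of index \<open>j\<close> carries
  \<open>q^(Suc n * j)\<close>. The factors \<open>qcoeff\<close> converge and are therefore
  bounded, so the sum tends to its term 1 at \<open>j = 0\<close>, and only the ratio of products
  remains on the left.\<close>

lemma gauss_theta_product:
  assumes q: "norm q < 1"
  shows "eval_fps (cfps phi) (- q) * qpochhammer_inf (- q) q = qpochhammer_inf q q"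
proof -
  let ?a = "qpochhammer_inf q q" and ?b = "qpochhammer_inf (- q) q"
  have nz: "?a \<noteq> 0" "?b \<noteq> 0"
    using qpochhammer_nonzero[of 1 1 q] qpochhammer_nonzero[of "-1" 1 q] q by simp_all
  have "(\<lambda>N. (\<Prod>i<N. 1 - q * q ^ i) / (\<Prod>i<N. 1 - (- q) * q ^ i)) \<longlonglongrightarrow> ?a / ?b"
    by (intro tendsto_divide qpochhammer_LIMSEQ q nz)
  then have P: "qratio q \<longlonglongrightarrow> ?a / ?b"
    by (simp add: qratio_def[abs_def] prod_dividef)
  have "(\<lambda>n. qratio q n * (1 + q ^ n)) \<longlonglongrightarrow> ?a / ?b * (1 + 0)"
    by (intro tendsto_intros P LIMSEQ_power_zero q)
  then have "(\<lambda>n. 2 / (qratio q n * (1 + q ^ n))) \<longlonglongrightarrow> 2 / (?a / ?b * (1 + 0))"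
    by (intro tendsto_divide tendsto_const) (use nz in auto)
  moreover have "2 / (qratio q n * (1 + q ^ n)) = qcoeff q n" for n
    using qratio_qcoeff[OF q, of n] by (auto simp: divide_eq_eq mult_ac)
  ultimately have "convergent (qcoeff q)" by (auto intro: convergentI)
  then obtain K where K: "\<And>n. norm (qcoeff q n) \<le> K"
    using convergent_imp_Bseq[of "qcoeff q"] by (auto simp: Bseq_def)
  have K0: "K \<ge> 0" using order_trans[OF norm_ge_zero K[of 0]] .
  let ?T = "\<lambda>n. \<Sum>j\<le>n. (-1) ^ j * qcoeff q j * q ^ (Suc n * j)"
  have "(\<lambda>n. ?T n - 1) \<longlonglongrightarrow> 0"
  proof (rule Lim_null_comparison[OF always_eventually])
    have "(\<lambda>n. of_nat n * norm q ^ n) \<longlonglongrightarrow> 0" by (rule powser_times_n_limit_0) (use q in simp)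
    then show "(\<lambda>n. K * (of_nat n * norm q ^ n)) \<longlonglongrightarrow> 0" by (rule tendsto_mult_right_zero)
    show "\<forall>n. norm (?T n - 1) \<le> K * (of_nat n * norm q ^ n)"
    proof
      fix n :: nat
      have "{..n} = insert 0 {1..n}" by auto
      then have "?T n - 1 = (\<Sum>j\<in>{1..n}. (-1) ^ j * qcoeff q j * q ^ (Suc n * j))"
        by (simp add: qcoeff_def)
      also have "norm \<dots> \<le> (\<Sum>j\<in>{1..n}. K * norm q ^ n)"
      proof (rule sum_norm_le)
        fix j assume j: "j \<in> {1..n}"
        have "n * 1 \<le> Suc n * j" using j by (intro mult_le_mono) auto
        then have "norm q ^ (Suc n * j) \<le> norm q ^ n" using q by (intro power_decreasing) auto
        then show "norm ((-1) ^ j * qcoeff q j * q ^ (Suc n * j)) \<le> K * norm q ^ n"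
          using K[of j] K0 unfolding norm_mult norm_power
          by (intro mult_mono) auto
      qed
      finally show "norm (?T n - 1) \<le> K * (of_nat n * norm q ^ n)" by (simp add: mult_ac)
    qed
  qed
  then have "?T \<longlonglongrightarrow> 1" by (simp only: LIM_zero_iff)
  from tendsto_mult[OF P this]
  have "(\<lambda>n. 1 + (\<Sum>m<n. 2 * (-1) ^ Suc m * q ^ (Suc m)\<^sup>2)) \<longlonglongrightarrow> ?a / ?b"
    by (simp only: finite_gauss_identity[OF q] mult_1_right)
  moreover have "(\<lambda>n. 1 + (\<Sum>m<n. 2 * (-1) ^ Suc m * q ^ (Suc m)\<^sup>2)) \<longlonglongrightarrow>
      1 + (eval_fps (cfps phi) (- q) - 1)"
    using eval_theta_neg_sums[OF q] by (intro tendsto_intros) (simp add: sums_def)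
  ultimately have "?a / ?b = 1 + (eval_fps (cfps phi) (- q) - 1)" by (rule LIMSEQ_unique)
  then show ?thesis using nz by (simp add: field_simps)
qed

section \<open>The generating function as a theta quotient\<close>

definition overcubic_fps :: "int fps" where
  "overcubic_fps = Abs_fps overcubic_pair"

lemma eval_overcubic:
  assumes "norm q < 1"
  shows "eval_fps (cfps overcubic_fps) q = overcubic_pair_gf q"
  using overcubic_pair_sums[OF assms] by (simp add: overcubic_fps_def eval_fps_def sums_iff)

lemma conv_disc_overcubic: "conv_disc (cfps overcubic_fps)"
  unfolding fps_conv_radius_def
proof (rule conv_radius_geI_ex')
  fix r :: real assume "0 < r" "ereal r < 1"
  then show "summable (\<lambda>n. fps_nth (cfps overcubic_fps) n * of_real r ^ n)"
    using overcubic_pair_sums[of "of_real r"] by (simp add: overcubic_fps_def sums_iff)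
qed

lemma overcubic_theta_eq: "overcubic_fps * fps_alt phi ^ 3 * phi = 1"
proof -
  let ?t = "cfps phi"
  let ?G = "cfps overcubic_fps * fps_alt ?t ^ 3 * ?t"
  have cv: "conv_disc ?t" "conv_disc (fps_alt ?t)"
    using conv_disc_theta by simp_all
  note cvG = conv_disc_mult[OF conv_disc_mult[OF conv_disc_overcubic
      conv_disc_power[OF cv(2), of 3]] cv(1)]
  have eval: "eval_fps ?G q = 1" if q: "norm q < 1" "q \<noteq> 0" for q
  proof -
    have q2: "norm (q\<^sup>2) < 1" using q by (simp_all add: norm_power power_less_one_iff)
    note less = ereal_less_conv_radius
    define T where "T = eval_fps ?t"
    define a where "a = qpochhammer_inf q q"
    define b where "b = qpochhammer_inf (- q) q"
    define a2 where "a2 = qpochhammer_inf (q\<^sup>2) (q\<^sup>2)"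
    define b2 where "b2 = qpochhammer_inf (- (q\<^sup>2)) (q\<^sup>2)"
    have nz: "a \<noteq> 0" "b \<noteq> 0" "a2 \<noteq> 0" "b2 \<noteq> 0"
      using qpochhammer_nonzero[of 1 1 q] qpochhammer_nonzero[of "-1" 1 q]
        qpochhammer_nonzero[of 1 2 q] qpochhammer_nonzero[of "-1" 2 q] q
      by (simp_all add: a_def b_def a2_def b2_def)
    have g: "T (- q) * b = a" "T (- (q\<^sup>2)) * b2 = a2"
      unfolding T_def a_def b_def a2_def b2_def
      by (rule gauss_theta_product[OF q(1)]) (rule gauss_theta_product[OF q2])
    have id: "T q * T (- q) = (T (- (q\<^sup>2)))\<^sup>2"
      unfolding T_def by (rule eval_theta_identities(1)[OF q(1) conv_disc_theta(2)])
    have "eval_fps ?G q = overcubic_pair_gf q * T (- q) ^ 3 * T q"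
      using less[OF conv_disc_overcubic q(1)] less[OF cv(1) q(1)] less[OF cv(2) q(1)]
        less[OF conv_disc_power[OF cv(2), of 3] q(1)]
        less[OF conv_disc_mult[OF conv_disc_overcubic conv_disc_power[OF cv(2), of 3]] q(1)]
      by (simp only: eval_fps_mult eval_fps_power eval_fps_alt eval_overcubic[OF q(1)] T_def)
    also have "overcubic_pair_gf q = b\<^sup>2 * b2\<^sup>2 / (a\<^sup>2 * a2\<^sup>2)"
      by (simp add: overcubic_pair_gf_def a_def b_def a2_def b2_def)
    also have "b\<^sup>2 * b2\<^sup>2 / (a\<^sup>2 * a2\<^sup>2) * T (- q) ^ 3 * T q =
        b\<^sup>2 * b2\<^sup>2 / (a\<^sup>2 * a2\<^sup>2) * ((T (- q))\<^sup>2 * (T q * T (- q)))"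
      by (simp add: power3_eq_cube power2_eq_square mult_ac)
    also have "\<dots> = (T (- q) * b)\<^sup>2 * (T (- (q\<^sup>2)) * b2)\<^sup>2 / (a\<^sup>2 * a2\<^sup>2)"
      unfolding id by (simp add: power_mult_distrib mult_ac)
    also have "\<dots> = 1" unfolding g using nz by simp
    finally show ?thesis .
  qed
  have "?G = 1"
  proof (rule eval_fps_eqD)
    show "fps_conv_radius ?G > 0" using cvG by (rule less_le_trans[rotated]) simp
    have "isCont (eval_fps ?G) 0"
      by (intro continuous_eval_fps continuous_ident) (use ereal_less_conv_radius[OF cvG, of 0] in auto)
    then have "(eval_fps ?G \<longlongrightarrow> eval_fps ?G 0) (at 0)" by (simp add: isCont_def)
    moreover have near: "\<forall>\<^sub>F q in at (0::complex). norm q < 1 \<and> q \<noteq> 0"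
      unfolding eventually_at by (intro exI[of _ 1]) auto
    then have "\<forall>\<^sub>F q in at 0. eval_fps ?G q = 1" by eventually_elim (use eval in blast)
    then have "(eval_fps ?G \<longlongrightarrow> 1) (at 0)" by (rule tendsto_eventually)
    ultimately have 0: "eval_fps ?G 0 = 1" by (intro tendsto_unique[of "at (0::complex)"]) auto
    have "\<forall>\<^sub>F q in nhds (0::complex). q \<in> ball 0 1" by (intro eventually_nhds_in_open) auto
    then show "\<forall>\<^sub>F q in nhds 0. eval_fps ?G q = eval_fps 1 q"
      by eventually_elim (use eval 0 in \<open>metis dist_0_norm eval_fps_1 mem_ball\<close>)
  qed simp
  then have "cfps (overcubic_fps * fps_alt phi ^ 3 * phi) = cfps 1"
    by (simp del: of_ints_eq_iff)
  then show ?thesis by (simp only: of_ints_eq_iff)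
qed

section \<open>Integral forms and their quotients by powers of A\<close>

inductive int_form :: "nat \<Rightarrow> int fps \<Rightarrow> bool" where
  const: "int_form 0 (fps_const c)"
| mult_A: "int_form j f \<Longrightarrow> int_form (Suc j) (modA * f)"
| mult_F: "int_form j f \<Longrightarrow> int_form (Suc j) (modF * f)"
| add: "int_form j f \<Longrightarrow> int_form j g \<Longrightarrow> int_form j (f + g)"

lemma theta_comb_add: "theta_comb j c + theta_comb j d = theta_comb j (\<lambda>l. c l + d l)"
  by (simp add: theta_comb_def sum.distrib[symmetric] distrib_right flip: fps_const_add)

lemma modA_mult_theta_comb: "modA * theta_comb j c = theta_comb (Suc j) (c(Suc j := 0))"
  unfolding theta_comb_def sum_distrib_left
  by (simp add: Suc_diff_le mult_ac)

lemma modF_mult_theta_comb: "modF * theta_comb j c = theta_comb (Suc j) (\<lambda>l. case l of 0 \<Rightarrow> 0 | Suc l' \<Rightarrow> c l')"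
  unfolding theta_comb_def sum_distrib_left
  by (simp add: sum.atMost_Suc_shift mult_ac del: sum.atMost_Suc)

lemma int_form_theta_comb: "int_form j f \<Longrightarrow> \<exists>c. f = theta_comb j c"
proof (induction rule: int_form.induct)
  case (const c)
  have "fps_const c = theta_comb 0 (\<lambda>_. c)" by (simp add: theta_comb_def)
  then show ?case by blast
qed (use modA_mult_theta_comb modF_mult_theta_comb theta_comb_add in blast)+

lemma int_form_mult:
  assumes "int_form i f" "int_form j g"
  shows "int_form (i + j) (f * g)"
  using assms
proof (induction rule: int_form.induct)
  case (const c)
  from const.prems show ?case
  proof (induction rule: int_form.induct)
    case (const d)
    then show ?case using int_form.const[of "c * d"] by simp
  next
    case (mult_A j f)
    then show ?case using int_form.mult_A by (simp add: mult.left_commute)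
  next
    case (mult_F j f)
    then show ?case using int_form.mult_F by (simp add: mult.left_commute)
  next
    case (add j f g)
    then show ?case using int_form.add by (simp add: distrib_left)
  qed
next
  case (mult_A j f)
  then show ?case using int_form.mult_A by (simp add: mult.assoc)
next
  case (mult_F j f)
  then show ?case using int_form.mult_F by (simp add: mult.assoc)
next
  case (add j f g)
  then show ?case using int_form.add by (simp add: distrib_right)
qed

lemma int_form_modA_power: "int_form j f \<Longrightarrow> int_form (n + j) (modA ^ n * f)"
  by (induction n) (auto intro: int_form.mult_A simp: mult.assoc)

text \<open>Integral polynomials in \<open>modF / modA\<close>, expressed by clearing the
  denominator. The degree of the form equals the exponent of \<open>modA\<close>, so the quotient
  has weight 0.\<close>

definition form_ratio :: "int fps \<Rightarrow> bool" where
  "form_ratio f \<longleftrightarrow> (\<exists>j. int_form j (modA ^ j * f))"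

lemma form_ratio_const: "form_ratio (fps_const c)"
  unfolding form_ratio_def using int_form.const[of c] by (intro exI[of _ 0]) simp

lemma form_ratio_add: "form_ratio f \<Longrightarrow> form_ratio g \<Longrightarrow> form_ratio (f + g)"
proof -
  assume "form_ratio f" "form_ratio g"
  then obtain i j where "int_form i (modA ^ i * f)" "int_form j (modA ^ j * g)"
    unfolding form_ratio_def by blast
  then have "int_form (j + i) (modA ^ j * (modA ^ i * f) + modA ^ i * (modA ^ j * g))"
    using int_form_modA_power[of i "modA ^ i * f" j] int_form_modA_power[of j "modA ^ j * g" i]
    by (auto intro!: int_form.add simp: add.commute)
  then show "form_ratio (f + g)"
    unfolding form_ratio_def by (intro exI[of _ "j + i"]) (simp add: power_add algebra_simps)
qed

lemma form_ratio_mult: "form_ratio f \<Longrightarrow> form_ratio g \<Longrightarrow> form_ratio (f * g)"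
proof -
  assume "form_ratio f" "form_ratio g"
  then obtain i j where "int_form i (modA ^ i * f)" "int_form j (modA ^ j * g)"
    unfolding form_ratio_def by blast
  from int_form_mult[OF this] show "form_ratio (f * g)"
    unfolding form_ratio_def by (intro exI[of _ "i + j"]) (simp add: power_add mult_ac)
qed

lemma form_ratio_numeral: "form_ratio (numeral n)" "form_ratio 1"
  using form_ratio_const[of "numeral n"] form_ratio_const[of 1] by (simp_all add: numeral_fps_const)

lemma form_ratio_uminus: "form_ratio f \<Longrightarrow> form_ratio (- f)"
  using form_ratio_mult[OF form_ratio_const[of "-1"], of f] by (simp flip: fps_const_neg)

lemma form_ratio_diff: "form_ratio f \<Longrightarrow> form_ratio g \<Longrightarrow> form_ratio (f - g)"
  using form_ratio_add[OF _ form_ratio_uminus, of f g] by simp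

lemma form_ratio_power: "form_ratio f \<Longrightarrow> form_ratio (f ^ n)"
  by (induction n) (auto intro: form_ratio_mult form_ratio_numeral)

lemma form_ratio_sum: "(\<And>i. i \<in> I \<Longrightarrow> form_ratio (f i)) \<Longrightarrow> form_ratio (sum f I)"
  using form_ratio_const[of 0]
  by (induction I rule: infinite_finite_induct) (auto intro: form_ratio_add)

section \<open>Approximation of the generating function modulo powers of 2\<close>

lemma dvd_mult_cong:
  fixes m :: "'a::comm_ring_1"
  assumes "m dvd f - g" "m dvd f' - g'"
  shows "m dvd f * f' - g * g'"
proof -
  have "f * f' - g * g' = (f - g) * f' + g * (f' - g')" by (simp add: algebra_simps)
  then show ?thesis using assms by (metis dvd_add dvd_mult dvd_mult2)
qed

lemma dvd_power_cong:
  fixes m :: "'a::comm_ring_1"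
  assumes "m dvd f - g"
  shows "m dvd f ^ n - g ^ n"
  by (induction n) (use assms dvd_mult_cong in auto)

text \<open>Every squaring gains a factor 2: \<open>B^2 - 1 = (B - 1) * (B + 1)\<close>, and
  \<open>B + 1\<close> is even as well.\<close>

lemma power_two_power_cong_1:
  fixes A :: "'a::comm_ring_1"
  assumes "2 dvd A - 1"
  shows "2 ^ k dvd A ^ (2 ^ k) - 1"
proof (induction k)
  case (Suc k)
  let ?B = "A ^ (2 ^ k)"
  have "A ^ (2 ^ Suc k) - 1 = (?B - 1) * (?B + 1)"
    by (simp add: power_mult power2_eq_square algebra_simps)
  moreover have two: "2 dvd ?B + 1"
  proof -
    have "2 dvd ?B - 1 ^ (2 ^ k)" by (rule dvd_power_cong[OF assms])
    moreover have "?B + 1 = (?B - 1 ^ (2 ^ k)) + 2" by simp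
    ultimately show ?thesis by (metis dvd_add dvd_refl)
  qed
  ultimately show ?case using mult_dvd_mono[OF Suc two] by (simp add: mult.commute)
qed simp

text \<open>
  With \<open>w = theta_odd / phi\<close> and \<open>u = modF / modA\<close>, the identity
  \<open>(1 - 4 w)^4 = 1 - 16 u\<close> turns into a fixed-point equation for \<open>w\<close> that is contracting
  2-adically, so \<open>w\<close> is a polynomial in \<open>u\<close> modulo every power of 2.
\<close>
lemma fixed_point_form_ratio:
  fixes w u :: "int fps"
  assumes w: "w = u + 2 * (3 * w\<^sup>2 - 8 * w ^ 3 + 8 * w ^ 4)" and u: "form_ratio u"
  shows "\<exists>g. form_ratio g \<and> 2 ^ k dvd w - g"
proof (induction k)
  case 0
  then show ?case using form_ratio_const by auto
next
  case (Suc k)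
  then obtain g where g: "form_ratio g" "2 ^ k dvd w - g" by blast
  let ?P = "\<lambda>x :: int fps. 3 * x\<^sup>2 - 8 * x ^ 3 + 8 * x ^ 4"
  have "?P w - ?P g = 3 * (w\<^sup>2 - g\<^sup>2) - 8 * (w ^ 3 - g ^ 3) + 8 * (w ^ 4 - g ^ 4)"
    by (simp add: algebra_simps)
  then have "2 ^ k dvd ?P w - ?P g"
    by (simp only:) (intro dvd_add[OF dvd_diff[OF dvd_mult dvd_mult] dvd_mult] dvd_power_cong[OF g(2)])
  then have "2 ^ Suc k dvd 2 * (?P w - ?P g)" unfolding power_Suc by (rule mult_dvd_mono[OF dvd_refl])
  moreover have "w - (u + 2 * ?P g) = 2 * (?P w - ?P g)"
    using w by (simp add: algebra_simps)
  moreover have "form_ratio (u + 2 * ?P g)"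
    by (intro form_ratio_add form_ratio_mult form_ratio_diff form_ratio_power form_ratio_numeral u g(1))
  ultimately show ?case by metis
qed

lemma overcubic_cong_theta_comb:
  "\<exists>j>0. \<exists>c. 2 ^ k dvd overcubic_fps - theta_comb j c"
proof -
  \<comment> \<open>The theta quotient itself provides the inverse of \<open>phi\<close> with
    integer coefficients.\<close>
  define \<psi> where "\<psi> = overcubic_fps * fps_alt phi ^ 3"
  have \<psi>: "phi * \<psi> = 1" using overcubic_theta_eq by (simp add: \<psi>_def mult.commute)
  define w where "w = theta_odd * \<psi>"
  define u where "u = modF * \<psi> ^ 4"
  have Apsi: "modA * \<psi> ^ 4 = 1"
    using arg_cong[OF \<psi>, of "\<lambda>x. x ^ 4"] by (simp add: modA_def power_mult_distrib mult.commute)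
  have Ew: "theta_even * \<psi> = 1 - 2 * w"
  proof -
    have eq: "theta_even = phi - 2 * theta_odd" by (simp add: phi_decomp)
    show ?thesis unfolding eq left_diff_distrib w_def mult.assoc \<psi> ..
  qed
  have uw: "u = (1 - 2 * w) * w * ((1 - 2 * w)\<^sup>2 + 4 * w\<^sup>2)"
    unfolding u_def modF_def Ew[symmetric] unfolding w_def
    by (simp add: power2_eq_square power4_eq_xxxx algebra_simps)
  have fixpoint: "w = u + 2 * (3 * w\<^sup>2 - 8 * w ^ 3 + 8 * w ^ 4)"
    unfolding uw by (simp add: power2_eq_square power3_eq_cube power4_eq_xxxx algebra_simps)
  have u: "form_ratio u"
  proof -
    have "modA ^ 1 * u = modF * (modA * \<psi> ^ 4)" by (simp add: u_def mult_ac)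
    then have "modA ^ 1 * u = modF * fps_const 1" using Apsi by simp
    then show ?thesis unfolding form_ratio_def using int_form.mult_F[OF int_form.const[of 1]] by (metis One_nat_def)
  qed
  obtain g where g: "form_ratio g" "2 ^ k dvd w - g" using fixed_point_form_ratio[OF fixpoint u] by blast
  \<comment> \<open>Here \<open>1 - 4 * w\<close> is \<open>fps_alt phi\<close> divided by
    \<open>phi\<close>, the fourth root of \<open>1 - 16 * u\<close>.\<close>
  have b_eq: "overcubic_fps * modA * (1 - 16 * u) = 1 - 4 * w"
  proof -
    have alt: "fps_alt phi * \<psi> = 1 - 4 * w"
    proof -
      have eq: "fps_alt phi = phi - 4 * theta_odd"
        unfolding fps_alt_theta_decomp by (simp add: phi_decomp)
      show ?thesis unfolding eq left_diff_distrib w_def mult.assoc \<psi> ..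
    qed
    have "1 - 16 * u = (1 - 4 * w) ^ 4"
      unfolding uw by (simp add: power2_eq_square power4_eq_xxxx algebra_simps)
    also have "\<dots> = fps_alt phi ^ 4 * \<psi> ^ 4" by (simp add: alt[symmetric] power_mult_distrib)
    finally have "overcubic_fps * modA * (1 - 16 * u) =
        (overcubic_fps * fps_alt phi ^ 3) * fps_alt phi * (modA * \<psi> ^ 4)"
      by (simp add: power_numeral_reduce mult_ac)
    also have "\<dots> = fps_alt phi * \<psi>" by (simp only: Apsi) (simp add: \<psi>_def mult_ac)
    finally show ?thesis by (simp only: alt)
  qed
  \<comment> \<open>A truncated geometric series inverts \<open>1 - 16 * u\<close> modulo
    \<open>2^k\<close>, as \<open>(16 * u)^k\<close> is divisible by \<open>2^k\<close>.\<close>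
  define s where "s = (\<Sum>i<k. (16 * u) ^ i)"
  have "(1 - 16 * u) * s = 1 - (16 * u) ^ k"
    unfolding s_def by (rule one_diff_power_eq[symmetric])
  then have geo: "overcubic_fps * modA * (1 - (16 * u) ^ k) = (1 - 4 * w) * s"
    using b_eq by (metis mult.assoc)
  have pk: "2 ^ k dvd (16 * u) ^ k"
  proof -
    have eq: "16 * u = 2 * (8 * u)" by simp
    show ?thesis unfolding eq power_mult_distrib[of 2] by (rule dvd_triv_left)
  qed
  have "overcubic_fps * modA - (1 - 4 * g) * s =
      overcubic_fps * modA * (16 * u) ^ k - (w - g) * (4 * s)"
    using geo by (simp add: algebra_simps)
  moreover have "2 ^ k dvd overcubic_fps * modA * (16 * u) ^ k - (w - g) * (4 * s)"
    by (rule dvd_diff[OF dvd_mult[OF pk] dvd_mult2[OF g(2)]])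
  ultimately have c1: "2 ^ k dvd overcubic_fps * modA - (1 - 4 * g) * s" by (simp only:)
  have "form_ratio ((1 - 4 * g) * s)"
    unfolding s_def
    by (intro form_ratio_mult form_ratio_diff form_ratio_sum form_ratio_power form_ratio_numeral u g(1))
  then obtain i where i: "int_form i (modA ^ i * ((1 - 4 * g) * s))" unfolding form_ratio_def by blast
  define m where "m = max k (Suc (Suc i))"
  have "Suc (Suc i) \<le> m" by (simp add: m_def)
  moreover have "m < 2 ^ m" by (rule less_exp)
  ultimately have big: "Suc (Suc i) < 2 ^ m" by linarith
  \<comment> \<open>One factor of \<open>modA^(2^m)\<close> is used up by the product
    \<open>overcubic_fps * modA\<close>, hence the \<open>- 1\<close>. The exponent \<open>m\<close>
    is at least \<open>k\<close> so that \<open>modA^(2^m)\<close> is 1 modulo \<open>2^k\<close>,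
    and large enough for \<open>j\<close> to be positive and at least the degree
    \<open>i\<close>.\<close>
  define j where "j = 2 ^ m - (1::nat)"
  have j: "j > 0" "Suc j = 2 ^ m" "i \<le> j" using big by (auto simp: j_def)
  have "int_form ((j - i) + i) (modA ^ (j - i) * (modA ^ i * ((1 - 4 * g) * s)))"
    by (rule int_form_modA_power[OF i])
  then have "int_form j (modA ^ j * ((1 - 4 * g) * s))"
    using j(3) by (simp add: mult.assoc[symmetric] power_add[symmetric])
  then obtain c where c: "modA ^ j * ((1 - 4 * g) * s) = theta_comb j c"
    using int_form_theta_comb by blast
  have "(2::int fps) ^ k dvd 2 ^ m" by (rule le_imp_power_dvd) (simp add: m_def)
  also have "2 ^ m dvd modA ^ (2 ^ m) - 1" by (rule power_two_power_cong_1[OF dvd_modA_minus_1])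
  finally have A1: "2 ^ k dvd modA ^ Suc j - 1" by (simp add: j(2))
  have "overcubic_fps - theta_comb j c =
      modA ^ j * (overcubic_fps * modA - (1 - 4 * g) * s) - overcubic_fps * (modA ^ Suc j - 1)"
    by (simp add: c[symmetric] algebra_simps)
  moreover have "2 ^ k dvd \<dots>" by (intro dvd_diff dvd_mult c1 A1)
  ultimately have "2 ^ k dvd overcubic_fps - theta_comb j c" by (simp only:)
  then show ?thesis using j(1) by blast
qed

theorem theorem1p3:
  fixes k :: nat
  assumes "k > 0"
  shows "((\<lambda>X::real. real (card {n::nat. real n \<le> X \<and> [overcubic_pair n = 0] (mod 2 ^ k)}) / X)
           \<longlongrightarrow> 1) at_top"
proof -
  obtain j c where j: "j > 0" and cong: "2 ^ k dvd overcubic_fps - theta_comb j c"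
    using overcubic_cong_theta_comb by blast
  have "fps_const (2 ^ k) dvd overcubic_fps - theta_comb j c"
    using cong by (simp add: numeral_fps_const fps_const_power)
  then have *: "2 ^ k dvd overcubic_pair n - fps_nth (theta_comb j c) n" for n
    unfolding fps_const_dvd_iff by (simp add: overcubic_fps_def)
  show ?thesis
  proof (rule density_one_if_many_exact_primes[where K = "k * Suc j"])
    fix n S assume "n > 0" "finite S" "card S = k * Suc j"
      and S: "\<And>p. p \<in> S \<Longrightarrow> prime p \<and> odd p \<and> exact_dvd p n"
    then have "2 ^ k dvd fps_nth (theta_comb j c) n" by (intro theta_comb_nth_dvd[OF j]) auto
    then have "2 ^ k dvd (overcubic_pair n - fps_nth (theta_comb j c) n) + fps_nth (theta_comb j c) n"
      by (intro dvd_add *)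
    then show "[overcubic_pair n = 0] (mod 2 ^ k)" by (simp add: cong_0_iff)
  qed
qed

end
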